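(* Let $P=(p_k)_{k\ge 1}$ be a probability distribution on $\{1,2,\dots\}$, let $D\sim P$ with $\mathbb{E}[D]<\infty$, let $K$ have the forward degree distribution $\mathbb{P}[K=k]=(k+1)p_{k+1}/\mathbb{E}[D]$, $k\ge 0$, and let $\nu=\mathbb{E}[K]$. Assume that the random graph sequence $(G_n)_{n\ge 1}$ is locally tree-like with asymptotic degree distribution $P$ and is uniformly sparse. Then, almost surely, the critical temperature $\beta_c$ of $(G_n)_{n\ge1}$ and of the random Bethe tree $\mathcal{T}(D,K,\infty)$ equals $$\beta_c=\operatorname{atanh}(1/\nu).$$
   Context: Ising model on finite graphs: $G_n=(V_n,E_n)$ is a random graph with vertex set $V_n=[n]=\{1,\dots,n\}$ and random edge set $E_n$. For inverse temperature $\beta\ge 0$ and a uniform external field $B\in\mathbb{R}$, the Boltzmann-Gibbs measure on $\sigma\in\{-1,+1\}^n$ is $\mu_n(\sigma)=\frac{1}{Z_n(\beta,B)}\exp\{\beta\sum_{(i,j)\in E_n}\sigma_i\sigma_j+B\sum_{i\in[n]}\sigma_i\}$ with $Z_n(\beta,B)$ the normalizing constant, and $\langle\cdot\rangle_{\mu_n}$ denotes expectation with respect to $\mu_n$. The magnetization per vertex is $M_n(\beta,B)=\frac1n\sum_{i\in[n]}\langle\sigma_i\rangle_{\mu_n}$, and $M(\beta,B)=\lim_{n\to\infty}M_n(\beta,B)$ is its thermodynamic limit (known to exist). Critical temperature: with $f(0^+)=\lim_{x\searrow 0}f(x)$, set $\beta_c=\inf\{\beta: M(\beta,0^+)>0\}$,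 where $M(\beta,0^+)=\lim_{B\searrow0}M(\beta,B)$. When $\nu=\infty$, the value $\operatorname{atanh}(1/\nu)$ is read as $0$. Random trees: $\mathcal{T}(D,K,\ell)$ is the branching process tree with $\ell$ generations in which the root has offspring distributed as $D$ and the vertices in each next generation have offspring numbers that are i.i.d. copies of $K$, independent of the root offspring; $\mathcal{T}(D,K,\infty)$ is the corresponding infinite tree (the random Bethe tree), with root $\phi$. Locally tree-like: $B_i(t)$ is the subgraph of $G_n$ induced by the vertices at graph distance at most $t$ from $i$; $\mathbb{P}_n$ is the law induced on the ball $B_i(t)$ in $G_n$ centred at a uniformly chosen vertex $i\in[n]$; $\simeq$ means that there is a bijective map between the vertices preserving the adjacency relations. $(G_n)_{n\ge1}$ is locally tree-like with asymptotic degree distribution $P$ when, for any rooted tree $\mathcal{T}$ with $t$ generations, $\lim_{n\to\infty}\mathbb{P}_n[B_i(t)\simeq\mathcal{T}]=\mathbb{P}[\mathcal{T}(D,K,t)\simeq\mathcal{T}]$. Uniformly sparse: a.s., $\lim_{\ell\to\infty}\limsup_{n\to\infty}\frac1n\sum_{i\in[n]}D_i\mathbf{1}_{\{D_i\ge\ell\}}=0$, where $D_i$ is the degree of vertex $i$ in $G_n$. Ising model on the random Bethe tree: let $\mu^{+/f}_{t,\beta,B}$ be the Ising model (inverse temperature $\beta$, uniform field $B$) on $\mathcal{T}(D,K,t)$ with $+$, respectively free, boundary conditions. For a function $f$ depending only on $\mathcal{T}(D,K,m)$ with $m\le t$, set $\langle f\rangle_{\mu^{+/f}_{\beta,B}}=\lim_{t\to\infty}\langle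 f\rangle_{\mu^{+/f}_{t,\beta,B}}$; these limits exist and are equal for both boundary conditions when $B>0$, which defines a unique infinite-volume Gibbs measure. For the Bethe tree, $M(\beta,B)$ is the expected root magnetization (the expectation of $\langle\sigma_\phi\rangle$) for this measure, and $\beta_c$ is again defined by $\beta_c=\inf\{\beta:M(\beta,0^+)>0\}$. *)

theory Defs
  imports "HOL-Probability.Probability"
begin

section \<open>Graphs\<close>

text \<open>A simple undirected graph is a vertex set together with a set of two-element sets of vertices.\<close>

type_synonym 'a graph = "'a set \<times> 'a set set"

definition edge_sets :: "'a set \<Rightarrow> 'a set set set" where
  "edge_sets V = Pow {e. e \<subseteq> V \<and> card e = 2}"

definition degree :: "'a set set \<Rightarrow> 'a \<Rightarrow> nat" where
  "degree E v = card {e \<in> E. v \<in> e}"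

definition walk :: "'a set set \<Rightarrow> 'a \<Rightarrow> 'a list \<Rightarrow> 'a \<Rightarrow> bool" where
  "walk E u xs v \<longleftrightarrow>
     xs \<noteq> [] \<and> hd xs = u \<and> last xs = v \<and> successively (\<lambda>x y. {x, y} \<in> E) xs"

text \<open>The distance is \<open>\<infinity>\<close> (the infimum of the empty set) if no walk exists.\<close>

definition graph_dist :: "'a set set \<Rightarrow> 'a \<Rightarrow> 'a \<Rightarrow> enat" where
  "graph_dist E u v = (INF xs \<in> {xs. walk E u xs v}. enat (length xs - 1))"

definition ball_graph :: "'a graph \<Rightarrow> 'a \<Rightarrow> nat \<Rightarrow> 'a graph" where
  "ball_graph = (\<lambda>(V, E) i t.
     let W = {v \<in> V. graph_dist E i v \<le> enat t} in (W, {e \<in> E. e \<subseteq> W}))"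

definition acyclic_graph :: "'a set set \<Rightarrow> bool" where
  "acyclic_graph E \<longleftrightarrow>
     \<not> (\<exists>xs. length xs \<ge> 3 \<and> distinct xs \<and>
            successively (\<lambda>x y. {x, y} \<in> E) xs \<and> {last xs, hd xs} \<in> E)"

definition tree_graph :: "'a graph \<Rightarrow> bool" where
  "tree_graph = (\<lambda>(V, E). V \<noteq> {} \<and> E \<in> edge_sets V \<and>
     (\<forall>u\<in>V. \<forall>v\<in>V. graph_dist E u v < \<infinity>) \<and> acyclic_graph E)"

text \<open>A rooted tree with \<open>t\<close> generations may die out before generation \<open>t\<close>, as the branching
  process itself may; so the condition is that its height is at most \<open>t\<close>.\<close>

definition rooted_tree_gen :: "nat \<Rightarrow> 'a graph \<Rightarrow> 'a \<Rightarrow> bool" where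
  "rooted_tree_gen t T r \<longleftrightarrow>
     tree_graph T \<and> r \<in> fst T \<and> (\<forall>v \<in> fst T. graph_dist (snd T) r v \<le> enat t)"

text \<open>Isomorphisms of rooted graphs also map the root to the root.\<close>

definition rooted_iso :: "'a graph \<Rightarrow> 'a \<Rightarrow> 'b graph \<Rightarrow> 'b \<Rightarrow> bool" where
  "rooted_iso = (\<lambda>(V, E) r (V', E') r'. \<exists>f. bij_betw f V V' \<and> f r = r' \<and>
     (\<forall>u\<in>V. \<forall>v\<in>V. {u, v} \<in> E \<longleftrightarrow> {f u, f v} \<in> E'))"


section \<open>Random trees\<close>

text \<open>Ulam--Harris encoding: vertices are lists of naturals, the root is \<open>[]\<close>, and \<open>X v\<close> is the
  number of children of \<open>v\<close>, which are \<open>v @ [0], \<dots>, v @ [X v - 1]\<close>. The offspring numbers are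
  independent, also those attached to lists that turn out not to be vertices of the tree.\<close>

definition offspring_law :: "nat pmf \<Rightarrow> nat pmf \<Rightarrow> (nat list \<Rightarrow> nat) measure" where
  "offspring_law D K = (\<Pi>\<^sub>M v\<in>UNIV. measure_pmf (if v = [] then D else K))"

definition gw_vertices :: "(nat list \<Rightarrow> nat) \<Rightarrow> nat list set" where
  "gw_vertices X = {v. \<forall>k < length v. v ! k < X (take k v)}"

text \<open>The tree up to and including generation \<open>t\<close>; under \<^term>\<open>offspring_law D K\<close> it
  is \<open>\<T>(D, K, t)\<close>.\<close>

definition gw_tree :: "(nat list \<Rightarrow> nat) \<Rightarrow> nat \<Rightarrow> nat list graph" where
  "gw_tree X t = (let V = {v \<in> gw_vertices X. length v \<le> t}
                  in (V, {{u, u @ [j]} | u j. u @ [j] \<in> V}))"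


section \<open>Assumptions on graph sequences\<close>

text \<open>The following two predicates concern one realisation \<open>E n\<close> (\<open>n \<ge> 1\<close>) of the edge sets, where
  \<open>E n\<close> is the edge set of a graph on \<open>{1..n}\<close>; in particular only the centre of the ball is random
  in the first one. Quantifying over trees on subsets of the naturals covers all countable trees up to
  isomorphism.\<close>

definition locally_tree_like :: "nat pmf \<Rightarrow> nat pmf \<Rightarrow> (nat \<Rightarrow> nat set set) \<Rightarrow> bool" where
  "locally_tree_like D K E \<longleftrightarrow>
     (\<forall>t (T :: nat graph) r. rooted_tree_gen t T r \<longrightarrow>
        (\<lambda>n. measure_pmf.prob (pmf_of_set {1..n})
               {i. rooted_iso (ball_graph ({1..n}, E n) i t) i T r})
        \<longlonglongrightarrow> measure (offspring_law D K) {X. rooted_iso (gw_tree X t) [] T r})"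

definition uniformly_sparse :: "(nat \<Rightarrow> nat set set) \<Rightarrow> bool" where
  "uniformly_sparse E \<longleftrightarrow>
     (\<lambda>l::nat. limsup (\<lambda>n. ereal (1 / real n *
        (\<Sum>i\<in>{1..n}. real (degree (E n) i) * of_bool (degree (E n) i \<ge> l))))) \<longlonglongrightarrow> 0"


section \<open>Ising model\<close>

text \<open>Spin configurations on \<open>V\<close> with the spins in \<open>A\<close> fixed to be \<open>+1\<close>; free boundary conditions
  correspond to \<open>A = {}\<close>.\<close>

definition spin_configs :: "'a set \<Rightarrow> 'a set \<Rightarrow> ('a \<Rightarrow> real) set" where
  "spin_configs V A = {\<sigma> \<in> V \<rightarrow>\<^sub>E {-1, 1}. \<forall>v\<in>A. \<sigma> v = 1}"

text \<open>For an edge \<open>e = {i, j}\<close> the product over \<open>e\<close> is \<open>\<sigma> i * \<sigma> j\<close>; every unordered edge is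
  counted once.\<close>

definition boltzmann_weight :: "real \<Rightarrow> real \<Rightarrow> 'a graph \<Rightarrow> ('a \<Rightarrow> real) \<Rightarrow> real" where
  "boltzmann_weight \<beta> B = (\<lambda>(V, E) \<sigma>.
     exp (\<beta> * (\<Sum>e\<in>E. \<Prod>v\<in>e. \<sigma> v) + B * (\<Sum>v\<in>V. \<sigma> v)))"

definition partition_function :: "real \<Rightarrow> real \<Rightarrow> 'a graph \<Rightarrow> 'a set \<Rightarrow> real" where
  "partition_function \<beta> B H A = (\<Sum>\<sigma>\<in>spin_configs (fst H) A. boltzmann_weight \<beta> B H \<sigma>)"

definition ising_prob :: "real \<Rightarrow> real \<Rightarrow> 'a graph \<Rightarrow> 'a set \<Rightarrow> ('a \<Rightarrow> real) \<Rightarrow> real" where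
  "ising_prob \<beta> B H A \<sigma> = boltzmann_weight \<beta> B H \<sigma> / partition_function \<beta> B H A"

definition ising_expectation ::
  "real \<Rightarrow> real \<Rightarrow> 'a graph \<Rightarrow> 'a set \<Rightarrow> (('a \<Rightarrow> real) \<Rightarrow> real) \<Rightarrow> real" where
  "ising_expectation \<beta> B H A f = (\<Sum>\<sigma>\<in>spin_configs (fst H) A. f \<sigma> * ising_prob \<beta> B H A \<sigma>)"

definition finite_magnetization :: "(nat \<Rightarrow> nat set set) \<Rightarrow> nat \<Rightarrow> real \<Rightarrow> real \<Rightarrow> real" where
  "finite_magnetization E n \<beta> B =
     1 / real n * (\<Sum>i\<in>{1..n}. ising_expectation \<beta> B ({1..n}, E n) {} (\<lambda>\<sigma>. \<sigma> i))"

definition magnetization :: "(nat \<Rightarrow> nat set set) \<Rightarrow> real \<Rightarrow> real \<Rightarrow> real" where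
  "magnetization E \<beta> B = lim (\<lambda>n. finite_magnetization E n \<beta> B)"

text \<open>Plus boundary conditions on the tree with \<open>t\<close> generations: all spins in generation \<open>t\<close>
  are \<open>+1\<close>.\<close>

definition tree_expectation_plus ::
  "real \<Rightarrow> real \<Rightarrow> (nat list \<Rightarrow> nat) \<Rightarrow> nat \<Rightarrow> ((nat list \<Rightarrow> real) \<Rightarrow> real) \<Rightarrow> real" where
  "tree_expectation_plus \<beta> B X t f =
     ising_expectation \<beta> B (gw_tree X t) {v \<in> fst (gw_tree X t). length v = t} f"

definition tree_expectation_free ::
  "real \<Rightarrow> real \<Rightarrow> (nat list \<Rightarrow> nat) \<Rightarrow> nat \<Rightarrow> ((nat list \<Rightarrow> real) \<Rightarrow> real) \<Rightarrow> real" where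
  "tree_expectation_free \<beta> B X t f = ising_expectation \<beta> B (gw_tree X t) {} f"

text \<open>The infinite-volume expectation of a local function on the infinite tree is the common limit
  for both boundary conditions. For \<open>B > 0\<close> it exists for almost every tree.\<close>

definition bethe_expectation ::
  "real \<Rightarrow> real \<Rightarrow> (nat list \<Rightarrow> nat) \<Rightarrow> ((nat list \<Rightarrow> real) \<Rightarrow> real) \<Rightarrow> real" where
  "bethe_expectation \<beta> B X f = (THE m.
     (\<lambda>t. tree_expectation_plus \<beta> B X t f) \<longlonglongrightarrow> m \<and>
     (\<lambda>t. tree_expectation_free \<beta> B X t f) \<longlonglongrightarrow> m)"

definition bethe_magnetization :: "nat pmf \<Rightarrow> nat pmf \<Rightarrow> real \<Rightarrow> real \<Rightarrow> real" where
  "bethe_magnetization D K \<beta> B =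
     (\<integral>X. bethe_expectation \<beta> B X (\<lambda>\<sigma>. \<sigma> []) \<partial>offspring_law D K)"


section \<open>Critical temperature\<close>

text \<open>The argument is the function \<open>M(\<beta>, B)\<close>. The infimum is taken in the extended reals, so the
  value is \<open>\<infinity>\<close> if there is no spontaneous magnetization at any \<open>\<beta>\<close>.\<close>

definition critical_temperature :: "(real \<Rightarrow> real \<Rightarrow> real) \<Rightarrow> ereal" where
  "critical_temperature M =
     Inf (ereal ` {\<beta>. \<beta> \<ge> 0 \<and> Lim (at_right 0) (\<lambda>B. M \<beta> B) > 0})"

text \<open>The inverse hyperbolic tangent on \<open>[0, \<infinity>]\<close>, with value \<open>\<infinity>\<close> from \<open>1\<close> on. Together with
  \<open>1 / \<infinity> = 0\<close> and \<open>1 / 0 = \<infinity>\<close> in \<^typ>\<open>ennreal\<close>, \<open>ext_artanh (1 / \<nu>)\<close> is \<open>0\<close> for \<open>\<nu> = \<infinity>\<close>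
  and \<open>\<infinity>\<close> for \<open>\<nu> \<le> 1\<close>.\<close>

definition ext_artanh :: "ennreal \<Rightarrow> ereal" where
  "ext_artanh x = (if x < 1 then ereal (artanh (enn2real x)) else \<infinity>)"

end

theory Submission imports Defs begin

text \<open>On a tree the Ising model is solved from the leaves upwards. A vertex \<open>v\<close>, with the part of the tree
below it summed out, feels an effective field \<open>h v\<close>, and \<open>h v = B + (\<Sum>w. \<xi> (h w))\<close> over the
children \<open>w\<close> of \<open>v\<close>, where \<open>tanh (\<xi> h) = tanh \<beta> * tanh h\<close> (\<open>\<xi>\<close> is
\<open>passed_field \<beta>\<close> below); the root magnetization is
\<open>tanh\<close> of the field at the root. On \<open>[0, \<infinity>)\<close> the map \<open>\<xi>\<close> is nondecreasing and concave, is
bounded by \<open>\<beta>\<close>, and satisfies \<open>tanh \<beta> * (h - h\<^sup>2) \<le> \<xi> h \<le> tanh \<beta> * h\<close>. Everything about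
trees follows from these properties.

\<^bold>\<open>Free and plus boundary conditions agree.\<close> Let \<open>F t s\<close> be the root field when the field
at a vertex \<open>v\<close> of generation \<open>t\<close> is \<open>B + s * X v\<close>, with \<open>X v\<close> its number of children. Then
\<open>s = 0\<close> is the free condition on \<open>t\<close> generations, \<open>s = \<xi> B\<close> the free condition on \<open>t + 1\<close>
generations, and \<open>s = \<beta>\<close> the plus condition on \<open>t + 1\<close> generations. As \<open>F t\<close> is concave in
\<open>s\<close>, the gap between plus and free is at most \<open>\<beta> / \<xi> B\<close> times an increment of the free fields,
which are increasing and bounded. So for \<open>B > 0\<close> the two limits coincide on every locally finite
tree (\<open>tree_field_limits_agree\<close>).

\<^bold>\<open>Graphs behave like the tree.\<close> By Griffiths' inequalities the magnetization at a vertex \<open>i\<close>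
lies between the values at \<open>i\<close> in the ball of radius \<open>t\<close> with free and with plus boundary. When the
ball is a tree these are the two tree values, and local convergence turns frequencies of balls into
probabilities of trees. Letting \<open>n\<close> and then \<open>t\<close> tend to infinity shows that \<open>M(\<beta>, B)\<close> of the graphs
exists and equals that of the Bethe tree for all \<open>\<beta> \<ge> 0\<close>, \<open>B > 0\<close> (\<open>magnetization_eq_bethe\<close>). Hence
both critical temperatures are those of one function.

\<^bold>\<open>The threshold.\<close> Write \<open>\<theta> = tanh \<beta>\<close>. If \<open>\<theta> * \<nu> < 1\<close>, the upper bound on \<open>\<xi>\<close> makes the
mean field at most \<open>B / (1 - \<theta> * \<nu>)\<close>, so \<open>M(\<beta>, B)\<close> is \<open>O(B)\<close>. If \<open>\<theta> * \<nu> > 1\<close>, truncate all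
offspring numbers at a large \<open>N\<close> and lower \<open>\<beta>\<close> until the growth rate \<open>l\<close> of the truncated tree
satisfies \<open>l > 1\<close> but \<open>l * \<theta>' < 1\<close>, with \<open>\<theta>'\<close> the lowered value of \<open>\<theta>\<close>; both operations only decrease the fields. For the limiting first
and second moments \<open>y\<close> and \<open>z\<close> of the field, the lower bound on \<open>\<xi>\<close> gives \<open>(l - 1) * y \<le> l * z\<close>, and
independence of the subtrees gives \<open>(1 - l * \<theta>') * z \<le> const * y\<^sup>2\<close>. Together they bound \<open>y\<close>
below by a constant that does not depend on \<open>B\<close> (\<open>truncated_field_mean_lower\<close>). An infimum is
determined by these two open cases.\<close>

section \<open>The field a child passes to its parent\<close>

text \<open>A spin with effective field \<open>h\<close>, coupled to its parent with strength \<open>\<beta>\<close> and then summed out, acts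
on the parent like this external field.\<close>

definition passed_field :: "real \<Rightarrow> real \<Rightarrow> real" where
  "passed_field \<beta> h = artanh (tanh \<beta> * tanh h)"

lemma tanh_artanh_real:
  fixes x :: real assumes "\<bar>x\<bar> < 1" shows "tanh (artanh x) = x"
proof -
  have p: "(1 + x) / (1 - x) > 0" using assms by (auto simp: field_simps)
  have "tanh (artanh x) = ((1 + x) / (1 - x) - 1) / ((1 + x) / (1 - x) + 1)"
    using p assms by (auto simp: artanh_def tanh_altdef exp_minus exp_ln field_simps simp flip: exp_add)
  also have "\<dots> = x" using assms by (auto simp: field_simps)
  finally show ?thesis .
qed

lemma abs_tanh_lt_1: "\<bar>tanh (x::real)\<bar> < 1"
  using tanh_real_bounds[of x] by auto

lemma abs_tanh_mult_lt_1: "\<bar>tanh (x::real) * tanh (y::real)\<bar> < 1"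
  using mult_strict_mono'[OF abs_tanh_lt_1[of x] abs_tanh_lt_1[of y]] by (simp add: abs_mult)

lemma tanh_passed_field: "tanh (passed_field \<beta> h) = tanh \<beta> * tanh h"
  unfolding passed_field_def by (rule tanh_artanh_real[OF abs_tanh_mult_lt_1])

lemma passed_field_0 [simp]: "passed_field \<beta> 0 = 0" "passed_field 0 h = 0"
  by (simp_all add: passed_field_def)

lemma passed_field_mono: "\<lbrakk>0 \<le> \<beta>; \<beta> \<le> \<beta>'; 0 \<le> h; h \<le> h'\<rbrakk> \<Longrightarrow> passed_field \<beta> h \<le> passed_field \<beta>' h'"
  by (subst tanh_real_le_iff[symmetric]) (simp add: tanh_passed_field mult_mono)

lemma passed_field_nonneg: "\<lbrakk>0 \<le> \<beta>; 0 \<le> h\<rbrakk> \<Longrightarrow> 0 \<le> passed_field \<beta> h"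
  by (subst tanh_real_nonneg_iff[symmetric]) (simp add: tanh_passed_field)

lemma passed_field_pos: "\<lbrakk>0 < \<beta>; 0 < h\<rbrakk> \<Longrightarrow> 0 < passed_field \<beta> h"
  by (subst tanh_real_pos_iff[symmetric]) (simp add: tanh_passed_field)

lemma passed_field_le: "\<lbrakk>0 \<le> \<beta>; 0 \<le> h\<rbrakk> \<Longrightarrow> passed_field \<beta> h \<le> \<beta>"
  using mult_left_le[of "tanh h" "tanh \<beta>"]
  by (subst tanh_real_le_iff[symmetric]) (simp add: tanh_passed_field less_imp_le[OF tanh_real_lt_1])

lemma DERIV_passed_field:
  "(passed_field \<beta> has_real_derivative
     tanh \<beta> * (1 - tanh h ^ 2) / (1 - (tanh \<beta> * tanh h) ^ 2)) (at h within S)"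
proof -
  have "((\<lambda>h. tanh \<beta> * tanh h) has_real_derivative tanh \<beta> * (1 - tanh h ^ 2)) (at h within S)"
    by (auto intro!: derivative_eq_intros)
  from DERIV_chain2[OF artanh_real_has_field_derivative[OF abs_tanh_mult_lt_1] this]
  show ?thesis by (simp add: passed_field_def[abs_def])
qed

lemma isCont_passed_field: "isCont (passed_field \<beta>) h"
  by (rule DERIV_isCont[OF DERIV_passed_field])

text \<open>The derivative \<open>\<theta> * (1 - u) / (1 - \<theta>\<^sup>2 * u)\<close> with \<open>\<theta> = tanh \<beta>\<close>, \<open>u = tanh\<^sup>2 h\<close>
decreases in \<open>u\<close> because \<open>\<theta>\<^sup>2 < 1\<close>.\<close>

lemma passed_field_concave:
  assumes "0 \<le> \<beta>" "0 \<le> a" "0 \<le> b" "0 \<le> s" "s \<le> 1"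
  shows "(1 - s) * passed_field \<beta> a + s * passed_field \<beta> b \<le> passed_field \<beta> ((1 - s) * a + s * b)"
proof -
  have "convex_on {0..} (\<lambda>h. - passed_field \<beta> h)"
  proof (rule convex_on_realI)
    fix x y :: real assume xy: "x \<in> {0..}" "y \<in> {0..}" "x \<le> y"
    let ?q = "tanh \<beta>" and ?u = "tanh x ^ 2" and ?v = "tanh y ^ 2"
    have uv: "?u \<le> ?v" using xy by (intro power_mono) auto
    have lt: "(?q * tanh z)^2 < 1" for z
      using abs_tanh_mult_lt_1[of \<beta> z] by (simp add: abs_square_less_1)
    have q2: "?q^2 < 1" using abs_tanh_lt_1[of \<beta>] by (simp add: abs_square_less_1)
    have "(1 - ?v) * (1 - ?q^2 * ?u) \<le> (1 - ?u) * (1 - ?q^2 * ?v)"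
    proof -
      have "0 \<le> (1 - ?q^2) * (?v - ?u)" using q2 uv by auto
      then show ?thesis by (simp add: algebra_simps)
    qed
    then have "(1 - ?v) / (1 - (?q * tanh y)^2) \<le> (1 - ?u) / (1 - (?q * tanh x)^2)"
      using lt[of x] lt[of y] by (simp add: frac_le_eq divide_le_eq field_simps power_mult_distrib)
    then have "?q * ((1 - ?v) / (1 - (?q * tanh y)^2)) \<le> ?q * ((1 - ?u) / (1 - (?q * tanh x)^2))"
      using assms(1) by (intro mult_left_mono) auto
    then show "- (?q * (1 - ?u) / (1 - (?q * tanh x)^2)) \<le> - (?q * (1 - ?v) / (1 - (?q * tanh y)^2))"
      by simp
  qed (auto intro!: DERIV_minus DERIV_passed_field)
  from convex_onD[OF this, of s a b] assms show ?thesis by simp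
qed

lemma passed_field_le_mult:
  assumes "0 \<le> \<beta>" "0 \<le> h" shows "passed_field \<beta> h \<le> tanh \<beta> * h"
proof -
  have "tanh \<beta> * 0 - passed_field \<beta> 0 \<le> tanh \<beta> * h - passed_field \<beta> h"
  proof (rule DERIV_nonneg_imp_nondecreasing[OF assms(2)])
    fix x assume x: "0 \<le> x" "x \<le> h"
    have q2: "tanh \<beta>^2 \<le> 1" using abs_tanh_lt_1[of \<beta>] by (simp add: abs_square_le_1)
    have lt: "(tanh \<beta> * tanh x)^2 < 1"
      using abs_tanh_mult_lt_1[of \<beta> x] by (simp add: abs_square_less_1)
    have "(tanh \<beta> * tanh x)^2 \<le> tanh x ^ 2"
      using mult_right_mono[OF q2, of "tanh x ^ 2"] by (simp add: power_mult_distrib)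
    then have "(1 - tanh x ^ 2) / (1 - (tanh \<beta> * tanh x)^2) \<le> 1" using lt by simp
    then have "tanh \<beta> * ((1 - tanh x ^ 2) / (1 - (tanh \<beta> * tanh x)^2)) \<le> tanh \<beta> * 1"
      using assms(1) by (intro mult_left_mono) auto
    then show "\<exists>y. ((\<lambda>h. tanh \<beta> * h - passed_field \<beta> h) has_real_derivative y) (at x) \<and> 0 \<le> y"
      by (intro exI[of _ "tanh \<beta> - tanh \<beta> * (1 - tanh x ^ 2) / (1 - (tanh \<beta> * tanh x) ^ 2)"] conjI)
         (auto intro!: derivative_eq_intros DERIV_passed_field)
  qed
  then show ?thesis by simp
qed

text \<open>Rewritten, this is \<open>1 + 2 * x \<le> exp (2 * x)\<close>. The bound serves twice: it yields the quadratic
lower bound on the passed field, and it turns a bounded field into a comparable magnetization.\<close>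

lemma tanh_ge_rational:
  fixes x :: real assumes "0 \<le> x" shows "x / (1 + x) \<le> tanh x"
proof -
  have "exp (- (2 * x)) * (1 + 2 * x) \<le> exp (- (2 * x)) * exp (2 * x)"
    using exp_ge_add_one_self[of "2 * x"] by (intro mult_left_mono) auto
  then have "exp (- (2 * x)) * (1 + 2 * x) \<le> 1" by (simp flip: exp_add)
  then show ?thesis using assms by (simp add: tanh_real_altdef field_simps add_pos_pos)
qed

lemma tanh_le_self: fixes x :: real assumes "0 \<le> x" shows "tanh x \<le> x"
proof -
  have "0 - tanh 0 \<le> x - tanh x"
    by (rule DERIV_nonneg_imp_nondecreasing[OF assms])
       (auto intro!: exI[of _ "tanh _ ^ 2"] derivative_eq_intros)
  then show ?thesis by simp
qed

text \<open>The linear coefficient must be exactly \<open>tanh \<beta>\<close>, since that is what decides whether fields grow;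
any quadratic error is harmless, because it is absorbed by second moments.\<close>

lemma passed_field_ge_quadratic:
  assumes "0 \<le> \<beta>" "0 \<le> h" shows "tanh \<beta> * (h - h^2) \<le> passed_field \<beta> h"
proof -
  have "(h - h^2) * (1 + h) \<le> h" using assms zero_le_power[of h 3] by (simp add: algebra_simps power2_eq_square power3_eq_cube)
  then have "h - h^2 \<le> h / (1 + h)" using assms by (simp add: field_simps)
  also have "\<dots> \<le> tanh h" using assms by (intro tanh_ge_rational)
  finally have "tanh \<beta> * (h - h^2) \<le> tanh \<beta> * tanh h"
    using assms by (intro mult_left_mono) auto
  also have "\<dots> \<le> passed_field \<beta> h" using tanh_le_self[OF passed_field_nonneg[OF assms]] by (simp add: tanh_passed_field)
  finally show ?thesis .
qed

section \<open>Griffiths inequalities and comparison with subgraphs\<close>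

lemma spin_configs_eq_PiE:
  assumes "A \<subseteq> V" shows "spin_configs V A = PiE V (\<lambda>v. if v \<in> A then {1} else {-1, 1})"
  using assms unfolding spin_configs_def
  by (auto simp: PiE_iff extensional_def split: if_splits)

lemma finite_spin_configs: "finite V \<Longrightarrow> finite (spin_configs V A)"
  unfolding spin_configs_def by (rule finite_subset[of _ "V \<rightarrow>\<^sub>E {-1, 1}"]) (auto intro!: finite_PiE)

lemma spin_configs_nonempty: "A \<subseteq> V \<Longrightarrow> spin_configs V A \<noteq> {}"
  by (auto simp: spin_configs_eq_PiE PiE_eq_empty_iff)

lemma spin_value: "\<sigma> \<in> spin_configs V A \<Longrightarrow> v \<in> V \<Longrightarrow> \<sigma> v = -1 \<or> \<sigma> v = 1"
  unfolding spin_configs_def by auto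

lemma spin_prod_value:
  assumes "\<sigma> \<in> spin_configs V A" "p \<subseteq> V" "finite V"
  shows "(\<Prod>v\<in>p. \<sigma> v) = -1 \<or> (\<Prod>v\<in>p. \<sigma> v) = 1"
proof -
  have "finite p" using assms finite_subset by blast
  then show ?thesis using assms(2)
    by (induction p) (use spin_value[OF assms(1)] in force)+
qed

text \<open>Griffiths' first inequality, for arbitrary monomials and with the spins in \<open>A\<close> fixed to \<open>+1\<close>. A
factor \<open>exp (c * s)\<close> with \<open>s = \<plusminus>1\<close> equals \<open>cosh c + s * sinh c\<close>, so couplings can be peeled off one
at a time at the price of new monomials with nonnegative coefficients. Allowing exponents \<open>a v\<close>
instead of sets of vertices keeps the class of monomials closed under multiplication.\<close>

lemma griffiths_first:
  assumes V: "finite V" "A \<subseteq> V" and F: "finite F" "\<And>p. p \<in> F \<Longrightarrow> p \<subseteq> V"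
    and c: "\<And>p. p \<in> F \<Longrightarrow> 0 \<le> c p"
  shows "0 \<le> (\<Sum>\<sigma>\<in>spin_configs V A. (\<Prod>v\<in>V. \<sigma> v ^ a v) * exp (\<Sum>p\<in>F. c p * (\<Prod>v\<in>p. \<sigma> v :: real)))"
  using F c
proof (induction F arbitrary: a rule: finite_induct)
  case empty
  have "(\<Sum>\<sigma>\<in>spin_configs V A. \<Prod>v\<in>V. \<sigma> v ^ a v)
      = (\<Prod>v\<in>V. \<Sum>s\<in>(if v \<in> A then {1} else {-1, 1::real}). s ^ a v)"
    using V by (subst prod_sum_PiE) (auto simp: spin_configs_eq_PiE)
  also have "0 \<le> \<dots>"
    by (intro prod_nonneg) (auto simp: minus_one_power_iff)
  finally show ?case by simp
next
  case (insert p F)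
  let ?w = "\<lambda>\<sigma>. exp (\<Sum>p\<in>F. c p * (\<Prod>v\<in>p. \<sigma> v :: real))"
  have p: "p \<subseteq> V" "0 \<le> c p" using insert.prems by auto
  have step: "(\<Prod>v\<in>V. \<sigma> v ^ a v) * exp (\<Sum>p\<in>insert p F. c p * (\<Prod>v\<in>p. \<sigma> v))
      = cosh (c p) * ((\<Prod>v\<in>V. \<sigma> v ^ a v) * ?w \<sigma>)
        + sinh (c p) * ((\<Prod>v\<in>V. \<sigma> v ^ (a v + of_bool (v \<in> p))) * ?w \<sigma>)"
    if \<sigma>: "\<sigma> \<in> spin_configs V A" for \<sigma>
  proof -
    have "(\<Prod>v\<in>V. \<sigma> v ^ of_bool (v \<in> p)) = (\<Prod>v\<in>p. \<sigma> v)"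
      using p(1) V(1) by (intro prod.mono_neutral_cong_right) auto
    then have "(\<Prod>v\<in>V. \<sigma> v ^ (a v + of_bool (v \<in> p))) = (\<Prod>v\<in>V. \<sigma> v ^ a v) * (\<Prod>v\<in>p. \<sigma> v)"
      by (simp add: power_add prod.distrib)
    moreover have "exp (c p * (\<Prod>v\<in>p. \<sigma> v)) = cosh (c p) + sinh (c p) * (\<Prod>v\<in>p. \<sigma> v)"
      using spin_prod_value[OF \<sigma> p(1) V(1)] by (auto simp: cosh_plus_sinh cosh_minus_sinh)
    ultimately show ?thesis using insert.hyps by (simp add: exp_add algebra_simps)
  qed
  have "0 \<le> cosh (c p) * (\<Sum>\<sigma>\<in>spin_configs V A. (\<Prod>v\<in>V. \<sigma> v ^ a v) * ?w \<sigma>)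
        + sinh (c p) * (\<Sum>\<sigma>\<in>spin_configs V A. (\<Prod>v\<in>V. \<sigma> v ^ (a v + of_bool (v \<in> p))) * ?w \<sigma>)"
    using insert p(2) by (intro add_nonneg_nonneg mult_nonneg_nonneg insert.IH) auto
  also have "\<dots> = (\<Sum>\<sigma>\<in>spin_configs V A. (\<Prod>v\<in>V. \<sigma> v ^ a v) *
      exp (\<Sum>p\<in>insert p F. c p * (\<Prod>v\<in>p. \<sigma> v)))"
    by (simp add: step sum.distrib sum_distrib_left cong: sum.cong)
  finally show ?case .
qed

text \<open>Expectations for an arbitrary energy function, so that one system can be compared with another one
whose couplings are not those of an Ising model with a single \<open>\<beta>\<close> and \<open>B\<close>.\<close>

definition gibbs_mean ::
  "'a set \<Rightarrow> 'a set \<Rightarrow> (('a \<Rightarrow> real) \<Rightarrow> real) \<Rightarrow> (('a \<Rightarrow> real) \<Rightarrow> real) \<Rightarrow> real" where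
  "gibbs_mean V A H f = (\<Sum>\<sigma>\<in>spin_configs V A. f \<sigma> * exp (H \<sigma>)) / (\<Sum>\<sigma>\<in>spin_configs V A. exp (H \<sigma>))"

lemma gibbs_normalizer_pos:
  assumes "finite V" "A \<subseteq> V" shows "0 < (\<Sum>\<sigma>\<in>spin_configs V A. exp (H \<sigma> :: real))"
  using assms by (intro sum_pos finite_spin_configs spin_configs_nonempty) auto

definition coupling_energy :: "'a set set \<Rightarrow> ('a set \<Rightarrow> real) \<Rightarrow> ('a \<Rightarrow> real) \<Rightarrow> real" where
  "coupling_energy F J \<sigma> = (\<Sum>p\<in>F. J p * (\<Prod>v\<in>p. \<sigma> v))"

text \<open>Ginibre's duplication argument in a form that compares two different systems directly. Take
independent configurations \<open>\<sigma>\<close> and \<open>\<sigma>'\<close> from the stronger and the weaker system. Substituting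
\<open>\<sigma>' = \<sigma> * \<tau>\<close> turns the numerator of the difference of magnetizations into a sum over \<open>\<tau>\<close> of
\<open>1 - \<tau> i \<ge> 0\<close> times a sum over \<open>\<sigma>\<close> with couplings \<open>J p + J' p * \<tau> p \<ge> 0\<close>, where Griffiths' first
inequality applies. Fixing more spins (\<open>A' \<subseteq> A\<close>) is allowed since the substitution preserves the
constraint \<open>\<sigma>' = 1\<close> on \<open>A'\<close>.\<close>

lemma griffiths_comparison:
  assumes V: "finite V" "A \<subseteq> V" "A' \<subseteq> A" and F: "finite F" "\<And>p. p \<in> F \<Longrightarrow> p \<subseteq> V"
    and J: "\<And>p. p \<in> F \<Longrightarrow> 0 \<le> J' p" "\<And>p. p \<in> F \<Longrightarrow> J' p \<le> J p" and i: "i \<in> V"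
  shows "gibbs_mean V A' (coupling_energy F J') (\<lambda>\<sigma>. \<sigma> i) \<le> gibbs_mean V A (coupling_energy F J) (\<lambda>\<sigma>. \<sigma> i)"
proof -
  let ?S = "spin_configs V A" and ?S' = "spin_configs V A'"
  define w where "w = (\<lambda>\<sigma>. exp (coupling_energy F J \<sigma>))"
  define w' where "w' = (\<lambda>\<sigma>. exp (coupling_energy F J' \<sigma>))"
  \<comment> \<open>Multiplication of configurations; \<open>mul \<sigma>\<close> is an involution because spins square to 1.\<close>
  define mul where "mul = (\<lambda>\<sigma> \<tau> :: 'a \<Rightarrow> real. restrict (\<lambda>v. \<sigma> v * \<tau> v) V)"
  have mul_mul: "mul \<sigma> (mul \<sigma> \<tau>) = \<tau>" if "\<sigma> \<in> ?S" "\<tau> \<in> ?S'" for \<sigma> \<tau>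
  proof
    fix v show "mul \<sigma> (mul \<sigma> \<tau>) v = \<tau> v"
      using spin_value[OF that(1), of v] that(2)
      by (cases "v \<in> V") (auto simp: mul_def spin_configs_def PiE_iff extensional_def)
  qed
  have mul_in: "mul \<sigma> \<tau> \<in> ?S'" if "\<sigma> \<in> ?S" "\<tau> \<in> ?S'" for \<sigma> \<tau>
    using that V unfolding mul_def spin_configs_def by (force simp: PiE_iff)
  have mul_prod: "(\<Prod>v\<in>p. mul \<sigma> \<tau> v) = (\<Prod>v\<in>p. \<sigma> v) * (\<Prod>v\<in>p. \<tau> v)" if "p \<subseteq> V" for p \<sigma> \<tau>
    using that by (subst prod.distrib[symmetric]) (intro prod.cong, auto simp: mul_def)
  have reindex: "(\<Sum>\<sigma>'\<in>?S'. g \<sigma>') = (\<Sum>\<tau>\<in>?S'. g (mul \<sigma> \<tau>))" if "\<sigma> \<in> ?S" for \<sigma> and g :: "_ \<Rightarrow> real"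
    by (rule sum.reindex_bij_witness[of _ "mul \<sigma>" "mul \<sigma>"]) (use that mul_mul mul_in in auto)
  have "(\<Sum>\<sigma>\<in>?S. \<Sum>\<sigma>'\<in>?S'. (\<sigma> i - \<sigma>' i) * (w \<sigma> * w' \<sigma>'))
      = (\<Sum>\<sigma>\<in>?S. \<Sum>\<tau>\<in>?S'. (1 - \<tau> i) * (\<sigma> i * exp (coupling_energy F (\<lambda>p. J p + J' p * (\<Prod>v\<in>p. \<tau> v)) \<sigma>)))"
  proof (rule sum.cong[OF refl])
    fix \<sigma> assume \<sigma>: "\<sigma> \<in> ?S"
    have "(\<sigma> i - mul \<sigma> \<tau> i) * (w \<sigma> * w' (mul \<sigma> \<tau>)) =
      (1 - \<tau> i) * (\<sigma> i * exp (coupling_energy F (\<lambda>p. J p + J' p * (\<Prod>v\<in>p. \<tau> v)) \<sigma>))" for \<tau>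
      unfolding w_def w'_def coupling_energy_def
      by (simp add: mul_prod F(2) flip: exp_add sum.distrib cong: sum.cong)
         (simp add: mul_def i algebra_simps)
    then show "(\<Sum>\<sigma>'\<in>?S'. (\<sigma> i - \<sigma>' i) * (w \<sigma> * w' \<sigma>')) =
      (\<Sum>\<tau>\<in>?S'. (1 - \<tau> i) * (\<sigma> i * exp (coupling_energy F (\<lambda>p. J p + J' p * (\<Prod>v\<in>p. \<tau> v)) \<sigma>)))"
      by (subst reindex[OF \<sigma>]) simp
  qed
  also have "\<dots> = (\<Sum>\<tau>\<in>?S'. (1 - \<tau> i) * (\<Sum>\<sigma>\<in>?S. \<sigma> i * exp (coupling_energy F (\<lambda>p. J p + J' p * (\<Prod>v\<in>p. \<tau> v)) \<sigma>)))"
    by (subst sum.swap) (simp add: sum_distrib_left)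
  also have "0 \<le> \<dots>"
  proof (rule sum_nonneg, rule mult_nonneg_nonneg)
    fix \<tau> assume \<tau>: "\<tau> \<in> ?S'"
    show "0 \<le> 1 - \<tau> i" using spin_value[OF \<tau> i] by auto
    have "0 \<le> J p + J' p * (\<Prod>v\<in>p. \<tau> v)" if "p \<in> F" for p
      using spin_prod_value[OF \<tau> F(2)[OF that] V(1)] J[OF that] by auto
    then have "0 \<le> (\<Sum>\<sigma>\<in>?S. (\<Prod>v\<in>V. \<sigma> v ^ of_bool (v = i)) *
        exp (\<Sum>p\<in>F. (J p + J' p * (\<Prod>v\<in>p. \<tau> v)) * (\<Prod>v\<in>p. \<sigma> v)))"
      using V F by (intro griffiths_first) auto
    also have "\<dots> = (\<Sum>\<sigma>\<in>?S. \<sigma> i * exp (coupling_energy F (\<lambda>p. J p + J' p * (\<Prod>v\<in>p. \<tau> v)) \<sigma>))"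
    proof -
      have "(\<Prod>v\<in>V. \<sigma> v ^ of_bool (v = i)) = \<sigma> i" for \<sigma> :: "'a \<Rightarrow> real"
        using V(1) i by (simp add: prod.delta of_bool_def if_distrib cong: if_cong)
      then show ?thesis by (simp add: coupling_energy_def)
    qed
    finally show "0 \<le> (\<Sum>\<sigma>\<in>?S. \<sigma> i * exp (coupling_energy F (\<lambda>p. J p + J' p * (\<Prod>v\<in>p. \<tau> v)) \<sigma>))" .
  qed
  finally have "0 \<le> (\<Sum>\<sigma>\<in>?S. \<Sum>\<sigma>'\<in>?S'. (\<sigma> i - \<sigma>' i) * (w \<sigma> * w' \<sigma>'))" .
  also have "\<dots> = (\<Sum>\<sigma>\<in>?S. \<sigma> i * w \<sigma>) * (\<Sum>\<sigma>'\<in>?S'. w' \<sigma>') - (\<Sum>\<sigma>\<in>?S. w \<sigma>) * (\<Sum>\<sigma>'\<in>?S'. \<sigma>' i * w' \<sigma>')"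
    unfolding sum_product sum_subtractf[symmetric] by (intro sum.cong refl) (simp add: algebra_simps)
  finally have *: "0 \<le> (\<Sum>\<sigma>\<in>?S. \<sigma> i * w \<sigma>) * (\<Sum>\<sigma>'\<in>?S'. w' \<sigma>') - (\<Sum>\<sigma>\<in>?S. w \<sigma>) * (\<Sum>\<sigma>'\<in>?S'. \<sigma>' i * w' \<sigma>')" .
  have frac: "b / Z' \<le> a / Z" if "0 \<le> a * Z' - Z * b" "0 < Z" "0 < Z'" for a b Z Z' :: real
    using that by (simp add: field_simps)
  show ?thesis
    unfolding gibbs_mean_def using frac[OF *[unfolded w_def w'_def]] V
    by (simp add: gibbs_normalizer_pos order.trans[OF V(3,2)])
qed

text \<open>The spins outside \<open>W\<close> are summed freely, so they contribute only their number.\<close>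

lemma sum_spin_configs_restrict:
  fixes g :: "('a \<Rightarrow> real) \<Rightarrow> real"
  assumes "W \<subseteq> V" "A \<subseteq> V"
  shows "(\<Sum>\<sigma>\<in>spin_configs V A. g (restrict \<sigma> W))
     = real (card (spin_configs (V - W) (A - W))) * (\<Sum>\<sigma>\<in>spin_configs W (A \<inter> W). g \<sigma>)"
proof -
  have "(\<Sum>\<sigma>\<in>spin_configs V A. g (restrict \<sigma> W))
      = (\<Sum>(\<rho>, \<sigma>)\<in>spin_configs (V - W) (A - W) \<times> spin_configs W (A \<inter> W). g \<sigma>)"
  proof (rule sum.reindex_bij_witness[of _
        "\<lambda>(\<rho>, \<sigma>). restrict (\<lambda>v. if v \<in> W then \<sigma> v else \<rho> v) V" "\<lambda>\<sigma>. (restrict \<sigma> (V - W), restrict \<sigma> W)"])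
    fix x assume x: "x \<in> spin_configs (V - W) (A - W) \<times> spin_configs W (A \<inter> W)"
    then obtain \<rho> \<sigma> where [simp]: "x = (\<rho>, \<sigma>)" and *: "\<rho> \<in> extensional (V - W)" "\<sigma> \<in> extensional W"
      by (auto simp: spin_configs_def PiE_iff)
    have "restrict (restrict (\<lambda>v. if v \<in> W then \<sigma> v else \<rho> v) V) (V - W) = \<rho>"
      "restrict (restrict (\<lambda>v. if v \<in> W then \<sigma> v else \<rho> v) V) W = \<sigma>"
      using * assms by (auto simp: fun_eq_iff restrict_def extensional_def)
    then show "(restrict (case x of (\<rho>, \<sigma>) \<Rightarrow> restrict (\<lambda>v. if v \<in> W then \<sigma> v else \<rho> v) V) (V - W),
        restrict (case x of (\<rho>, \<sigma>) \<Rightarrow> restrict (\<lambda>v. if v \<in> W then \<sigma> v else \<rho> v) V) W) = x"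
      by simp
    show "(case x of (\<rho>, \<sigma>) \<Rightarrow> restrict (\<lambda>v. if v \<in> W then \<sigma> v else \<rho> v) V) \<in> spin_configs V A"
      using x assms by (auto simp: spin_configs_def PiE_iff)
  next
    fix \<sigma> assume \<sigma>: "\<sigma> \<in> spin_configs V A"
    then show "(case (restrict \<sigma> (V - W), restrict \<sigma> W) of (\<rho>, \<sigma>) \<Rightarrow>
        restrict (\<lambda>v. if v \<in> W then \<sigma> v else \<rho> v) V) = \<sigma>"
      using assms by (auto simp: spin_configs_def PiE_iff extensional_def fun_eq_iff)
    show "(restrict \<sigma> (V - W), restrict \<sigma> W) \<in> spin_configs (V - W) (A - W) \<times> spin_configs W (A \<inter> W)"
      using \<sigma> assms by (auto simp: spin_configs_def PiE_iff)
  qed auto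
  also have "\<dots> = real (card (spin_configs (V - W) (A - W))) * (\<Sum>\<sigma>\<in>spin_configs W (A \<inter> W). g \<sigma>)"
    by (simp add: sum.cartesian_product[symmetric])
  finally show ?thesis .
qed

text \<open>If the energy is decided by the spins in \<open>W\<close> up to a constant, all other spins can be dropped.\<close>

lemma gibbs_mean_restrict:
  assumes V: "finite V" "W \<subseteq> V" "A \<subseteq> V" and i: "i \<in> W"
    and H: "\<And>\<sigma>. \<sigma> \<in> spin_configs V A \<Longrightarrow> H \<sigma> = H' (restrict \<sigma> W) + c"
  shows "gibbs_mean V A H (\<lambda>\<sigma>. \<sigma> i) = gibbs_mean W (A \<inter> W) H' (\<lambda>\<sigma>. \<sigma> i)"
proof -
  let ?N = "real (card (spin_configs (V - W) (A - W)))"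
  have "0 < ?N" using V
    by (simp add: card_gt_0_iff finite_spin_configs spin_configs_nonempty Diff_mono)
  have "(\<Sum>\<sigma>\<in>spin_configs V A. \<sigma> i * exp (H \<sigma>))
      = exp c * (\<Sum>\<sigma>\<in>spin_configs V A. restrict \<sigma> W i * exp (H' (restrict \<sigma> W)))"
    unfolding sum_distrib_left using i by (intro sum.cong) (auto simp: H exp_add)
  moreover have "(\<Sum>\<sigma>\<in>spin_configs V A. exp (H \<sigma>)) = exp c * (\<Sum>\<sigma>\<in>spin_configs V A. exp (H' (restrict \<sigma> W)))"
    unfolding sum_distrib_left by (intro sum.cong) (auto simp: H exp_add)
  ultimately show ?thesis
    using \<open>0 < ?N\<close> sum_spin_configs_restrict[OF V(2,3), of "\<lambda>\<sigma>. \<sigma> i * exp (H' \<sigma>)"]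
      sum_spin_configs_restrict[OF V(2,3), of "\<lambda>\<sigma>. exp (H' \<sigma>)"]
    by (simp add: gibbs_mean_def)
qed

lemma ising_expectation_eq_gibbs_mean:
  "ising_expectation \<beta> B (V, E) A f =
     gibbs_mean V A (\<lambda>\<sigma>. \<beta> * (\<Sum>e\<in>E. \<Prod>v\<in>e. \<sigma> v) + B * (\<Sum>v\<in>V. \<sigma> v)) f"
  unfolding ising_expectation_def ising_prob_def gibbs_mean_def boltzmann_weight_def partition_function_def
  by (simp add: sum_divide_distrib)

text \<open>The field is a coupling of strength \<open>B\<close> on singletons; singletons and edges are told apart by their
cardinality.\<close>

definition ising_couplings :: "'a graph \<Rightarrow> 'a set set" where
  "ising_couplings H = snd H \<union> (\<lambda>v. {v}) ` fst H"

definition ising_strength :: "real \<Rightarrow> real \<Rightarrow> 'a set \<Rightarrow> real" where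
  "ising_strength \<beta> B p = (if card p = 2 then \<beta> else B)"

lemma ising_energy_eq_coupling_energy:
  assumes "finite V" "E \<in> edge_sets V"
  shows "\<beta> * (\<Sum>e\<in>E. \<Prod>v\<in>e. \<sigma> v) + B * (\<Sum>v\<in>V. \<sigma> v)
     = coupling_energy (ising_couplings (V, E)) (ising_strength \<beta> B) \<sigma>"
proof -
  have E: "E \<subseteq> Pow V" "\<And>e. e \<in> E \<Longrightarrow> card e = 2" using assms(2) by (auto simp: edge_sets_def)
  have "finite E" using E(1) assms(1) by (meson finite_Pow_iff finite_subset)
  then have "coupling_energy (ising_couplings (V, E)) (ising_strength \<beta> B) \<sigma>
      = (\<Sum>p\<in>E. ising_strength \<beta> B p * (\<Prod>v\<in>p. \<sigma> v)) + (\<Sum>p\<in>(\<lambda>v. {v}) ` V. ising_strength \<beta> B p * (\<Prod>v\<in>p. \<sigma> v))"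
    unfolding coupling_energy_def ising_couplings_def using assms(1) E(2)
    by (simp, intro sum.union_disjoint) force+
  also have "(\<Sum>p\<in>E. ising_strength \<beta> B p * (\<Prod>v\<in>p. \<sigma> v)) = \<beta> * (\<Sum>e\<in>E. \<Prod>v\<in>e. \<sigma> v)"
    unfolding sum_distrib_left by (intro sum.cong) (auto simp: ising_strength_def E(2))
  also have "(\<Sum>p\<in>(\<lambda>v. {v}) ` V. ising_strength \<beta> B p * (\<Prod>v\<in>p. \<sigma> v)) = B * (\<Sum>v\<in>V. \<sigma> v)"
    by (subst sum.reindex) (auto simp: inj_on_def ising_strength_def sum_distrib_left)
  finally show ?thesis by simp
qed

lemma ising_couplings_subgraph:
  assumes "W \<subseteq> V"
  shows "ising_couplings (W, {e \<in> E. e \<subseteq> W}) = {p \<in> ising_couplings (V, E). p \<subseteq> W}"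
  using assms by (auto simp: ising_couplings_def)

lemma coupling_energy_restrict:
  assumes "finite F" "\<And>p. p \<in> F \<Longrightarrow> \<not> p \<subseteq> W \<Longrightarrow> J p * (\<Prod>v\<in>p. \<sigma> v) = k p"
  shows "coupling_energy F J \<sigma> = coupling_energy {p \<in> F. p \<subseteq> W} J (restrict \<sigma> W) + (\<Sum>p\<in>{p\<in>F. \<not> p \<subseteq> W}. k p)"
proof -
  have "coupling_energy F J \<sigma> = (\<Sum>p\<in>{p \<in> F. p \<subseteq> W}. J p * (\<Prod>v\<in>p. \<sigma> v)) + (\<Sum>p\<in>{p \<in> F. \<not> p \<subseteq> W}. J p * (\<Prod>v\<in>p. \<sigma> v))"
    unfolding coupling_energy_def using assms(1)
    by (subst sum.union_disjoint[symmetric]) (auto intro!: sum.cong)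
  also have "(\<Sum>p\<in>{p \<in> F. p \<subseteq> W}. J p * (\<Prod>v\<in>p. \<sigma> v)) = coupling_energy {p \<in> F. p \<subseteq> W} J (restrict \<sigma> W)"
    unfolding coupling_energy_def by (intro sum.cong refl arg_cong2[where f="(*)"] prod.cong) auto
  also have "(\<Sum>p\<in>{p \<in> F. \<not> p \<subseteq> W}. J p * (\<Prod>v\<in>p. \<sigma> v)) = (\<Sum>p\<in>{p\<in>F. \<not> p \<subseteq> W}. k p)"
    by (intro sum.cong) (auto simp: assms(2))
  finally show ?thesis .
qed

text \<open>Switching off the couplings outside \<open>W\<close> lowers the magnetization and leaves the free model on \<open>W\<close>.
Fixing the spins in \<open>S\<close> and everything outside \<open>W\<close> raises it and, since then all couplings that leave \<open>W\<close> are
constant, leaves the model on \<open>W\<close> with plus boundary \<open>S\<close>.\<close>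

lemma
  assumes V: "finite V" "E \<in> edge_sets V" and W: "W \<subseteq> V" "i \<in> W" and pos: "0 \<le> \<beta>" "0 \<le> B"
  shows ising_free_subgraph_le:
      "ising_expectation \<beta> B (W, {e \<in> E. e \<subseteq> W}) {} (\<lambda>\<sigma>. \<sigma> i) \<le> ising_expectation \<beta> B (V, E) {} (\<lambda>\<sigma>. \<sigma> i)"
    and ising_plus_subgraph_ge:
      "\<lbrakk>S \<subseteq> W; \<And>e. e \<in> E \<Longrightarrow> \<not> e \<subseteq> W \<Longrightarrow> e \<subseteq> S \<union> (V - W)\<rbrakk> \<Longrightarrow>
       ising_expectation \<beta> B (V, E) {} (\<lambda>\<sigma>. \<sigma> i) \<le> ising_expectation \<beta> B (W, {e \<in> E. e \<subseteq> W}) S (\<lambda>\<sigma>. \<sigma> i)"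
proof -
  let ?F = "ising_couplings (V, E)" and ?J = "ising_strength \<beta> B"
  let ?F' = "{p \<in> ?F. p \<subseteq> W}"
  have F: "finite ?F" "\<And>p. p \<in> ?F \<Longrightarrow> p \<subseteq> V"
    using V unfolding ising_couplings_def edge_sets_def
    by (auto intro!: finite_subset[of E "Pow V"])
  have J: "0 \<le> ?J p" for p using pos by (simp add: ising_strength_def)
  have i: "i \<in> V" using W by auto
  have fW: "finite W" using V(1) W(1) finite_subset by blast
  have EW: "{e \<in> E. e \<subseteq> W} \<in> edge_sets W" using V(2) by (auto simp: edge_sets_def)
  have sub: "ising_expectation \<beta> B (W, {e \<in> E. e \<subseteq> W}) S (\<lambda>\<sigma>. \<sigma> i)
      = gibbs_mean W S (coupling_energy ?F' ?J) (\<lambda>\<sigma>. \<sigma> i)" for S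
    by (simp add: ising_expectation_eq_gibbs_mean ising_energy_eq_coupling_energy[OF fW EW, abs_def]
        ising_couplings_subgraph[OF W(1)])
  have whole: "ising_expectation \<beta> B (V, E) {} (\<lambda>\<sigma>. \<sigma> i) = gibbs_mean V {} (coupling_energy ?F ?J) (\<lambda>\<sigma>. \<sigma> i)"
    by (simp add: ising_expectation_eq_gibbs_mean ising_energy_eq_coupling_energy[OF V, abs_def])
  have "gibbs_mean V {} (coupling_energy ?F (\<lambda>p. if p \<subseteq> W then ?J p else 0)) (\<lambda>\<sigma>. \<sigma> i)
      = gibbs_mean W ({} \<inter> W) (coupling_energy ?F' ?J) (\<lambda>\<sigma>. \<sigma> i)"
  proof (rule gibbs_mean_restrict[where c = 0])
    fix \<sigma> assume "\<sigma> \<in> spin_configs V {}"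
    show "coupling_energy ?F (\<lambda>p. if p \<subseteq> W then ?J p else 0) \<sigma> = coupling_energy ?F' ?J (restrict \<sigma> W) + 0"
      by (subst coupling_energy_restrict[OF F(1), of W _ _ "\<lambda>_. 0"]) (auto simp: coupling_energy_def)
  qed (use V W in auto)
  moreover have "gibbs_mean V {} (coupling_energy ?F (\<lambda>p. if p \<subseteq> W then ?J p else 0)) (\<lambda>\<sigma>. \<sigma> i)
      \<le> gibbs_mean V {} (coupling_energy ?F ?J) (\<lambda>\<sigma>. \<sigma> i)"
    using V F J i by (intro griffiths_comparison) auto
  ultimately show "ising_expectation \<beta> B (W, {e \<in> E. e \<subseteq> W}) {} (\<lambda>\<sigma>. \<sigma> i) \<le> ising_expectation \<beta> B (V, E) {} (\<lambda>\<sigma>. \<sigma> i)"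
    by (simp add: sub whole)
  assume S: "S \<subseteq> W" "\<And>e. e \<in> E \<Longrightarrow> \<not> e \<subseteq> W \<Longrightarrow> e \<subseteq> S \<union> (V - W)"
  let ?A = "S \<union> (V - W)"
  have A: "p \<subseteq> ?A" if "p \<in> ?F" "\<not> p \<subseteq> W" for p
    using that S(2)[of p] unfolding ising_couplings_def by auto
  have "gibbs_mean V ?A (coupling_energy ?F ?J) (\<lambda>\<sigma>. \<sigma> i)
      = gibbs_mean W (?A \<inter> W) (coupling_energy ?F' ?J) (\<lambda>\<sigma>. \<sigma> i)"
  proof (rule gibbs_mean_restrict[where c = "\<Sum>p\<in>{p\<in>?F. \<not> p \<subseteq> W}. ?J p"])
    fix \<sigma> assume \<sigma>: "\<sigma> \<in> spin_configs V ?A"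
    have "(\<Prod>v\<in>p. \<sigma> v) = 1" if "p \<in> ?F" "\<not> p \<subseteq> W" for p
      using A[OF that] \<sigma> by (intro prod.neutral) (auto simp: spin_configs_def)
    then show "coupling_energy ?F ?J \<sigma> = coupling_energy ?F' ?J (restrict \<sigma> W) + (\<Sum>p\<in>{p\<in>?F. \<not> p \<subseteq> W}. ?J p)"
      by (intro coupling_energy_restrict F(1)) simp
  qed (use V W S in auto)
  moreover have "?A \<inter> W = S" using S(1) by auto
  moreover have "gibbs_mean V {} (coupling_energy ?F ?J) (\<lambda>\<sigma>. \<sigma> i) \<le> gibbs_mean V ?A (coupling_energy ?F ?J) (\<lambda>\<sigma>. \<sigma> i)"
    using V F J i W S by (intro griffiths_comparison) auto
  ultimately show "ising_expectation \<beta> B (V, E) {} (\<lambda>\<sigma>. \<sigma> i) \<le> ising_expectation \<beta> B (W, {e \<in> E. e \<subseteq> W}) S (\<lambda>\<sigma>. \<sigma> i)"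
    by (simp add: sub whole)
qed

section \<open>The field recursion on trees\<close>

text \<open>The recursion starts \<open>t\<close> generations below the root with the field \<open>B + s * X v\<close> at \<open>v\<close>. The
parameter \<open>s\<close> interpolates between boundary conditions: every child is replaced by a constant
passed field \<open>s\<close>, which is \<open>0\<close> for no child, \<open>passed_field \<beta> B\<close> for a child without offspring, and
\<open>\<beta>\<close> for a child fixed to \<open>+1\<close>.\<close>

primrec tree_field :: "real \<Rightarrow> real \<Rightarrow> real \<Rightarrow> nat \<Rightarrow> (nat list \<Rightarrow> nat) \<Rightarrow> real" where
  "tree_field \<beta> B s 0 X = B + s * real (X [])"
| "tree_field \<beta> B s (Suc t) X = B + (\<Sum>i<X []. passed_field \<beta> (tree_field \<beta> B s t (\<lambda>v. X (i # v))))"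

lemma tree_field_ge:
  assumes "0 \<le> \<beta>" "0 \<le> B" "0 \<le> s" shows "B \<le> tree_field \<beta> B s t X"
proof (induction t arbitrary: X)
  case (Suc t)
  have "0 \<le> (\<Sum>i<X []. passed_field \<beta> (tree_field \<beta> B s t (\<lambda>v. X (i # v))))"
    using assms(1) by (intro sum_nonneg passed_field_nonneg order.trans[OF assms(2) Suc])
  then show ?case by simp
qed (use assms in auto)

lemma tree_field_nonneg: "\<lbrakk>0 \<le> \<beta>; 0 \<le> B; 0 \<le> s\<rbrakk> \<Longrightarrow> 0 \<le> tree_field \<beta> B s t X"
  using tree_field_ge order.trans by blast

lemma tree_field_mono:
  assumes "0 \<le> \<beta>" "\<beta> \<le> \<beta>'" "0 \<le> B" "B \<le> B'" "0 \<le> s" "s \<le> s'" "\<And>v. X v \<le> X' v"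
  shows "tree_field \<beta> B s t X \<le> tree_field \<beta>' B' s' t X'"
  using assms(7)
proof (induction t arbitrary: X X')
  case 0
  then show ?case using assms by (auto intro!: add_mono mult_mono)
next
  case (Suc t)
  have "(\<Sum>i<X []. passed_field \<beta> (tree_field \<beta> B s t (\<lambda>v. X (i # v))))
      \<le> (\<Sum>i<X []. passed_field \<beta>' (tree_field \<beta>' B' s' t (\<lambda>v. X' (i # v))))"
    using assms Suc by (intro sum_mono passed_field_mono tree_field_nonneg) auto
  also have "\<dots> \<le> (\<Sum>i<X' []. passed_field \<beta>' (tree_field \<beta>' B' s' t (\<lambda>v. X' (i # v))))"
    using assms Suc(2) by (intro sum_mono2 passed_field_nonneg tree_field_nonneg) auto
  finally show ?case using assms by auto
qed

lemma tree_field_le: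
  assumes "0 \<le> \<beta>" "0 \<le> B" "0 \<le> s" "s \<le> \<beta>" shows "tree_field \<beta> B s t X \<le> B + \<beta> * real (X [])"
proof (cases t)
  case (Suc u)
  have "(\<Sum>i<X []. passed_field \<beta> (tree_field \<beta> B s u (\<lambda>v. X (i # v)))) \<le> (\<Sum>i<X []. \<beta>)"
    using assms by (intro sum_mono passed_field_le tree_field_nonneg) auto
  then show ?thesis by (simp add: Suc mult.commute)
qed (use assms in \<open>auto intro!: mult_right_mono\<close>)

lemma tree_field_free_Suc: "tree_field \<beta> B 0 (Suc t) X = tree_field \<beta> B (passed_field \<beta> B) t X"
proof (induction t arbitrary: X)
  case (Suc t)
  show ?case by (subst (1 2) tree_field.simps(2)) (simp only: Suc)
qed (simp add: mult.commute)

lemma tree_field_free_incseq: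
  assumes "0 \<le> \<beta>" "0 \<le> B" shows "incseq (\<lambda>t. tree_field \<beta> B 0 t X)"
proof (rule incseq_SucI)
  fix t show "tree_field \<beta> B 0 t X \<le> tree_field \<beta> B 0 (Suc t) X"
    unfolding tree_field_free_Suc using assms by (intro tree_field_mono passed_field_nonneg) auto
qed

text \<open>Sums and compositions of nondecreasing concave functions are concave; this is concavity in \<open>s\<close>,
tested on the segment from \<open>0\<close> to \<open>s\<close>. On general graphs the same role is played by the GHS
inequality.\<close>

lemma tree_field_concave:
  assumes "0 \<le> \<beta>" "0 \<le> B" "0 \<le> s" "0 \<le> r" "r \<le> 1"
  shows "(1 - r) * tree_field \<beta> B 0 t X + r * tree_field \<beta> B s t X \<le> tree_field \<beta> B (r * s) t X"
proof (induction t arbitrary: X)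
  case (Suc t)
  let ?f = "\<lambda>s i. tree_field \<beta> B s t (\<lambda>v. X (i # v))"
  have "(1 - r) * passed_field \<beta> (?f 0 i) + r * passed_field \<beta> (?f s i) \<le> passed_field \<beta> (?f (r * s) i)" for i
  proof -
    have "(1 - r) * passed_field \<beta> (?f 0 i) + r * passed_field \<beta> (?f s i) \<le> passed_field \<beta> ((1 - r) * ?f 0 i + r * ?f s i)"
      using assms by (intro passed_field_concave tree_field_nonneg) auto
    also have "\<dots> \<le> passed_field \<beta> (?f (r * s) i)"
      using assms by (intro passed_field_mono Suc add_nonneg_nonneg mult_nonneg_nonneg tree_field_nonneg) auto
    finally show ?thesis .
  qed
  then have "(\<Sum>i<X []. (1 - r) * passed_field \<beta> (?f 0 i) + r * passed_field \<beta> (?f s i)) \<le> (\<Sum>i<X []. passed_field \<beta> (?f (r * s) i))"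
    by (intro sum_mono)
  then have "(1 - r) * (\<Sum>i<X []. passed_field \<beta> (?f 0 i)) + r * (\<Sum>i<X []. passed_field \<beta> (?f s i)) \<le> (\<Sum>i<X []. passed_field \<beta> (?f (r * s) i))"
    by (simp add: sum.distrib flip: sum_distrib_left)
  then show ?case by (simp add: algebra_simps)
qed (simp add: algebra_simps)

text \<open>With \<open>r * \<beta> = passed_field \<beta> B\<close>, concavity says that the free field on \<open>t + 1\<close> generations lies at
least the fraction \<open>r\<close> of the way from the free field on \<open>t\<close> generations to the plus field on
\<open>t + 1\<close> generations. The free fields converge, so the plus fields are squeezed to the same limit. The
ratio \<open>r\<close> is positive only because \<open>B > 0\<close>; in the case \<open>\<beta> = 0\<close> the fields coincide.\<close>

lemma tree_field_limits_agree:
  assumes "0 \<le> \<beta>" "0 < B"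
  shows "\<exists>h. (\<lambda>t. tree_field \<beta> B 0 t X) \<longlonglongrightarrow> h \<and> (\<lambda>t. tree_field \<beta> B \<beta> t X) \<longlonglongrightarrow> h"
proof -
  let ?f = "\<lambda>t. tree_field \<beta> B 0 t X" and ?p = "\<lambda>t. tree_field \<beta> B \<beta> t X"
  have "incseq ?f" using assms by (intro tree_field_free_incseq) auto
  moreover have "Bseq ?f" using assms
    by (intro BseqI'[where K = "B + \<beta> * real (X [])"])
       (auto simp: abs_of_nonneg tree_field_nonneg intro!: tree_field_le)
  ultimately obtain h where h: "?f \<longlonglongrightarrow> h"
    using Bseq_monoseq_convergent convergentD incseq_imp_monoseq by blast
  have "?p \<longlonglongrightarrow> h"
  proof (cases "\<beta> = 0")
    case True
    then show ?thesis using h by simp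
  next
    case False
    \<comment> \<open>Where the free field on one more generation sits between \<open>s = 0\<close> and \<open>s = \<beta>\<close>.\<close>
    define r where "r = passed_field \<beta> B / \<beta>"
    have r: "0 < r" "r \<le> 1" "r * \<beta> = passed_field \<beta> B"
      using assms False passed_field_pos[of \<beta> B] passed_field_le[of \<beta> B] by (auto simp: r_def)
    have h': "(\<lambda>t. ?f (Suc t)) \<longlonglongrightarrow> h" using h by (rule LIMSEQ_Suc)
    show ?thesis
    proof (rule tendsto_sandwich[OF _ _ h])
      show "\<forall>\<^sub>F t in sequentially. ?f t \<le> ?p t"
        using assms by (intro always_eventually allI tree_field_mono) auto
      have "?p t \<le> ?f t + (?f (Suc t) - ?f t) / r" for t
        using tree_field_concave[of \<beta> B \<beta> r t X] assms r
        by (simp add: tree_field_free_Suc field_simps del: tree_field.simps)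
      then show "\<forall>\<^sub>F t in sequentially. ?p t \<le> ?f t + (?f (Suc t) - ?f t) / r"
        by (intro always_eventually allI)
      show "(\<lambda>t. ?f t + (?f (Suc t) - ?f t) / r) \<longlonglongrightarrow> h"
        using tendsto_add[OF h tendsto_divide[OF tendsto_diff[OF h' h] tendsto_const, of r]] r by simp
    qed
  qed
  with h show ?thesis by blast
qed

abbreviation subtree :: "(nat list \<Rightarrow> nat) \<Rightarrow> nat \<Rightarrow> nat list \<Rightarrow> nat" where
  "subtree X i \<equiv> (\<lambda>v. X (i # v))"

definition gw_verts :: "(nat list \<Rightarrow> nat) \<Rightarrow> nat \<Rightarrow> nat list set" where
  "gw_verts X t = {v \<in> gw_vertices X. length v \<le> t}"

text \<open>Every vertex but the root owns the edge to its parent, so sums over edges become sums over vertices,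
which is the form suited to recursion over subtrees.\<close>

definition tree_on :: "nat list set \<Rightarrow> nat list graph" where
  "tree_on V = (V, (\<lambda>v. {butlast v, v}) ` (V - {[]}))"

lemma gw_tree_eq: "gw_tree X t = tree_on (gw_verts X t)"
proof -
  have *: "{{u, u @ [j]} | u j. u @ [j] \<in> V} = (\<lambda>v. {butlast v, v}) ` (V - {[]})" for V :: "nat list set"
  proof (intro set_eqI iffI)
    fix e assume "e \<in> (\<lambda>v. {butlast v, v}) ` (V - {[]})"
    then obtain v where "v \<in> V" "v \<noteq> []" "e = {butlast v, v}" by auto
    then show "e \<in> {{u, u @ [j]} | u j. u @ [j] \<in> V}"
      by (intro CollectI exI[of _ "butlast v"] exI[of _ "last v"]) auto
  next
    fix e assume "e \<in> {{u, u @ [j]} | u j. u @ [j] \<in> V}"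
    then obtain u j where *: "u @ [j] \<in> V" "e = {u, u @ [j]}" by blast
    then show "e \<in> (\<lambda>v. {butlast v, v}) ` (V - {[]})"
      by (intro image_eqI[of _ _ "u @ [j]"]) auto
  qed
  show ?thesis unfolding gw_tree_def tree_on_def gw_verts_def Let_def * by (rule refl)
qed

lemma Nil_in_gw_verts: "[] \<in> gw_verts X t"
  by (simp add: gw_verts_def gw_vertices_def)

lemma Cons_in_gw_vertices:
  "i # v \<in> gw_vertices X \<longleftrightarrow> i < X [] \<and> v \<in> gw_vertices (subtree X i)"
  unfolding gw_vertices_def by (simp add: All_less_Suc2)

lemma gw_verts_0: "gw_verts X 0 = {[]}"
  by (auto simp: gw_verts_def gw_vertices_def)

lemma gw_verts_Suc: "gw_verts X (Suc t) = insert [] (\<Union>i<X []. (#) i ` gw_verts (subtree X i) t)"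
proof (rule set_eqI)
  fix v show "v \<in> gw_verts X (Suc t) \<longleftrightarrow> v \<in> insert [] (\<Union>i<X []. (#) i ` gw_verts (subtree X i) t)"
    by (cases v) (auto simp: gw_verts_def Cons_in_gw_vertices, simp add: gw_vertices_def)
qed

lemma finite_gw_verts: "finite (gw_verts X t)"
  by (induction t arbitrary: X) (auto simp: gw_verts_0 gw_verts_Suc)

definition tree_energy :: "real \<Rightarrow> real \<Rightarrow> nat list set \<Rightarrow> (nat list \<Rightarrow> real) \<Rightarrow> real" where
  "tree_energy \<beta> B V \<sigma> = \<beta> * (\<Sum>v\<in>V - {[]}. \<sigma> (butlast v) * \<sigma> v) + B * (\<Sum>v\<in>V. \<sigma> v)"

lemma boltzmann_weight_tree_on:
  "boltzmann_weight \<beta> B (tree_on V) \<sigma> = exp (tree_energy \<beta> B V \<sigma>)"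
proof -
  have neq: "butlast v \<noteq> v" if "v \<noteq> []" for v :: "nat list"
    using that by (metis append_butlast_last_id append_self_conv not_Cons_self2)
  have inj: "inj_on (\<lambda>v::nat list. {butlast v, v}) (V - {[]})"
  proof (rule inj_onI)
    fix v w :: "nat list" assume "v \<in> V - {[]}" "w \<in> V - {[]}" and eq: "{butlast v, v} = {butlast w, w}"
    have "\<not> (v = butlast w \<and> w = butlast v)"
    proof
      assume *: "v = butlast w \<and> w = butlast v"
      then have "length v = length w - 1" "length w = length v - 1"
        by (metis length_butlast)+
      with \<open>v \<in> V - {[]}\<close> show False by (cases v) auto
    qed
    then show "v = w" using eq by (auto simp: doubleton_eq_iff)
  qed
  have "(\<Sum>e\<in>(\<lambda>v. {butlast v, v}) ` (V - {[]}). \<Prod>u\<in>e. \<sigma> u) = (\<Sum>v\<in>V - {[]}. \<sigma> (butlast v) * \<sigma> v)"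
    unfolding sum.reindex[OF inj] by (intro sum.cong) (auto simp: neq)
  then show ?thesis by (simp add: boltzmann_weight_def tree_on_def tree_energy_def)
qed

text \<open>Subtrees of the root interact only through the root spin.\<close>

lemma tree_energy_Suc:
  "tree_energy \<beta> B (gw_verts X (Suc t)) \<sigma> = B * \<sigma> [] +
     (\<Sum>i<X []. \<beta> * \<sigma> [] * \<sigma> [i] + tree_energy \<beta> B (gw_verts (subtree X i) t) (\<lambda>v. \<sigma> (i # v)))"
proof -
  let ?V = "\<lambda>i. gw_verts (subtree X i) t"
  have nil: "gw_verts X (Suc t) - {[]} = (\<Union>i<X []. (#) i ` ?V i)"
    by (auto simp: gw_verts_Suc)
  have split: "(\<Sum>v\<in>(\<Union>i<X []. (#) i ` ?V i). f v) = (\<Sum>i<X []. \<Sum>v\<in>?V i. f (i # v))" for f :: "nat list \<Rightarrow> real"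
    by (subst sum.UNION_disjoint) (auto simp: finite_gw_verts sum.reindex)
  have "(\<Sum>v\<in>gw_verts X (Suc t). \<sigma> v) = \<sigma> [] + (\<Sum>v\<in>gw_verts X (Suc t) - {[]}. \<sigma> v)"
    by (simp add: sum.remove finite_gw_verts Nil_in_gw_verts)
  moreover have "(\<Sum>v\<in>?V i. \<sigma> (butlast (i # v)) * \<sigma> (i # v)) =
      \<sigma> [] * \<sigma> [i] + (\<Sum>v\<in>?V i - {[]}. \<sigma> (i # butlast v) * \<sigma> (i # v))" for i
    by (subst sum.remove[of _ "[]"]) (auto simp: finite_gw_verts Nil_in_gw_verts)
  ultimately show ?thesis
    unfolding tree_energy_def nil split
    by (simp add: sum.distrib sum_distrib_left algebra_simps del: butlast.simps)
qed

lemma tree_energy_cong: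
  assumes "\<And>v. v \<in> gw_verts X t \<Longrightarrow> \<sigma> v = \<rho> v"
  shows "tree_energy \<beta> B (gw_verts X t) \<sigma> = tree_energy \<beta> B (gw_verts X t) \<rho>"
proof -
  have "butlast v \<in> gw_verts X t" if "v \<in> gw_verts X t" for v
    using that unfolding gw_verts_def gw_vertices_def
    by (auto simp: nth_butlast butlast_conv_take min_def)
  then show ?thesis unfolding tree_energy_def using assms by simp
qed

definition tree_boundary :: "bool \<Rightarrow> (nat list \<Rightarrow> nat) \<Rightarrow> nat \<Rightarrow> nat list set" where
  "tree_boundary pl X t = {v \<in> gw_verts X t. pl \<and> length v = t}"

text \<open>The partition function with the root spin fixed to \<open>s\<close>; the flag \<open>pl\<close> selects plus boundary conditions.\<close>

definition rooted_partition :: "real \<Rightarrow> real \<Rightarrow> bool \<Rightarrow> nat \<Rightarrow> (nat list \<Rightarrow> nat) \<Rightarrow> real \<Rightarrow> real" where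
  "rooted_partition \<beta> B pl t X s =
     (\<Sum>\<sigma> | \<sigma> \<in> spin_configs (gw_verts X t) (tree_boundary pl X t) \<and> \<sigma> [] = s.
        exp (tree_energy \<beta> B (gw_verts X t) \<sigma>))"

text \<open>Once the root spin is fixed, a configuration is an independent choice of configurations of the
subtrees. The boundary conditions match since generation \<open>t + 1\<close> of the tree consists of the
generations \<open>t\<close> of the subtrees, and the root is never in generation \<open>t + 1\<close>.\<close>

lemma spin_configs_tree_reindex:
  assumes s: "s \<in> {-1, 1}"
  shows "(\<Sum>\<sigma> | \<sigma> \<in> spin_configs (gw_verts X (Suc t)) (tree_boundary pl X (Suc t)) \<and> \<sigma> [] = s.
            F (\<lambda>i\<in>{..<X []}. restrict (\<lambda>v. \<sigma> (i # v)) (gw_verts (subtree X i) t)))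
       = (\<Sum>\<omega> \<in> PiE {..<X []} (\<lambda>i. spin_configs (gw_verts (subtree X i) t) (tree_boundary pl (subtree X i) t)). F \<omega> :: real)"
proof (rule sum.reindex_bij_witness[of _
      "\<lambda>\<omega>. restrict (\<lambda>v. case v of [] \<Rightarrow> s | i # w \<Rightarrow> \<omega> i w) (gw_verts X (Suc t))"
      "\<lambda>\<sigma>. \<lambda>i\<in>{..<X []}. restrict (\<lambda>v. \<sigma> (i # v)) (gw_verts (subtree X i) t)"])
  let ?r = "\<lambda>\<sigma>. \<lambda>i\<in>{..<X []}. restrict (\<lambda>v. \<sigma> (i # v)) (gw_verts (subtree X i) t)"
  let ?e = "\<lambda>\<omega>. restrict (\<lambda>v. case v of [] \<Rightarrow> s | i # w \<Rightarrow> \<omega> i w) (gw_verts X (Suc t))"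
  let ?S = "{\<sigma> \<in> spin_configs (gw_verts X (Suc t)) (tree_boundary pl X (Suc t)). \<sigma> [] = s}"
  let ?P = "PiE {..<X []} (\<lambda>i. spin_configs (gw_verts (subtree X i) t) (tree_boundary pl (subtree X i) t))"
  have cons: "i # v \<in> gw_verts X (Suc t) \<longleftrightarrow> i < X [] \<and> v \<in> gw_verts (subtree X i) t" for i v
    by (auto simp: gw_verts_Suc)
  { fix \<sigma> assume \<sigma>: "\<sigma> \<in> ?S"
    show "?e (?r \<sigma>) = \<sigma>"
    proof
      fix v show "?e (?r \<sigma>) v = \<sigma> v"
        using \<sigma> cons by (cases v) (auto simp: Nil_in_gw_verts spin_configs_def PiE_iff extensional_def)
    qed
    show "?r \<sigma> \<in> ?P" using \<sigma> cons
      by (auto simp: spin_configs_def PiE_iff tree_boundary_def)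
  }
  { fix \<omega> assume \<omega>: "\<omega> \<in> ?P"
    show "?r (?e \<omega>) = \<omega>"
    proof (intro ext)
      fix i v show "?r (?e \<omega>) i v = \<omega> i v"
      proof (cases "i < X []")
        case True
        then have "\<omega> i \<in> extensional (gw_verts (subtree X i) t)"
          using \<omega> by (auto simp: spin_configs_def PiE_iff)
        then show ?thesis using True by (auto simp: cons restrict_def extensional_def)
      next
        case False
        then show ?thesis using \<omega> by (auto simp: restrict_def PiE_iff extensional_def)
      qed
    qed
    have *: "\<omega> i w \<in> {-1, 1} \<and> (pl \<longrightarrow> length w = t \<longrightarrow> \<omega> i w = 1)" if "i # w \<in> gw_verts X (Suc t)" for i w
      using \<omega> that unfolding cons by (fastforce simp: spin_configs_def PiE_iff tree_boundary_def)
    show "?e \<omega> \<in> ?S" using * s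
      by (fastforce simp: spin_configs_def PiE_iff tree_boundary_def Nil_in_gw_verts split: list.split)
  }
qed auto

lemma rooted_partition_Suc:
  assumes s: "s \<in> {-1, 1}"
  shows "rooted_partition \<beta> B pl (Suc t) X s = exp (B * s) * (\<Prod>i<X [].
     exp (\<beta> * s) * rooted_partition \<beta> B pl t (subtree X i) 1
     + exp (- \<beta> * s) * rooted_partition \<beta> B pl t (subtree X i) (-1))"
proof -
  let ?C = "\<lambda>i. spin_configs (gw_verts (subtree X i) t) (tree_boundary pl (subtree X i) t)"
  let ?w = "\<lambda>i \<omega>. exp (\<beta> * s * \<omega> [] + tree_energy \<beta> B (gw_verts (subtree X i) t) \<omega>)"
  have inner: "(\<Sum>\<omega>\<in>?C i. ?w i \<omega>) =
     exp (\<beta> * s) * rooted_partition \<beta> B pl t (subtree X i) 1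
     + exp (- \<beta> * s) * rooted_partition \<beta> B pl t (subtree X i) (-1)" for i
  proof -
    have split: "?C i = {\<omega> \<in> ?C i. \<omega> [] = 1} \<union> {\<omega> \<in> ?C i. \<omega> [] = -1}"
      using spin_value[OF _ Nil_in_gw_verts] by blast
    have "(\<Sum>\<omega>\<in>?C i. ?w i \<omega>) = (\<Sum>\<omega> | \<omega> \<in> ?C i \<and> \<omega> [] = 1. ?w i \<omega>) + (\<Sum>\<omega> | \<omega> \<in> ?C i \<and> \<omega> [] = -1. ?w i \<omega>)"
      by (subst split, subst sum.union_disjoint) (auto simp: finite_spin_configs finite_gw_verts)
    also have "(\<Sum>\<omega> | \<omega> \<in> ?C i \<and> \<omega> [] = 1. ?w i \<omega>) = exp (\<beta> * s) * rooted_partition \<beta> B pl t (subtree X i) 1"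
      unfolding rooted_partition_def sum_distrib_left by (intro sum.cong) (auto simp flip: exp_add)
    also have "(\<Sum>\<omega> | \<omega> \<in> ?C i \<and> \<omega> [] = -1. ?w i \<omega>) = exp (- \<beta> * s) * rooted_partition \<beta> B pl t (subtree X i) (-1)"
      unfolding rooted_partition_def sum_distrib_left by (intro sum.cong) (auto simp flip: exp_add)
    finally show ?thesis .
  qed
  have "rooted_partition \<beta> B pl (Suc t) X s =
     (\<Sum>\<sigma> | \<sigma> \<in> spin_configs (gw_verts X (Suc t)) (tree_boundary pl X (Suc t)) \<and> \<sigma> [] = s.
        exp (B * s) * (\<Prod>i<X []. ?w i ((\<lambda>i\<in>{..<X []}. restrict (\<lambda>v. \<sigma> (i # v)) (gw_verts (subtree X i) t)) i)))"
    unfolding rooted_partition_def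
  proof (rule sum.cong[OF refl])
    fix \<sigma> :: "nat list \<Rightarrow> real"
    assume "\<sigma> \<in> {\<sigma> \<in> spin_configs (gw_verts X (Suc t)) (tree_boundary pl X (Suc t)). \<sigma> [] = s}"
    then have "\<sigma> [] = s" by simp
    moreover have "tree_energy \<beta> B (gw_verts (subtree X i) t) (\<lambda>v. \<sigma> (i # v)) =
        tree_energy \<beta> B (gw_verts (subtree X i) t) (restrict (\<lambda>v. \<sigma> (i # v)) (gw_verts (subtree X i) t))" for i
      by (rule tree_energy_cong) simp
    ultimately show "exp (tree_energy \<beta> B (gw_verts X (Suc t)) \<sigma>) =
        exp (B * s) * (\<Prod>i<X []. ?w i ((\<lambda>i\<in>{..<X []}. restrict (\<lambda>v. \<sigma> (i # v)) (gw_verts (subtree X i) t)) i))"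
      by (simp add: tree_energy_Suc exp_add exp_sum Nil_in_gw_verts)
  qed
  also have "\<dots> = exp (B * s) * (\<Sum>\<omega>\<in>PiE {..<X []} ?C. \<Prod>i<X []. ?w i (\<omega> i))"
    unfolding sum_distrib_left[symmetric]
    by (subst spin_configs_tree_reindex[OF s, where F = "\<lambda>\<omega>. \<Prod>i<X []. ?w i (\<omega> i)"]) simp
  also have "(\<Sum>\<omega>\<in>PiE {..<X []} ?C. \<Prod>i<X []. ?w i (\<omega> i)) = (\<Prod>i<X []. \<Sum>\<omega>\<in>?C i. ?w i \<omega>)"
    by (subst prod_sum_PiE) (auto intro!: finite_spin_configs finite_gw_verts)
  also have "\<dots> = (\<Prod>i<X []. exp (\<beta> * s) * rooted_partition \<beta> B pl t (subtree X i) 1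
     + exp (- \<beta> * s) * rooted_partition \<beta> B pl t (subtree X i) (-1))"
    by (simp only: inner)
  finally show ?thesis .
qed

text \<open>Summing out a spin with field \<open>h\<close> gives \<open>2 * cosh (\<beta> * s + h)\<close> as a function of the parent spin \<open>s\<close>.
Any positive function on two points has the form \<open>c * exp (s * x)\<close>, and here \<open>x\<close> is the passed field.\<close>

lemma exp_passed_field_factor:
  "\<exists>c>0. \<forall>s\<in>{-1, 1}. exp (\<beta> * s + h) + exp (- \<beta> * s - h) = c * exp (s * passed_field \<beta> h)"
proof -
  let ?x = "passed_field \<beta> h"
  define c where "c = 2 * cosh h * cosh \<beta> / cosh ?x"
  have c: "c > 0" by (simp add: c_def)
  have cosh_eq: "2 * cosh y = exp y + exp (- y)" for y :: real by (simp add: cosh_def)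
  have key: "cosh h * cosh \<beta> * (cosh ?x * (tanh \<beta> * tanh h)) = sinh h * sinh \<beta> * cosh ?x"
    by (simp add: tanh_def)
  have sx: "sinh ?x = cosh ?x * (tanh \<beta> * tanh h)"
    unfolding tanh_passed_field[symmetric] by (simp add: tanh_def)
  have ep: "exp ?x = cosh ?x + sinh ?x" and em: "exp (- ?x) = cosh ?x - sinh ?x"
    by (simp_all add: cosh_plus_sinh cosh_minus_sinh)
  have "2 * cosh (\<beta> + h) * cosh ?x = 2 * cosh h * cosh \<beta> * exp ?x"
    unfolding ep sx using key by (simp add: cosh_add algebra_simps)
  then have p: "exp (\<beta> + h) + exp (- \<beta> - h) = c * exp ?x"
    using cosh_eq[of "\<beta> + h"] by (simp add: c_def field_simps)
  have "2 * cosh (\<beta> - h) * cosh ?x = 2 * cosh h * cosh \<beta> * exp (- ?x)"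
    unfolding em sx using key by (simp add: cosh_diff algebra_simps)
  then have m: "exp (- \<beta> + h) + exp (\<beta> - h) = c * exp (- ?x)"
    using cosh_eq[of "\<beta> - h"] by (simp add: c_def field_simps)
  show ?thesis using c p m by (intro exI[of _ c]) auto
qed

lemma rooted_partition_Suc_field:
  assumes "\<And>i. i < X [] \<Longrightarrow> \<exists>c>0. \<forall>s\<in>{-1, 1}. rooted_partition \<beta> B pl t (subtree X i) s = c * exp (s * h i)"
  shows "\<exists>c>0. \<forall>s\<in>{-1, 1}. rooted_partition \<beta> B pl (Suc t) X s = c * exp (s * (B + (\<Sum>i<X []. passed_field \<beta> (h i))))"
proof -
  have "\<exists>c>0. \<forall>s\<in>{-1, 1}. exp (\<beta> * s) * rooted_partition \<beta> B pl t (subtree X i) 1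
     + exp (- \<beta> * s) * rooted_partition \<beta> B pl t (subtree X i) (-1) = c * exp (s * passed_field \<beta> (h i))" if i: "i < X []" for i
  proof -
    obtain c where c: "c > 0" "\<forall>s\<in>{-1, 1}. rooted_partition \<beta> B pl t (subtree X i) s = c * exp (s * h i)"
      using assms[OF i] by blast
    obtain d where d: "d > 0" "\<forall>s\<in>{-1, 1}. exp (\<beta> * s + h i) + exp (- \<beta> * s - h i) = d * exp (s * passed_field \<beta> (h i))"
      using exp_passed_field_factor by blast
    have "exp (\<beta> * s) * rooted_partition \<beta> B pl t (subtree X i) 1
      + exp (- \<beta> * s) * rooted_partition \<beta> B pl t (subtree X i) (-1) = c * (exp (\<beta> * s + h i) + exp (- \<beta> * s - h i))" for s
      using c(2) by (simp add: exp_add exp_diff exp_minus algebra_simps divide_inverse)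
    then show ?thesis using c(1) d by (intro exI[of _ "c * d"]) auto
  qed
  then obtain c where c: "\<And>i. i < X [] \<Longrightarrow> 0 < c i"
    "\<And>i s. i < X [] \<Longrightarrow> s \<in> {-1, 1} \<Longrightarrow> exp (\<beta> * s) * rooted_partition \<beta> B pl t (subtree X i) 1
     + exp (- \<beta> * s) * rooted_partition \<beta> B pl t (subtree X i) (-1) = c i * exp (s * passed_field \<beta> (h i))"
    by metis
  show ?thesis
  proof (intro exI[of _ "\<Prod>i<X []. c i"] conjI ballI)
    show "0 < (\<Prod>i<X []. c i)" using c(1) by (intro prod_pos) auto
    fix s :: real assume s: "s \<in> {-1, 1}"
    have "rooted_partition \<beta> B pl (Suc t) X s = exp (B * s) * (\<Prod>i<X []. c i * exp (s * passed_field \<beta> (h i)))"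
      unfolding rooted_partition_Suc[OF s] using c(2)[OF _ s] by simp
    then show "rooted_partition \<beta> B pl (Suc t) X s = (\<Prod>i<X []. c i) * exp (s * (B + (\<Sum>i<X []. passed_field \<beta> (h i))))"
      by (simp add: prod.distrib exp_sum distrib_left exp_add sum_distrib_left mult_ac)
  qed
qed

lemma rooted_partition_0:
  "rooted_partition \<beta> B pl 0 X 1 = exp B" "rooted_partition \<beta> B pl 0 X (-1) = (if pl then 0 else exp (- B))"
proof -
  have e: "tree_energy \<beta> B {[]} \<sigma> = B * \<sigma> []" for \<sigma> by (simp add: tree_energy_def)
  have 1: "{\<sigma> \<in> spin_configs {[]} (tree_boundary pl X 0). \<sigma> [] = 1} = {\<lambda>v\<in>{[]}. 1}"
    by (auto simp: spin_configs_def tree_boundary_def gw_verts_0 PiE_iff extensional_def fun_eq_iff)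
  have 2: "{\<sigma> \<in> spin_configs {[]} (tree_boundary pl X 0). \<sigma> [] = -1} = (if pl then {} else {\<lambda>v\<in>{[]}. -1})"
    by (auto simp: spin_configs_def tree_boundary_def gw_verts_0 PiE_iff extensional_def fun_eq_iff)
  show "rooted_partition \<beta> B pl 0 X 1 = exp B"
    unfolding rooted_partition_def gw_verts_0 1 by (simp add: e)
  show "rooted_partition \<beta> B pl 0 X (-1) = (if pl then 0 else exp (- B))"
    unfolding rooted_partition_def gw_verts_0 2 by (simp add: e)
qed

lemma rooted_partition_free:
  "\<exists>c>0. \<forall>s\<in>{-1, 1}. rooted_partition \<beta> B False t X s = c * exp (s * tree_field \<beta> B 0 t X)"
proof (induction t arbitrary: X)
  case 0
  show ?case by (intro exI[of _ 1]) (simp add: rooted_partition_0)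
next
  case (Suc t)
  show ?case unfolding tree_field.simps by (rule rooted_partition_Suc_field) (rule Suc)
qed

text \<open>The recursion starts at \<open>t + 1\<close> generations: with only the root fixed to \<open>+1\<close>, the value at
\<open>-1\<close> vanishes and the effective field would be infinite.\<close>

lemma rooted_partition_plus:
  "\<exists>c>0. \<forall>s\<in>{-1, 1}. rooted_partition \<beta> B True (Suc t) X s = c * exp (s * tree_field \<beta> B \<beta> t X)"
proof (induction t arbitrary: X)
  case 0
  show ?case
    by (intro exI[of _ "exp B ^ X []"])
       (simp add: rooted_partition_Suc rooted_partition_0 power_mult_distrib exp_add exp_diff
          exp_minus field_simps exp_of_nat_mult[symmetric])
next
  case (Suc t)
  show ?case unfolding tree_field.simps(2) by (rule rooted_partition_Suc_field) (rule Suc)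
qed

text \<open>The root spin is distributed proportionally to \<open>exp (s * h)\<close> on \<open>s = \<plusminus>1\<close>.\<close>

lemma root_magnetization_eq_tanh:
  assumes "\<exists>c>0. \<forall>s\<in>{-1, 1}. rooted_partition \<beta> B pl t X s = c * exp (s * h)"
  shows "ising_expectation \<beta> B (tree_on (gw_verts X t)) (tree_boundary pl X t) (\<lambda>\<sigma>. \<sigma> []) = tanh h"
proof -
  let ?C = "spin_configs (gw_verts X t) (tree_boundary pl X t)"
  let ?w = "\<lambda>\<sigma>. exp (tree_energy \<beta> B (gw_verts X t) \<sigma>)"
  obtain c where c: "c > 0" "rooted_partition \<beta> B pl t X 1 = c * exp h" "rooted_partition \<beta> B pl t X (-1) = c * exp (- h)"
    using assms by auto
  have split: "?C = {\<omega> \<in> ?C. \<omega> [] = 1} \<union> {\<omega> \<in> ?C. \<omega> [] = -1}"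
    using spin_value[OF _ Nil_in_gw_verts] by blast
  have sum: "(\<Sum>\<sigma>\<in>?C. f (\<sigma> []) * ?w \<sigma>) = f 1 * rooted_partition \<beta> B pl t X 1 + f (-1) * rooted_partition \<beta> B pl t X (-1)" for f :: "real \<Rightarrow> real"
    by (subst split, subst sum.union_disjoint)
       (auto simp: finite_spin_configs finite_gw_verts rooted_partition_def sum_distrib_left)
  have "ising_expectation \<beta> B (tree_on (gw_verts X t)) (tree_boundary pl X t) (\<lambda>\<sigma>. \<sigma> [])
      = (\<Sum>\<sigma>\<in>?C. \<sigma> [] * ?w \<sigma>) / (\<Sum>\<sigma>\<in>?C. 1 * ?w \<sigma>)"
    by (simp add: ising_expectation_def ising_prob_def partition_function_def boltzmann_weight_tree_on
        sum_divide_distrib) (simp add: tree_on_def)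
  also have "\<dots> = (c * exp h - c * exp (- h)) / (c * exp h + c * exp (- h))"
    unfolding sum[of "\<lambda>s. s"] sum[of "\<lambda>_. 1"] c(2,3) by simp
  also have "\<dots> = tanh h" using c(1) by (simp add: tanh_altdef flip: right_diff_distrib distrib_left)
  finally show ?thesis .
qed

lemma tree_expectation_free_eq: "tree_expectation_free \<beta> B X t (\<lambda>\<sigma>. \<sigma> []) = tanh (tree_field \<beta> B 0 t X)"
proof -
  have "tree_boundary False X t = {}" by (simp add: tree_boundary_def)
  then show ?thesis
    using root_magnetization_eq_tanh[OF rooted_partition_free, of \<beta> B X t]
    by (simp add: tree_expectation_free_def gw_tree_eq)
qed

lemma tree_expectation_plus_eq: "tree_expectation_plus \<beta> B X (Suc t) (\<lambda>\<sigma>. \<sigma> []) = tanh (tree_field \<beta> B \<beta> t X)"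
proof -
  have "tree_boundary True X (Suc t) = {v \<in> fst (tree_on (gw_verts X (Suc t))). length v = Suc t}"
    by (simp add: tree_boundary_def tree_on_def)
  then show ?thesis
    using root_magnetization_eq_tanh[OF rooted_partition_plus, of \<beta> B X t]
    by (simp only: tree_expectation_plus_def gw_tree_eq)
qed

text \<open>Defined by the free fields, whose monotonicity makes the limit exist; the plus fields share it.\<close>

definition bethe_field :: "real \<Rightarrow> real \<Rightarrow> (nat list \<Rightarrow> nat) \<Rightarrow> real" where
  "bethe_field \<beta> B X = lim (\<lambda>t. tree_field \<beta> B 0 t X)"

lemma
  assumes "0 \<le> \<beta>" "0 < B"
  shows tree_field_free_tendsto: "(\<lambda>t. tree_field \<beta> B 0 t X) \<longlonglongrightarrow> bethe_field \<beta> B X"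
    and tree_field_plus_tendsto: "(\<lambda>t. tree_field \<beta> B \<beta> t X) \<longlonglongrightarrow> bethe_field \<beta> B X"
proof -
  obtain h where h: "(\<lambda>t. tree_field \<beta> B 0 t X) \<longlonglongrightarrow> h" "(\<lambda>t. tree_field \<beta> B \<beta> t X) \<longlonglongrightarrow> h"
    using tree_field_limits_agree[OF assms] by blast
  moreover have "bethe_field \<beta> B X = h" unfolding bethe_field_def using h(1) by (rule limI)
  ultimately show "(\<lambda>t. tree_field \<beta> B 0 t X) \<longlonglongrightarrow> bethe_field \<beta> B X"
    "(\<lambda>t. tree_field \<beta> B \<beta> t X) \<longlonglongrightarrow> bethe_field \<beta> B X" by auto
qed

lemma bethe_expectation_root:
  assumes "0 \<le> \<beta>" "0 < B"
  shows "bethe_expectation \<beta> B X (\<lambda>\<sigma>. \<sigma> []) = tanh (bethe_field \<beta> B X)"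
proof -
  have f: "(\<lambda>t. tree_expectation_free \<beta> B X t (\<lambda>\<sigma>. \<sigma> [])) \<longlonglongrightarrow> tanh (bethe_field \<beta> B X)"
    unfolding tree_expectation_free_eq by (intro tendsto_tanh tree_field_free_tendsto assms) auto
  have "(\<lambda>t. tree_expectation_plus \<beta> B X (Suc t) (\<lambda>\<sigma>. \<sigma> [])) \<longlonglongrightarrow> tanh (bethe_field \<beta> B X)"
    unfolding tree_expectation_plus_eq by (intro tendsto_tanh tree_field_plus_tendsto assms) auto
  then have p: "(\<lambda>t. tree_expectation_plus \<beta> B X t (\<lambda>\<sigma>. \<sigma> [])) \<longlonglongrightarrow> tanh (bethe_field \<beta> B X)"
    by (rule LIMSEQ_imp_Suc)
  show ?thesis unfolding bethe_expectation_def
  proof (rule the_equality)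
    fix m assume "(\<lambda>t. tree_expectation_plus \<beta> B X t (\<lambda>\<sigma>. \<sigma> [])) \<longlonglongrightarrow> m \<and>
      (\<lambda>t. tree_expectation_free \<beta> B X t (\<lambda>\<sigma>. \<sigma> [])) \<longlonglongrightarrow> m"
    then show "m = tanh (bethe_field \<beta> B X)" using LIMSEQ_unique f by blast
  qed (use f p in blast)
qed

section \<open>Moments of the field on random trees\<close>

abbreviation offspring_space :: "(nat list \<Rightarrow> nat) measure" where
  "offspring_space \<equiv> PiM UNIV (\<lambda>_. count_space UNIV)"

lemma sets_offspring_law [measurable_cong]: "sets (offspring_law D K) = sets offspring_space"
  unfolding offspring_law_def by (intro sets_PiM_cong) auto

lemma space_offspring_law [simp]: "space (offspring_law D K) = UNIV"
  by (simp add: offspring_law_def space_PiM)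

lemma prob_space_offspring_law: "prob_space (offspring_law D K)"
  unfolding offspring_law_def by (intro prob_space_PiM measure_pmf.prob_space_axioms)

lemma measurable_offspring [measurable]: "(\<lambda>X. X v) \<in> measurable offspring_space (count_space UNIV)"
  by (rule measurable_component_singleton) auto

lemma measurable_subtree [measurable]: "(\<lambda>X. subtree X i) \<in> measurable offspring_space offspring_space"
  by (intro measurable_abs_UNIV measurable_offspring)

lemma measurable_truncate [measurable]: "(\<lambda>X v. min N (X v)) \<in> measurable offspring_space offspring_space"
  by (intro measurable_abs_UNIV measurable_compose[OF measurable_offspring]) auto

lemma borel_measurable_passed_field [measurable]: "passed_field \<beta> \<in> borel_measurable borel"
  by (intro borel_measurable_continuous_onI continuous_at_imp_continuous_on ballI isCont_passed_field)

lemma measurable_tree_field [measurable]: "tree_field \<beta> B s t \<in> borel_measurable offspring_space"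
proof (induction t)
  case 0
  have "(\<lambda>X. real (X [])) \<in> borel_measurable offspring_space"
    by (rule measurable_compose[OF measurable_offspring]) auto
  then show ?case by (simp add: tree_field.simps[abs_def])
next
  case (Suc t)
  have "(\<lambda>X. \<Sum>i<k. passed_field \<beta> (tree_field \<beta> B s t (subtree X i))) \<in> borel_measurable offspring_space" for k
    by (intro borel_measurable_sum measurable_compose[OF _ borel_measurable_passed_field] measurable_compose[OF measurable_subtree Suc])
  then have "(\<lambda>X. \<Sum>i<X []. passed_field \<beta> (tree_field \<beta> B s t (subtree X i))) \<in> borel_measurable offspring_space"
    by (rule measurable_compose_countable) measurable
  then show ?case by (simp add: tree_field.simps[abs_def])
qed

lemma measurable_bethe_field [measurable]:
  assumes "0 \<le> \<beta>" "0 < B" shows "bethe_field \<beta> B \<in> borel_measurable offspring_space"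
  by (rule borel_measurable_LIMSEQ_real[OF tree_field_free_tendsto[OF assms] measurable_tree_field])

lemma distr_subtree: "distr (offspring_law D K) offspring_space (\<lambda>X. subtree X i) = offspring_law K K"
proof -
  let ?M = "\<lambda>v::nat list. measure_pmf (if v = [] then D else K)"
  have "distr (PiM UNIV ?M) (PiM UNIV (\<lambda>v. ?M (i # v))) (\<lambda>\<omega>. \<lambda>n\<in>UNIV. \<omega> (i # n)) = PiM UNIV (\<lambda>v. ?M (i # v))"
    by (rule distr_PiM_reindex) (auto intro: measure_pmf.prob_space_axioms)
  moreover have "sets (PiM UNIV (\<lambda>v. ?M (i # v))) = sets offspring_space"
    by (intro sets_PiM_cong) auto
  ultimately show ?thesis
    by (simp add: offspring_law_def restrict_def cong: distr_cong)
qed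

lemma distr_offspring:
  "distr (offspring_law D K) (measure_pmf (if v = [] then D else K)) (\<lambda>X. X v) = measure_pmf (if v = [] then D else K)"
  unfolding offspring_law_def by (rule distr_PiM_component) (auto intro: measure_pmf.prob_space_axioms)

lemma distr_root: "distr (offspring_law D K) (count_space UNIV) (\<lambda>X. X []) = measure_pmf D"
proof -
  have "distr (offspring_law D K) (count_space UNIV) (\<lambda>X. X []) = distr (offspring_law D K) (measure_pmf D) (\<lambda>X. X [])"
    by (rule distr_cong) auto
  then show ?thesis using distr_offspring[of D K "[]"] by simp
qed

text \<open>The root's offspring number and the subtrees of its potential children depend on disjoint blocks of
coordinates. Subtrees of all potential children are included, as \<open>offspring_law\<close> attaches offspring
numbers to every list.\<close>

lemma indep_root_subtrees:
  fixes \<phi> :: "nat \<Rightarrow> 'b::topological_space"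
  assumes \<psi>: "\<And>i. \<psi> i \<in> borel_measurable offspring_space"
  shows "prob_space.indep_vars (offspring_law D K) (\<lambda>_. borel)
     (\<lambda>j X. case j of 0 \<Rightarrow> \<phi> (X []) | Suc i \<Rightarrow> \<psi> i (subtree X i)) UNIV"
proof -
  interpret prob_space "offspring_law D K" by (rule prob_space_offspring_law)
  let ?M = "\<lambda>v::nat list. measure_pmf (if v = [] then D else K)"
  have pmf: "measurable N (?M v) = measurable N (count_space UNIV)" for N :: "(nat list \<Rightarrow> nat) measure" and v
    by (rule measurable_cong_sets) auto
  let ?B = "\<lambda>j. case j of 0 \<Rightarrow> {[]} | Suc i \<Rightarrow> range ((#) i)"
  have "indep_vars ?M (\<lambda>v X. X v) UNIV"
  proof (subst indep_vars_iff_distr_eq_PiM)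
    show "distr (offspring_law D K) (PiM UNIV ?M) (\<lambda>X. \<lambda>v\<in>UNIV. X v) =
        PiM UNIV (\<lambda>v. distr (offspring_law D K) (?M v) (\<lambda>X. X v))"
      unfolding distr_offspring by (simp add: offspring_law_def restrict_def distr_id[unfolded id_def])
  qed (auto simp: offspring_law_def)
  then have "indep_vars (\<lambda>j. PiM (?B j) ?M) (\<lambda>j X. restrict (\<lambda>v. X v) (?B j)) UNIV"
    by (rule indep_vars_restrict) (auto simp: disjoint_family_on_def split: nat.splits)
  then have "indep_vars (\<lambda>_. borel) (\<lambda>j X. (case j of 0 \<Rightarrow> (\<lambda>Y. \<phi> (Y [])) | Suc i \<Rightarrow> (\<lambda>Y. \<psi> i (subtree Y i)))
      (restrict (\<lambda>v. X v) (?B j))) UNIV"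
  proof (rule indep_vars_compose2)
    fix j :: nat
    show "(case j of 0 \<Rightarrow> (\<lambda>Y. \<phi> (Y [])) | Suc i \<Rightarrow> (\<lambda>Y. \<psi> i (subtree Y i))) \<in> measurable (PiM (?B j) ?M) borel"
    proof (cases j)
      case 0
      have "(\<lambda>Y. Y []) \<in> measurable (PiM {[]} ?M) (?M [])" by (rule measurable_component_singleton) auto
      then have "(\<lambda>Y. Y []) \<in> measurable (PiM {[]} ?M) (count_space UNIV)" unfolding pmf .
      then have "(\<lambda>Y. \<phi> (Y [])) \<in> measurable (PiM {[]} ?M) borel"
        by (rule measurable_compose) simp
      then show ?thesis unfolding 0 nat.case .
    next
      case (Suc i)
      have "(\<lambda>Y v. Y (i # v)) \<in> measurable (PiM (range ((#) i)) ?M) offspring_space"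
      proof (rule measurable_abs_UNIV)
        fix v
        have "(\<lambda>Y. Y (i # v)) \<in> measurable (PiM (range ((#) i)) ?M) (?M (i # v))"
          by (rule measurable_component_singleton) auto
        then show "(\<lambda>Y. Y (i # v)) \<in> measurable (PiM (range ((#) i)) ?M) (count_space UNIV)" unfolding pmf .
      qed
      then have "(\<lambda>Y. \<psi> i (subtree Y i)) \<in> measurable (PiM (range ((#) i)) ?M) borel"
        by (rule measurable_compose) (rule \<psi>)
      then show ?thesis unfolding Suc nat.case .
    qed
  qed
  then show ?thesis
    by (rule indep_vars_cong[THEN iffD1, rotated -1]) (auto split: nat.splits)
qed

lemma nn_integral_root_times_subtree:
  fixes \<phi> :: "nat \<Rightarrow> ennreal"
  assumes \<psi>: "\<psi> \<in> borel_measurable offspring_space"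
  shows "(\<integral>\<^sup>+X. \<phi> (X []) * \<psi> (subtree X i) \<partial>offspring_law D K)
     = (\<integral>\<^sup>+k. \<phi> k \<partial>D) * (\<integral>\<^sup>+X. \<psi> X \<partial>offspring_law K K)"
proof -
  interpret prob_space "offspring_law D K" by (rule prob_space_offspring_law)
  let ?U = "\<lambda>j X. case j of 0 \<Rightarrow> \<phi> (X []) | Suc i \<Rightarrow> \<psi> (subtree X i)"
  have ind: "indep_vars (\<lambda>_. borel) ?U {0, Suc i}"
    by (rule indep_vars_subset[OF indep_root_subtrees]) (auto simp: \<psi>)
  have "(\<integral>\<^sup>+X. \<phi> (X []) * \<psi> (subtree X i) \<partial>offspring_law D K) = (\<integral>\<^sup>+X. (\<Prod>j\<in>{0, Suc i}. ?U j X) \<partial>offspring_law D K)"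
    by simp
  also have "\<dots> = (\<integral>\<^sup>+X. \<phi> (X []) \<partial>offspring_law D K) * (\<integral>\<^sup>+X. \<psi> (subtree X i) \<partial>offspring_law D K)"
    by (subst indep_vars_nn_integral[OF _ ind]) auto
  also have "(\<integral>\<^sup>+X. \<phi> (X []) \<partial>offspring_law D K) = (\<integral>\<^sup>+k. \<phi> k \<partial>D)"
    by (subst distr_root[of D K, symmetric], subst nn_integral_distr) auto
  also have "(\<integral>\<^sup>+X. \<psi> (subtree X i) \<partial>offspring_law D K) = (\<integral>\<^sup>+X. \<psi> X \<partial>offspring_law K K)"
    by (subst distr_subtree[of D K i, symmetric], subst nn_integral_distr) (auto simp: \<psi>)
  finally show ?thesis .
qed

text \<open>Wald's identity: the number of children is independent of each subtree.\<close>

lemma nn_integral_sum_subtrees: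
  fixes \<psi> :: "_ \<Rightarrow> ennreal"
  assumes \<psi>[measurable]: "\<psi> \<in> borel_measurable offspring_space"
  shows "(\<integral>\<^sup>+X. (\<Sum>i<X []. \<psi> (subtree X i)) \<partial>offspring_law D K)
     = (\<integral>\<^sup>+k. ennreal (real k) \<partial>D) * (\<integral>\<^sup>+X. \<psi> X \<partial>offspring_law K K)"
proof -
  have ind: "(\<Sum>i. of_bool (i < n) * f i) = (\<Sum>i<n. f i)" for n and f :: "nat \<Rightarrow> ennreal"
    by (subst suminf_finite[of "{..<n}"]) auto
  have "(\<integral>\<^sup>+X. (\<Sum>i<X []. \<psi> (subtree X i)) \<partial>offspring_law D K)
      = (\<integral>\<^sup>+X. (\<Sum>i. of_bool (i < X []) * \<psi> (subtree X i)) \<partial>offspring_law D K)"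
    by (simp add: ind)
  also have "\<dots> = (\<Sum>i. \<integral>\<^sup>+X. of_bool (i < X []) * \<psi> (subtree X i) \<partial>offspring_law D K)"
    by (rule nn_integral_suminf) measurable
  also have "\<dots> = (\<Sum>i. (\<integral>\<^sup>+k. of_bool (i < k) \<partial>D) * (\<integral>\<^sup>+X. \<psi> X \<partial>offspring_law K K))"
    by (subst nn_integral_root_times_subtree[OF \<psi>]) simp
  also have "\<dots> = (\<Sum>i. \<integral>\<^sup>+k. of_bool (i < k) \<partial>D) * (\<integral>\<^sup>+X. \<psi> X \<partial>offspring_law K K)"
    by (rule ennreal_suminf_multc)
  also have "(\<Sum>i. \<integral>\<^sup>+k. of_bool (i < k) \<partial>D) = (\<integral>\<^sup>+k. (\<Sum>i. of_bool (i < k)) \<partial>D)"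
    by (rule nn_integral_suminf[symmetric]) simp
  also have "(\<lambda>k. \<Sum>i. of_bool (i < k) :: ennreal) = (\<lambda>k. ennreal (real k))"
    using ind[of _ "\<lambda>_. 1"] by (auto simp: ennreal_of_nat_eq_real_of_nat)
  finally show ?thesis .
qed

text \<open>Free and plus limits agree for every tree, so the infinite-volume expectation is given by the field
everywhere and its integral needs no discussion of exceptional trees.\<close>

lemma bethe_magnetization_eq:
  assumes "0 \<le> \<beta>" "0 < B"
  shows "bethe_magnetization D K \<beta> B = (\<integral>X. tanh (bethe_field \<beta> B X) \<partial>offspring_law D K)"
  unfolding bethe_magnetization_def by (simp add: bethe_expectation_root assms)

lemma borel_measurable_tanh [measurable]: "(tanh :: real \<Rightarrow> real) \<in> borel_measurable borel"
  by (intro borel_measurable_continuous_onI continuous_intros) auto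

lemma integrable_tanh:
  assumes "f \<in> borel_measurable offspring_space" shows "integrable (offspring_law D K) (\<lambda>X. tanh (f X) :: real)"
proof -
  interpret prob_space "offspring_law D K" by (rule prob_space_offspring_law)
  have [measurable]: "f \<in> borel_measurable (offspring_law D K)" using assms by simp
  show ?thesis by (rule integrable_const_bound[of _ 1]) (auto simp: less_imp_le abs_tanh_lt_1)
qed

lemma
  assumes "0 \<le> \<beta>" "0 < B"
  shows magnetization_free_tendsto:
      "(\<lambda>t. \<integral>X. tanh (tree_field \<beta> B 0 t X) \<partial>offspring_law D K) \<longlonglongrightarrow> bethe_magnetization D K \<beta> B"
    and magnetization_plus_tendsto:
      "(\<lambda>t. \<integral>X. tanh (tree_field \<beta> B \<beta> t X) \<partial>offspring_law D K) \<longlonglongrightarrow> bethe_magnetization D K \<beta> B"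
proof -
  interpret prob_space "offspring_law D K" by (rule prob_space_offspring_law)
  have [measurable]: "bethe_field \<beta> B \<in> borel_measurable (offspring_law D K)"
    using measurable_bethe_field[OF assms] by simp
  show "(\<lambda>t. \<integral>X. tanh (tree_field \<beta> B 0 t X) \<partial>offspring_law D K) \<longlonglongrightarrow> bethe_magnetization D K \<beta> B"
    unfolding bethe_magnetization_eq[OF assms]
    by (rule integral_dominated_convergence[where w = "\<lambda>_. 1"])
       (auto intro!: tendsto_tanh tree_field_free_tendsto assms simp: less_imp_le abs_tanh_lt_1)
  show "(\<lambda>t. \<integral>X. tanh (tree_field \<beta> B \<beta> t X) \<partial>offspring_law D K) \<longlonglongrightarrow> bethe_magnetization D K \<beta> B"
    unfolding bethe_magnetization_eq[OF assms]
    by (rule integral_dominated_convergence[where w = "\<lambda>_. 1"])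
       (auto intro!: tendsto_tanh tree_field_plus_tendsto assms simp: less_imp_le abs_tanh_lt_1)
qed

lemma bethe_magnetization_mono:
  assumes "0 \<le> \<beta>" "0 < B" "B \<le> B'"
  shows "bethe_magnetization D K \<beta> B \<le> bethe_magnetization D K \<beta> B'"
proof (rule LIMSEQ_le[OF magnetization_free_tendsto magnetization_free_tendsto])
  show "\<exists>N. \<forall>t\<ge>N. (\<integral>X. tanh (tree_field \<beta> B 0 t X) \<partial>offspring_law D K)
      \<le> (\<integral>X. tanh (tree_field \<beta> B' 0 t X) \<partial>offspring_law D K)"
    using assms by (intro exI[of _ 0] allI impI integral_mono integrable_tanh measurable_tree_field)
      (auto intro!: tree_field_mono)
qed (use assms in auto)

lemma bethe_magnetization_nonneg:
  assumes "0 \<le> \<beta>" "0 < B" shows "0 \<le> bethe_magnetization D K \<beta> B"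
  by (rule LIMSEQ_le_const[OF magnetization_free_tendsto[OF assms]])
     (use assms in \<open>auto intro!: exI[of _ 0] integral_nonneg_AE simp: tree_field_nonneg\<close>)

lemma nn_integral_tree_field_Suc_le:
  assumes "0 \<le> \<beta>" "0 \<le> B"
  shows "(\<integral>\<^sup>+X. ennreal (tree_field \<beta> B 0 (Suc t) X) \<partial>offspring_law D K)
     \<le> ennreal B + ennreal (tanh \<beta>) * (\<integral>\<^sup>+k. ennreal (real k) \<partial>D) * (\<integral>\<^sup>+X. ennreal (tree_field \<beta> B 0 t X) \<partial>offspring_law K K)"
proof -
  interpret prob_space "offspring_law D K" by (rule prob_space_offspring_law)
  let ?f = "tree_field \<beta> B 0 t"
  have f: "0 \<le> ?f X" for X using assms by (intro tree_field_nonneg) auto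
  have "(\<integral>\<^sup>+X. ennreal (tree_field \<beta> B 0 (Suc t) X) \<partial>offspring_law D K)
      = (\<integral>\<^sup>+X. ennreal B + (\<Sum>i<X []. ennreal (passed_field \<beta> (?f (subtree X i)))) \<partial>offspring_law D K)"
    using assms f by (intro nn_integral_cong) (simp add: ennreal_plus sum_nonneg passed_field_nonneg sum_ennreal)
  also have "\<dots> = ennreal B + (\<integral>\<^sup>+X. (\<Sum>i<X []. ennreal (passed_field \<beta> (?f (subtree X i)))) \<partial>offspring_law D K)"
  proof (subst nn_integral_add)
    show "(\<lambda>X. \<Sum>i<X []. ennreal (passed_field \<beta> (?f (subtree X i)))) \<in> borel_measurable (offspring_law D K)"
      by (rule measurable_compose_countable) measurable
  qed (auto simp: emeasure_space_1[simplified])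
  also have "(\<integral>\<^sup>+X. (\<Sum>i<X []. ennreal (passed_field \<beta> (?f (subtree X i)))) \<partial>offspring_law D K)
      = (\<integral>\<^sup>+k. ennreal (real k) \<partial>D) * (\<integral>\<^sup>+X. ennreal (passed_field \<beta> (?f X)) \<partial>offspring_law K K)"
    by (rule nn_integral_sum_subtrees) measurable
  finally have eq: "(\<integral>\<^sup>+X. ennreal (tree_field \<beta> B 0 (Suc t) X) \<partial>offspring_law D K)
      = ennreal B + (\<integral>\<^sup>+k. ennreal (real k) \<partial>D) * (\<integral>\<^sup>+X. ennreal (passed_field \<beta> (?f X)) \<partial>offspring_law K K)" .
  have "(\<integral>\<^sup>+X. ennreal (passed_field \<beta> (?f X)) \<partial>offspring_law K K)
      \<le> (\<integral>\<^sup>+X. ennreal (tanh \<beta>) * ennreal (?f X) \<partial>offspring_law K K)"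
    using assms f by (intro nn_integral_mono) (simp add: ennreal_mult[symmetric] ennreal_leI passed_field_le_mult)
  also have "\<dots> = ennreal (tanh \<beta>) * (\<integral>\<^sup>+X. ennreal (?f X) \<partial>offspring_law K K)"
    by (rule nn_integral_cmult) measurable
  finally have "(\<integral>\<^sup>+k. ennreal (real k) \<partial>D) * (\<integral>\<^sup>+X. ennreal (passed_field \<beta> (?f X)) \<partial>offspring_law K K)
      \<le> (\<integral>\<^sup>+k. ennreal (real k) \<partial>D) * (ennreal (tanh \<beta>) * (\<integral>\<^sup>+X. ennreal (?f X) \<partial>offspring_law K K))"
    by (rule mult_left_mono) simp
  then show ?thesis unfolding eq by (intro add_left_mono) (simp only: mult_ac)
qed

text \<open>Since a passed field is at most \<open>tanh \<beta> * h\<close>, the mean field below the root satisfies \<open>e (t + 1) \<le> B + q * e t\<close> with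
\<open>q = tanh \<beta> * \<nu> < 1\<close>, hence stays below \<open>B / (1 - q)\<close>; one more step of the recursion, with the
offspring law of the root, gives a bound that is linear in \<open>B\<close>.\<close>

lemma bethe_magnetization_le_linear:
  assumes \<beta>: "0 \<le> \<beta>" and sub: "ennreal (tanh \<beta>) * (\<integral>\<^sup>+k. ennreal (real k) \<partial>measure_pmf K) < 1"
    and D: "integrable (measure_pmf D) real"
  shows "\<exists>C. \<forall>B>0. bethe_magnetization D K \<beta> B \<le> C * B"
proof -
  define q where "q = enn2real (ennreal (tanh \<beta>) * (\<integral>\<^sup>+k. ennreal (real k) \<partial>measure_pmf K))"
  have q: "ennreal q = ennreal (tanh \<beta>) * (\<integral>\<^sup>+k. ennreal (real k) \<partial>measure_pmf K)" "0 \<le> q"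
    unfolding q_def using sub by (auto intro!: ennreal_enn2real order.strict_trans[OF sub])
  have "q < 1" using sub unfolding q(1)[symmetric] using q(2) by (simp add: ennreal_less_one_iff)
  define d where "d = measure_pmf.expectation D real"
  have d: "(\<integral>\<^sup>+k. ennreal (real k) \<partial>D) = ennreal d" unfolding d_def
    by (rule nn_integral_eq_integral[OF D]) auto
  have d0: "0 \<le> d" by (simp add: d_def)
  define C where "C = 1 + tanh \<beta> * d / (1 - q)"
  have "bethe_magnetization D K \<beta> B \<le> C * B" if B: "0 < B" for B
  proof -
    have cavity: "(\<integral>\<^sup>+X. ennreal (tree_field \<beta> B 0 t X) \<partial>offspring_law K K) \<le> ennreal (B / (1 - q))" for t
    proof (induction t)
      case 0
      interpret prob_space "offspring_law K K" by (rule prob_space_offspring_law)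
      have "B \<le> B / (1 - q)" using B q(2) \<open>q < 1\<close> by (simp add: field_simps)
      then show ?case by (simp add: emeasure_space_1[simplified] ennreal_leI)
    next
      case (Suc t)
      have "(\<integral>\<^sup>+X. ennreal (tree_field \<beta> B 0 (Suc t) X) \<partial>offspring_law K K)
          \<le> ennreal B + ennreal q * (\<integral>\<^sup>+X. ennreal (tree_field \<beta> B 0 t X) \<partial>offspring_law K K)"
        unfolding q(1) using \<beta> B by (intro nn_integral_tree_field_Suc_le) auto
      also have "\<dots> \<le> ennreal B + ennreal q * ennreal (B / (1 - q))"
        by (intro add_left_mono mult_left_mono Suc) auto
      also have "\<dots> = ennreal (B + q * (B / (1 - q)))"
        using B q(2) \<open>q < 1\<close>
          by (simp add: ennreal_mult[symmetric] ennreal_plus[symmetric] del: ennreal_plus)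
      also have "B + q * (B / (1 - q)) = B / (1 - q)" using \<open>q < 1\<close> by (simp add: field_simps)
      finally show ?case .
    qed
    show ?thesis
    proof (rule LIMSEQ_le_const2[OF LIMSEQ_Suc[OF magnetization_free_tendsto[OF \<beta> B]]], intro exI[of _ 0] allI impI)
      fix t
      let ?h = "tree_field \<beta> B 0 (Suc t)"
      have h: "0 \<le> ?h X" for X using \<beta> B by (intro tree_field_nonneg) auto
      have "ennreal (\<integral>X. tanh (?h X) \<partial>offspring_law D K) = (\<integral>\<^sup>+X. ennreal (tanh (?h X)) \<partial>offspring_law D K)"
        by (rule nn_integral_eq_integral[symmetric, OF integrable_tanh[OF measurable_tree_field]]) (use h in auto)
      also have "\<dots> \<le> (\<integral>\<^sup>+X. ennreal (?h X) \<partial>offspring_law D K)"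
        using h by (intro nn_integral_mono ennreal_leI tanh_le_self) auto
      also have "\<dots> \<le> ennreal B + ennreal (tanh \<beta>) * ennreal d * (\<integral>\<^sup>+X. ennreal (tree_field \<beta> B 0 t X) \<partial>offspring_law K K)"
        unfolding d[symmetric] using \<beta> B by (intro nn_integral_tree_field_Suc_le) auto
      also have "\<dots> \<le> ennreal B + ennreal (tanh \<beta>) * ennreal d * ennreal (B / (1 - q))"
        by (intro add_left_mono mult_left_mono cavity) auto
      also have "\<dots> = ennreal (B + tanh \<beta> * d * (B / (1 - q)))"
        using B \<beta> d0 \<open>q < 1\<close>
          by (simp add: ennreal_mult[symmetric] ennreal_plus[symmetric] del: ennreal_plus)
      also have "B + tanh \<beta> * d * (B / (1 - q)) = C * B" by (simp add: C_def algebra_simps)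
      finally show "(\<integral>X. tanh (?h X) \<partial>offspring_law D K) \<le> C * B"
        using B \<beta> d0 \<open>q < 1\<close> by (subst (asm) ennreal_le_iff) (auto simp: C_def)
    qed
  qed
  then show ?thesis by blast
qed

lemma
  fixes \<psi> :: "_ \<Rightarrow> real"
  assumes \<psi>: "\<psi> \<in> borel_measurable offspring_space" "\<And>X. \<bar>\<psi> X\<bar> \<le> c"
  shows integral_root_times_subtree: "(\<integral>X. of_bool (i < X []) * \<psi> (subtree X i) \<partial>offspring_law D K)
       = measure_pmf.prob D {i<..} * (\<integral>X. \<psi> X \<partial>offspring_law K K)"
    and integral_subtree_times_subtree: "i \<noteq> j \<Longrightarrow> (\<integral>X. \<psi> (subtree X i) * \<psi> (subtree X j) \<partial>offspring_law D K)
       = (\<integral>X. \<psi> X \<partial>offspring_law K K)^2"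
proof -
  interpret prob_space "offspring_law D K" by (rule prob_space_offspring_law)
  let ?U = "\<lambda>j X. case j of 0 \<Rightarrow> of_bool (i < X []) | Suc i \<Rightarrow> \<psi> (subtree X i)"
  have ind: "indep_vars (\<lambda>_. borel) ?U J" for J
    by (rule indep_vars_subset[OF indep_root_subtrees]) (auto simp: \<psi>)
  have sub: "(\<integral>X. \<psi> (subtree X i) \<partial>offspring_law D K) = (\<integral>X. \<psi> X \<partial>offspring_law K K)" for i
    by (subst distr_subtree[of D K i, symmetric], subst integral_distr) (auto simp: \<psi>)
  have root: "(\<integral>X. of_bool (i < X []) \<partial>offspring_law D K) = measure_pmf.prob D {i<..}"
  proof -
    have "(\<integral>X. (of_bool (i < X []) :: real) \<partial>offspring_law D K) = (\<integral>k. of_bool (i < k) \<partial>measure_pmf D)"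
      by (subst distr_root[of D K, symmetric], subst integral_distr) auto
    also have "\<dots> = (\<integral>k. indicator {i<..} k \<partial>measure_pmf D)"
      by (intro Bochner_Integration.integral_cong) (auto simp: indicator_def)
    finally show ?thesis by simp
  qed
  have [measurable]: "(\<lambda>X. \<psi> (subtree X i)) \<in> borel_measurable (offspring_law D K)" for i
    using \<psi>(1) by measurable
  have int: "integrable (offspring_law D K) (\<lambda>X. \<psi> (subtree X i))" for i
    by (rule integrable_const_bound[of _ c]) (auto simp: \<psi>)
  have int0: "integrable (offspring_law D K) (\<lambda>X. of_bool (i < X []) :: real)"
    by (rule integrable_const_bound[of _ 1]) auto
  have intU: "integrable (offspring_law D K) (?U j)" for j
    using int int0 by (cases j) auto
  have "(\<integral>X. of_bool (i < X []) * \<psi> (subtree X i) \<partial>offspring_law D K) = (\<integral>X. (\<Prod>j\<in>{0, Suc i}. ?U j X) \<partial>offspring_law D K)"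
    by simp
  also have "\<dots> = (\<Prod>j\<in>{0, Suc i}. \<integral>X. ?U j X \<partial>offspring_law D K)"
    by (rule indep_vars_lebesgue_integral[OF _ ind intU]) auto
  finally show "(\<integral>X. of_bool (i < X []) * \<psi> (subtree X i) \<partial>offspring_law D K)
       = measure_pmf.prob D {i<..} * (\<integral>X. \<psi> X \<partial>offspring_law K K)"
    by (simp add: sub root)
  assume "i \<noteq> j"
  then have "(\<integral>X. \<psi> (subtree X i) * \<psi> (subtree X j) \<partial>offspring_law D K) = (\<integral>X. (\<Prod>j\<in>{Suc i, Suc j}. ?U j X) \<partial>offspring_law D K)"
    by simp
  also have "\<dots> = (\<Prod>j\<in>{Suc i, Suc j}. \<integral>X. ?U j X \<partial>offspring_law D K)"
    by (rule indep_vars_lebesgue_integral[OF _ ind intU]) auto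
  finally show "(\<integral>X. \<psi> (subtree X i) * \<psi> (subtree X j) \<partial>offspring_law D K) = (\<integral>X. \<psi> X \<partial>offspring_law K K)^2"
    using \<open>i \<noteq> j\<close> by (simp add: sub power2_eq_square)
qed

text \<open>The mean of \<open>min N K\<close>, written as a sum of tail probabilities since these appear as the weights of
the individual potential children.\<close>

definition truncated_mean :: "nat pmf \<Rightarrow> nat \<Rightarrow> real" where
  "truncated_mean K N = (\<Sum>i<N. measure_pmf.prob K {i<..})"

lemma truncated_mean_eq: "ennreal (truncated_mean K N) = (\<integral>\<^sup>+k. ennreal (real (min N k)) \<partial>measure_pmf K)"
proof -
  have inner: "(\<Sum>i<N. indicator {i<..} k) = ennreal (real (min N k))" for k
  proof -
    have "(\<Sum>i<N. indicator {i<..} k :: ennreal) = (\<Sum>i\<in>{..<min N k}. 1)"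
      by (rule sum.mono_neutral_cong_right) (auto simp: indicator_def)
    then show ?thesis by (simp add: ennreal_of_nat_eq_real_of_nat)
  qed
  have "ennreal (truncated_mean K N) = (\<Sum>i<N. \<integral>\<^sup>+k. indicator {i<..} k \<partial>measure_pmf K)"
    by (simp add: truncated_mean_def measure_pmf.emeasure_eq_measure sum_ennreal)
  also have "\<dots> = (\<integral>\<^sup>+k. (\<Sum>i<N. indicator {i<..} k) \<partial>measure_pmf K)"
    by (rule nn_integral_sum[symmetric]) simp
  finally show ?thesis by (simp only: inner)
qed

text \<open>In the second moment the diagonal terms carry the weights \<open>P(K > i)\<close>, and each of the at most
\<open>N\<^sup>2\<close> off-diagonal terms is at most the squared mean by independence of distinct subtrees.\<close>

lemma
  fixes \<psi> :: "_ \<Rightarrow> real"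
  assumes \<psi>: "\<psi> \<in> borel_measurable offspring_space" "\<And>X. 0 \<le> \<psi> X" "\<And>X. \<psi> X \<le> c"
  shows integral_truncated_sum: "(\<integral>X. (\<Sum>i<min N (X []). \<psi> (subtree X i)) \<partial>offspring_law K K)
       = truncated_mean K N * (\<integral>X. \<psi> X \<partial>offspring_law K K)"
    and integral_truncated_sum_square: "(\<integral>X. (\<Sum>i<min N (X []). \<psi> (subtree X i))^2 \<partial>offspring_law K K)
       \<le> truncated_mean K N * (\<integral>X. (\<psi> X)^2 \<partial>offspring_law K K) + real N ^ 2 * (\<integral>X. \<psi> X \<partial>offspring_law K K)^2"
proof -
  let ?\<mu> = "offspring_law K K"
  interpret prob_space ?\<mu> by (rule prob_space_offspring_law)
  let ?T = "\<lambda>i X. of_bool (i < X []) * \<psi> (subtree X i)"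
  have \<psi>2: "(\<lambda>X. (\<psi> X)^2) \<in> borel_measurable offspring_space" "\<And>X. \<bar>(\<psi> X)^2\<bar> \<le> c^2" "\<And>X. \<bar>\<psi> X\<bar> \<le> c"
    using \<psi> by (auto intro!: power_mono)
  have c: "0 \<le> c" using order.trans[OF \<psi>(2,3)] .
  have [measurable]: "(\<lambda>X. \<psi> (subtree X i)) \<in> borel_measurable ?\<mu>" for i
    using \<psi>(1) by measurable
  have T: "0 \<le> ?T i X" "?T i X \<le> c" for i X using \<psi>(2,3) c by (auto simp: of_bool_def)
  have intT: "integrable ?\<mu> (?T i)" for i
    using T by (intro integrable_const_bound[of _ c]) auto
  have bound: "\<bar>a * b\<bar> \<le> c * c" if "\<bar>a\<bar> \<le> c" "\<bar>b\<bar> \<le> c" for a b :: real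
    unfolding abs_mult using mult_mono[OF that c abs_ge_zero] .
  have absT: "\<bar>?T i X\<bar> \<le> c" for i X using T[of i X] by (simp only: abs_of_nonneg)
  have intTT: "integrable ?\<mu> (\<lambda>X. ?T i X * ?T j X)" for i j
    by (rule integrable_const_bound[of _ "c * c"], rule always_eventually, rule allI)
       (unfold real_norm_def, rule bound[OF absT absT], measurable)
  have intpp: "integrable ?\<mu> (\<lambda>X. \<psi> (subtree X i) * \<psi> (subtree X j))" for i j
    by (rule integrable_const_bound[of _ "c * c"], rule always_eventually, rule allI)
       (unfold real_norm_def, rule bound[OF \<psi>2(3) \<psi>2(3)], measurable)
  have S: "(\<Sum>i<min N (X []). \<psi> (subtree X i)) = (\<Sum>i<N. ?T i X)" for X
    by (rule sum.mono_neutral_cong_left) auto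
  show "(\<integral>X. (\<Sum>i<min N (X []). \<psi> (subtree X i)) \<partial>?\<mu>) = truncated_mean K N * (\<integral>X. \<psi> X \<partial>?\<mu>)"
    unfolding S Bochner_Integration.integral_sum[OF intT] truncated_mean_def sum_distrib_right
      integral_root_times_subtree[OF \<psi>(1) \<psi>2(3)] by (rule refl)
  let ?m = "\<integral>X. \<psi> X \<partial>?\<mu>" and ?q = "\<integral>X. (\<psi> X)^2 \<partial>?\<mu>"
  have diag: "(\<integral>X. ?T i X * ?T i X \<partial>?\<mu>) = measure_pmf.prob K {i<..} * ?q" for i
  proof -
    have "(\<lambda>X. ?T i X * ?T i X) = (\<lambda>X. of_bool (i < X []) * (\<psi> (subtree X i))^2)"
      by (auto simp: power2_eq_square)
    then show ?thesis using integral_root_times_subtree[OF \<psi>2(1,2)] by simp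
  qed
  have off: "(\<integral>X. ?T i X * ?T j X \<partial>?\<mu>) \<le> ?m^2" if "i \<noteq> j" for i j
  proof -
    have "(\<integral>X. ?T i X * ?T j X \<partial>?\<mu>) \<le> (\<integral>X. \<psi> (subtree X i) * \<psi> (subtree X j) \<partial>?\<mu>)"
      using \<psi>(2) by (intro integral_mono intTT intpp) (auto simp: of_bool_def)
    then show ?thesis using integral_subtree_times_subtree[OF \<psi>(1) \<psi>2(3) that] by simp
  qed
  have "(\<integral>X. (\<Sum>i<min N (X []). \<psi> (subtree X i))^2 \<partial>?\<mu>) = (\<integral>X. (\<Sum>i<N. \<Sum>j<N. ?T i X * ?T j X) \<partial>?\<mu>)"
    unfolding S power2_eq_square sum_product by (rule refl)
  also have "\<dots> = (\<Sum>i<N. \<Sum>j<N. \<integral>X. ?T i X * ?T j X \<partial>?\<mu>)"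
    by (simp only: Bochner_Integration.integral_sum Bochner_Integration.integrable_sum intTT)
  also have "\<dots> \<le> (\<Sum>i<N. \<Sum>j<N. of_bool (i = j) * (measure_pmf.prob K {i<..} * ?q) + ?m^2)"
  proof (intro sum_mono)
    fix i j show "(\<integral>X. ?T i X * ?T j X \<partial>?\<mu>) \<le> of_bool (i = j) * (measure_pmf.prob K {i<..} * ?q) + ?m^2"
      using diag[of i] off[of i j] by (cases "i = j") auto
  qed
  also have "\<dots> = truncated_mean K N * ?q + real N ^ 2 * ?m^2"
  proof -
    have "(\<Sum>j<N. of_bool (i = j) * a) = a" if "i < N" for i and a :: real
      using that by (simp add: of_bool_def if_distrib[of "\<lambda>x. x * a"] cong: if_cong)
    then show ?thesis
      by (simp add: sum.distrib truncated_mean_def sum_distrib_right power2_eq_square)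
  qed
  finally show "(\<integral>X. (\<Sum>i<min N (X []). \<psi> (subtree X i))^2 \<partial>?\<mu>) \<le> truncated_mean K N * ?q + real N ^ 2 * ?m^2" .
qed

text \<open>A second moment argument. In the limit \<open>t \<rightarrow> \<infinity>\<close> the moments \<open>y\<close>, \<open>z\<close> of the field satisfy
\<open>y \<ge> B + l * (y - z)\<close>, from the quadratic lower bound on the passed field, and
\<open>z \<le> B\<^sup>2 + 2 * B * l * y + l * tanh \<beta> * z + N\<^sup>2 * y\<^sup>2\<close>. The factor \<open>l * tanh \<beta>\<close> is the growth rate
of the second moment; as it is below \<open>1\<close>, and as \<open>B \<le> y\<close>, the second moment is of order \<open>y\<^sup>2\<close>. But
\<open>l > 1\<close> forces \<open>z\<close> to be at least of order \<open>y\<close>, which is impossible for small \<open>y\<close>. The bound does not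
depend on \<open>B\<close>.\<close>

lemma truncated_field_mean_lower:
  fixes N :: nat and K :: "nat pmf" and \<beta> B :: real
  defines "H \<equiv> \<lambda>t X. tree_field \<beta> B 0 t (\<lambda>v. min N (X v))"
    and "l \<equiv> truncated_mean K N * tanh \<beta>"
  assumes \<beta>: "0 < \<beta>" and B: "0 < B" and super: "1 < l" and moderate: "l * tanh \<beta> < 1"
  shows "\<exists>y \<ge> (l - 1) * (1 - l * tanh \<beta>) / (l * (1 + 2 * l + real N ^ 2)).
     (\<lambda>t. \<integral>X. H t X \<partial>offspring_law K K) \<longlonglongrightarrow> y"
proof -
  let ?\<mu> = "offspring_law K K" and ?a = "truncated_mean K N"
  interpret prob_space ?\<mu> by (rule prob_space_offspring_law)
  define C where "C = B + \<beta> * real N"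
  have Hm [measurable]: "H t \<in> borel_measurable offspring_space" for t
    unfolding H_def by measurable
  have HB: "B \<le> H t X" for t X unfolding H_def using \<beta> B by (intro tree_field_ge) auto
  have H0: "0 \<le> H t X" for t X using HB[of t X] B by linarith
  have HC: "H t X \<le> C" for t X
  proof -
    have "H t X \<le> B + \<beta> * real (min N (X []))" unfolding H_def using \<beta> B by (intro tree_field_le) auto
    also have "\<dots> \<le> C" unfolding C_def using \<beta> by (intro add_left_mono mult_left_mono) auto
    finally show ?thesis .
  qed
  have H2C: "(H t X)^2 \<le> C^2" for t X by (intro power_mono HC H0)
  have Hinc: "H t X \<le> H (Suc t) X" for t X
    unfolding H_def using \<beta> B by (intro incseq_SucD tree_field_free_incseq) auto
  have intH: "integrable ?\<mu> (H t)" for t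
    by (rule integrable_const_bound[of _ C]) (auto simp: H0 HC)
  have intH2: "integrable ?\<mu> (\<lambda>X. (H t X)^2)" for t
    by (rule integrable_const_bound[of _ "C^2"]) (auto simp: H2C)
  define y where "y = (\<lambda>t. \<integral>X. H t X \<partial>?\<mu>)"
  define z where "z = (\<lambda>t. \<integral>X. (H t X)^2 \<partial>?\<mu>)"
  define S where "S = (\<lambda>t X. \<Sum>i<min N (X []). passed_field \<beta> (H t (subtree X i)))"
  have HSuc: "H (Suc t) X = B + S t X" for t X by (simp add: H_def S_def)
  have xiH: "0 \<le> passed_field \<beta> (H t X)" "passed_field \<beta> (H t X) \<le> \<beta>" "passed_field \<beta> (H t X) \<le> tanh \<beta> * H t X"
     "tanh \<beta> * (H t X - (H t X)^2) \<le> passed_field \<beta> (H t X)" for t X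
    using \<beta> H0 by (auto intro: passed_field_nonneg passed_field_le passed_field_le_mult passed_field_ge_quadratic)
  have xim [measurable]: "(\<lambda>X. passed_field \<beta> (H t X)) \<in> borel_measurable offspring_space" for t by measurable
  have intxi: "integrable ?\<mu> (\<lambda>X. passed_field \<beta> (H t X))" for t
    by (rule integrable_const_bound[of _ \<beta>]) (auto simp: xiH)
  have intxi2: "integrable ?\<mu> (\<lambda>X. (passed_field \<beta> (H t X))^2)" for t
    using xiH by (intro integrable_const_bound[of _ "\<beta>^2"]) (auto intro!: power_mono)
  have S_eq: "S t X = H (Suc t) X - B" for t X by (simp add: HSuc)
  have intS: "integrable ?\<mu> (S t)" for t unfolding S_eq[abs_def] using intH by simp
  have intS2: "integrable ?\<mu> (\<lambda>X. (S t X)^2)" for t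
    unfolding S_eq[abs_def] power2_diff using intH intH2 by simp
  have a: "0 \<le> ?a" by (simp add: truncated_mean_def sum_nonneg)
  have ES: "(\<integral>X. S t X \<partial>?\<mu>) = ?a * (\<integral>X. passed_field \<beta> (H t X) \<partial>?\<mu>)" for t
    unfolding S_def by (rule integral_truncated_sum[OF xim xiH(1,2)])
  have ES2: "(\<integral>X. (S t X)^2 \<partial>?\<mu>) \<le> ?a * (\<integral>X. (passed_field \<beta> (H t X))^2 \<partial>?\<mu>) + real N ^ 2 * (\<integral>X. passed_field \<beta> (H t X) \<partial>?\<mu>)^2" for t
    unfolding S_def by (rule integral_truncated_sum_square[OF xim xiH(1,2)])
  have th: "0 < tanh \<beta>" "tanh \<beta> < 1" using \<beta> by (auto simp: tanh_real_lt_1)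
  have y0: "0 \<le> y t" for t unfolding y_def by (simp add: H0)
  have Exi_le: "(\<integral>X. passed_field \<beta> (H t X) \<partial>?\<mu>) \<le> tanh \<beta> * y t" for t
  proof -
    have "(\<integral>X. passed_field \<beta> (H t X) \<partial>?\<mu>) \<le> (\<integral>X. tanh \<beta> * H t X \<partial>?\<mu>)"
      using intH intxi xiH by (intro integral_mono) auto
    then show ?thesis by (simp add: y_def)
  qed
  have Exi_ge: "tanh \<beta> * (y t - z t) \<le> (\<integral>X. passed_field \<beta> (H t X) \<partial>?\<mu>)" for t
  proof -
    have "(\<integral>X. tanh \<beta> * (H t X - (H t X)^2) \<partial>?\<mu>) \<le> (\<integral>X. passed_field \<beta> (H t X) \<partial>?\<mu>)"
      using intH intH2 intxi xiH by (intro integral_mono) auto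
    then show ?thesis using intH intH2 by (simp add: y_def z_def)
  qed
  have Exi2: "(\<integral>X. (passed_field \<beta> (H t X))^2 \<partial>?\<mu>) \<le> tanh \<beta> ^ 2 * z t" for t
  proof -
    have "(passed_field \<beta> (H t X))^2 \<le> tanh \<beta> ^ 2 * (H t X)^2" for X
      using power_mono[OF xiH(3) xiH(1), of t X 2] by (simp add: power_mult_distrib)
    then have "(\<integral>X. (passed_field \<beta> (H t X))^2 \<partial>?\<mu>) \<le> (\<integral>X. tanh \<beta> ^ 2 * (H t X)^2 \<partial>?\<mu>)"
      using intH2 intxi2 by (intro integral_mono) auto
    then show ?thesis by (simp add: z_def)
  qed
  have ySuc: "B + l * (y t - z t) \<le> y (Suc t)" for t
  proof -
    have "y (Suc t) = B + ?a * (\<integral>X. passed_field \<beta> (H t X) \<partial>?\<mu>)"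
      unfolding y_def HSuc using intS ES by (simp add: prob_space[simplified])
    moreover have "?a * (tanh \<beta> * (y t - z t)) \<le> ?a * (\<integral>X. passed_field \<beta> (H t X) \<partial>?\<mu>)"
      by (intro mult_left_mono Exi_ge a)
    ultimately show ?thesis by (simp add: l_def mult.assoc)
  qed
  have zSuc: "z (Suc t) \<le> B^2 + 2 * B * (l * y t) + l * tanh \<beta> * z t + real N ^ 2 * (y t)^2" for t
  proof -
    have "z (Suc t) = B^2 + 2 * B * (\<integral>X. S t X \<partial>?\<mu>) + (\<integral>X. (S t X)^2 \<partial>?\<mu>)"
      unfolding z_def HSuc power2_sum using intS intS2 by (simp add: prob_space[simplified])
    moreover have "2 * B * (\<integral>X. S t X \<partial>?\<mu>) \<le> 2 * B * (l * y t)"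
      unfolding ES l_def mult.assoc[of ?a] using B a Exi_le by (intro mult_left_mono) auto
    moreover have "?a * (\<integral>X. (passed_field \<beta> (H t X))^2 \<partial>?\<mu>) \<le> l * tanh \<beta> * z t"
      using mult_left_mono[OF Exi2[of t] a] by (simp add: l_def power2_eq_square mult.assoc)
    moreover have "real N ^ 2 * (\<integral>X. passed_field \<beta> (H t X) \<partial>?\<mu>)^2 \<le> real N ^ 2 * (y t)^2"
    proof (intro mult_left_mono power_mono)
      have "tanh \<beta> * y t \<le> y t" using th y0 by (simp add: mult_left_le_one_le)
      then show "(\<integral>X. passed_field \<beta> (H t X) \<partial>?\<mu>) \<le> y t" using Exi_le order.trans by blast
    qed (auto simp: xiH)
    ultimately show ?thesis using ES2[of t] by linarith
  qed
  have "incseq y" unfolding y_def using Hinc by (intro incseq_SucI integral_mono intH) auto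
  moreover have "incseq z" unfolding z_def using Hinc H0 by (intro incseq_SucI integral_mono intH2 power_mono) auto
  moreover have "y t \<le> C" for t unfolding y_def
    by (rule order.trans[OF integral_mono[OF intH, of "\<lambda>_. C"]]) (auto simp: HC prob_space[simplified])
  moreover have "z t \<le> C^2" for t unfolding z_def
    by (rule order.trans[OF integral_mono[OF intH2, of "\<lambda>_. C^2"]]) (auto simp: H2C prob_space[simplified])
  ultimately obtain y' z' where lim: "y \<longlonglongrightarrow> y'" "z \<longlonglongrightarrow> z'"
    using incseq_convergent by metis
  have yB: "B \<le> y'"
  proof (rule LIMSEQ_le_const[OF lim(1)], intro exI[of _ 0] allI impI)
    fix t have "(\<integral>X. B \<partial>?\<mu>) \<le> y t" unfolding y_def using HB by (intro integral_mono intH) auto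
    then show "B \<le> y t" by (simp add: prob_space[simplified])
  qed
  have 1: "B + l * (y' - z') \<le> y'"
  proof (rule LIMSEQ_le[OF _ LIMSEQ_Suc[OF lim(1)]])
    show "(\<lambda>t. B + l * (y t - z t)) \<longlonglongrightarrow> B + l * (y' - z')" by (intro tendsto_intros lim)
  qed (use ySuc in blast)
  have 2: "z' \<le> B^2 + 2 * B * (l * y') + l * tanh \<beta> * z' + real N ^ 2 * y'^2"
  proof (rule LIMSEQ_le[OF LIMSEQ_Suc[OF lim(2)]])
    show "(\<lambda>t. B^2 + 2 * B * (l * y t) + l * tanh \<beta> * z t + real N ^ 2 * (y t)^2)
        \<longlonglongrightarrow> B^2 + 2 * B * (l * y') + l * tanh \<beta> * z' + real N ^ 2 * y'^2" by (intro tendsto_intros lim)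
  qed (use zSuc in blast)
  have y'0: "0 < y'" using yB B by linarith
  have 3: "(l - 1) * y' \<le> l * z'" using 1 B by (simp add: algebra_simps)
  have 4: "(1 - l * tanh \<beta>) * z' \<le> (1 + 2 * l + real N ^ 2) * y'^2"
  proof -
    have "B^2 \<le> y'^2" using yB B by (intro power_mono) auto
    moreover have "2 * B * (l * y') \<le> 2 * y' * (l * y')"
      using yB super y'0 by (intro mult_right_mono) auto
    ultimately show ?thesis using 2 by (simp add: algebra_simps power2_eq_square)
  qed
  have "(l - 1) * (1 - l * tanh \<beta>) * y' \<le> l * ((1 - l * tanh \<beta>) * z')"
    using mult_left_mono[OF 3, of "1 - l * tanh \<beta>"] moderate by (simp add: mult_ac)
  also have "\<dots> \<le> l * ((1 + 2 * l + real N ^ 2) * y'^2)"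
    using 4 super by (intro mult_left_mono) auto
  finally have "(l - 1) * (1 - l * tanh \<beta>) * y' \<le> (l * (1 + 2 * l + real N ^ 2) * y') * y'"
    by (simp add: power2_eq_square mult_ac)
  then have 5: "(l - 1) * (1 - l * tanh \<beta>) \<le> l * (1 + 2 * l + real N ^ 2) * y'"
    using y'0 by simp
  have "0 < l * (1 + 2 * l + real N ^ 2)" using super by (intro mult_pos_pos add_pos_nonneg) auto
  with 5 have "(l - 1) * (1 - l * tanh \<beta>) / (l * (1 + 2 * l + real N ^ 2)) \<le> y'"
    by (simp add: divide_le_eq mult.commute)
  with lim(1) show ?thesis unfolding y_def by blast
qed

section \<open>The critical temperature of the Bethe tree\<close>

text \<open>Monotone convergence, in the extended reals so that an infinite mean is included.\<close>

lemma exists_supercritical_truncation: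
  assumes "1 < ennreal c * (\<integral>\<^sup>+k. ennreal (real k) \<partial>measure_pmf K)" "0 \<le> c"
  shows "\<exists>N. 1 < truncated_mean K N * c"
proof -
  have "(\<lambda>k. ennreal (real k)) = (\<lambda>k. SUP N. ennreal (real (min N k)))"
  proof
    fix k :: nat
    show "ennreal (real k) = (SUP N. ennreal (real (min N k)))"
      by (rule antisym, rule SUP_upper2[of k]) (auto intro!: SUP_least ennreal_leI)
  qed
  then have "(\<integral>\<^sup>+k. ennreal (real k) \<partial>measure_pmf K) = (\<integral>\<^sup>+k. (SUP N. ennreal (real (min N k))) \<partial>measure_pmf K)"
    by simp
  also have "\<dots> = (SUP N. \<integral>\<^sup>+k. ennreal (real (min N k)) \<partial>measure_pmf K)"
    by (rule nn_integral_monotone_convergence_SUP) (auto simp: incseq_def le_fun_def intro!: ennreal_leI)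
  also have "\<dots> = (SUP N. ennreal (truncated_mean K N))" by (simp add: truncated_mean_eq)
  finally have "1 < (SUP N. ennreal c * ennreal (truncated_mean K N))"
    using assms(1) by (simp add: SUP_mult_left_ennreal)
  then obtain N where "1 < ennreal c * ennreal (truncated_mean K N)" by (auto simp: less_SUP_iff)
  then have "1 < ennreal (truncated_mean K N * c)"
    using assms(2) by (simp add: ennreal_mult'' mult.commute truncated_mean_def sum_nonneg)
  then show ?thesis by (auto simp: ennreal_less_iff simp flip: ennreal_1)
qed

text \<open>As \<open>a > 1\<close>, the interval from \<open>1 / a\<close> to \<open>1 / sqrt a\<close> is nonempty, and any value in it meets both
requirements; taking the minimum with \<open>\<theta>\<close> keeps the value admissible.\<close>

lemma exists_slightly_supercritical:
  fixes a \<theta> :: real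
  assumes "1 < a * \<theta>" "0 < \<theta>" "\<theta> < 1"
  shows "\<exists>\<theta>'>0. \<theta>' \<le> \<theta> \<and> 1 < a * \<theta>' \<and> a * \<theta>' * \<theta>' < 1"
proof -
  have a: "1 < a"
  proof (rule ccontr)
    assume "\<not> 1 < a"
    then have "a * \<theta> \<le> 1 * \<theta>" using assms(2) by (intro mult_right_mono) auto
    then show False using assms by linarith
  qed
  have sq: "sqrt a * sqrt a = a" "1 < sqrt a" using a by auto
  have "1 / a < 1 / sqrt a"
    using a sq mult_strict_left_mono[of 1 "sqrt a" "sqrt a"] by (simp add: frac_less2)
  then obtain m where m: "1 / a < m" "m < 1 / sqrt a" using dense by blast
  have am: "1 < a * m" using m(1) a by (simp add: field_simps)
  have m0: "0 < m" using m(1) a by (smt (verit) divide_pos_pos)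
  have "sqrt a * m < 1" using m(2) sq by (simp add: field_simps)
  then have "(sqrt a * m) * (sqrt a * m) < 1 * 1" using m0 sq by (intro mult_strict_mono) auto
  then have amm: "a * m * m < 1" using sq(1) by (simp add: mult_ac)
  let ?t = "min \<theta> m"
  have "a * ?t * ?t \<le> a * m * m" using a m0 assms by (intro mult_mono) auto
  then show ?thesis using am amm m0 assms by (intro exI[of _ ?t]) (auto simp: min_def)
qed

text \<open>Truncating offspring numbers and decreasing \<open>\<beta>\<close> lowers all fields, so the truncated bound carries over
to the fields below the root. The root has at least one child, and already the field passed by its first child
keeps the root magnetization away from \<open>0\<close>: the truncated fields are at most \<open>C\<close>, so \<open>tanh\<close> costs at
most the factor \<open>1 + C\<close>.\<close>

lemma bethe_magnetization_bounded_below: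
  assumes D0: "pmf D 0 = 0" and \<beta>: "0 \<le> \<beta>"
    and super: "1 < ennreal (tanh \<beta>) * (\<integral>\<^sup>+k. ennreal (real k) \<partial>measure_pmf K)"
  shows "\<exists>c>0. \<forall>B. 0 < B \<longrightarrow> B \<le> 1 \<longrightarrow> c \<le> bethe_magnetization D K \<beta> B"
proof -
  have "\<beta> \<noteq> 0" using super by auto
  then have \<beta>pos: "0 < \<beta>" using \<beta> by simp
  then have th: "0 < tanh \<beta>" "tanh \<beta> < 1" by (auto simp: tanh_real_lt_1)
  obtain N where N: "1 < truncated_mean K N * tanh \<beta>"
    using exists_supercritical_truncation[OF super] th by auto
  obtain \<theta> where \<theta>: "0 < \<theta>" "\<theta> \<le> tanh \<beta>" "1 < truncated_mean K N * \<theta>" "truncated_mean K N * \<theta> * \<theta> < 1"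
    using exists_slightly_supercritical[OF N th] by blast
  define \<beta>' where "\<beta>' = artanh \<theta>"
  have tb: "tanh \<beta>' = \<theta>" unfolding \<beta>'_def using \<theta> th by (intro tanh_artanh_real) auto
  have b': "0 < \<beta>'" using \<theta>(1) unfolding tb[symmetric] by simp
  have bb: "\<beta>' \<le> \<beta>" using \<theta>(2) unfolding tb[symmetric] by simp
  let ?l = "truncated_mean K N * \<theta>"
  define \<eta> where "\<eta> = (?l - 1) * (1 - ?l * \<theta>) / (?l * (1 + 2 * ?l + real N ^ 2))"
  have l_pos: "0 < ?l" using \<theta>(3) by linarith
  have "0 < 1 + 2 * ?l + real N ^ 2" using l_pos zero_le_power2[of "real N"] by linarith
  then have l0: "0 < ?l * (1 + 2 * ?l + real N ^ 2)" by (rule mult_pos_pos[OF l_pos])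
  have "0 < (?l - 1) * (1 - ?l * \<theta>)" using \<theta>(3,4) by (intro mult_pos_pos) linarith+
  then have \<eta>: "0 < \<eta>" unfolding \<eta>_def using l0 by (rule divide_pos_pos)
  define C where "C = 1 + \<beta>' * real N"
  have C: "0 < C" using b' by (simp add: C_def add_pos_nonneg)
  have "tanh \<beta> / (1 + C) * \<eta> \<le> bethe_magnetization D K \<beta> B" if B: "0 < B" "B \<le> 1" for B
  proof -
    let ?\<mu> = "offspring_law D K"
    interpret prob_space ?\<mu> by (rule prob_space_offspring_law)
    define H where "H = (\<lambda>t X. tree_field \<beta>' B 0 t (\<lambda>v. min N (X v)))"
    from truncated_field_mean_lower[OF b' B(1), of K N, unfolded tb, OF \<theta>(3,4)]
    obtain y where y: "\<eta> \<le> y" "(\<lambda>t. \<integral>X. H t X \<partial>offspring_law K K) \<longlonglongrightarrow> y"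
      unfolding \<eta>_def H_def by blast
    have Hm [measurable]: "H t \<in> borel_measurable offspring_space" for t
      unfolding H_def by measurable
    have H0: "0 \<le> H t X" for t X unfolding H_def using b' B by (intro tree_field_nonneg) auto
    have HC: "H t X \<le> C" for t X
    proof -
      have "H t X \<le> B + \<beta>' * real (min N (X []))" unfolding H_def using b' B by (intro tree_field_le) auto
      also have "\<dots> \<le> C" unfolding C_def using b' B by (intro add_mono mult_left_mono) auto
      finally show ?thesis .
    qed
    have pos: "AE X in ?\<mu>. 0 < X []"
    proof -
      have "AE k in measure_pmf D. 0 < k"
        using D0 by (auto simp: AE_measure_pmf_iff set_pmf_iff intro!: gr0I)
      then have "AE k in distr ?\<mu> (count_space UNIV) (\<lambda>X. X []). 0 < k" unfolding distr_root .
      moreover have "(\<lambda>X. X []) \<in> measurable ?\<mu> (count_space UNIV)" by measurable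
      ultimately show ?thesis by (rule AE_distrD[rotated])
    qed
    have lower: "tanh \<beta> / (1 + C) * (\<integral>X. H t X \<partial>offspring_law K K) \<le> (\<integral>X. tanh (tree_field \<beta> B 0 (Suc t) X) \<partial>?\<mu>)" for t
    proof -
      have [measurable]: "(\<lambda>X. H t (subtree X 0)) \<in> borel_measurable ?\<mu>"
        unfolding measurable_cong_sets[OF sets_offspring_law refl]
        by (rule measurable_compose[OF measurable_subtree Hm])
      have "tanh \<beta> / (1 + C) * (\<integral>X. H t X \<partial>offspring_law K K) = tanh \<beta> / (1 + C) * (\<integral>X. H t (subtree X 0) \<partial>?\<mu>)"
        by (subst distr_subtree[of D K 0, symmetric], subst integral_distr) auto
      also have "\<dots> = (\<integral>X. tanh \<beta> / (1 + C) * H t (subtree X 0) \<partial>?\<mu>)" by simp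
      also have "\<dots> \<le> (\<integral>X. tanh (tree_field \<beta> B 0 (Suc t) X) \<partial>?\<mu>)"
      proof (rule integral_mono_AE)
        show "integrable ?\<mu> (\<lambda>X. tanh \<beta> / (1 + C) * H t (subtree X 0))"
          by (intro integrable_mult_right integrable_const_bound[of _ C]) (auto simp: H0 HC)
        show "integrable ?\<mu> (\<lambda>X. tanh (tree_field \<beta> B 0 (Suc t) X))"
          by (rule integrable_tanh[OF measurable_tree_field])
        have "tanh \<beta> / (1 + C) * H t (subtree X 0) \<le> tanh (tree_field \<beta> B 0 (Suc t) X)" if X: "0 < X []" for X
        proof -
          let ?h = "H t (subtree X 0)" and ?f = "\<lambda>i. tree_field \<beta> B 0 t (subtree X i)"
          have "?h / (1 + C) \<le> ?h / (1 + ?h)" using H0 HC by (intro divide_left_mono mult_pos_pos add_pos_nonneg) (auto simp: C_def b' less_imp_le add_pos_nonneg)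
          also have "\<dots> \<le> tanh ?h" by (rule tanh_ge_rational[OF H0])
          also have "\<dots> \<le> tanh (?f 0)"
            unfolding H_def using b' bb B by (simp only: tanh_real_le_iff, intro tree_field_mono) auto
          finally have "tanh \<beta> * (?h / (1 + C)) \<le> tanh \<beta> * tanh (?f 0)" using th by (intro mult_left_mono) auto
          also have "\<dots> = tanh (passed_field \<beta> (?f 0))" by (simp add: tanh_passed_field)
          also have "passed_field \<beta> (?f 0) \<le> (\<Sum>i<X []. passed_field \<beta> (?f i))"
            using X \<beta> B by (intro member_le_sum passed_field_nonneg tree_field_nonneg) auto
          then have "tanh (passed_field \<beta> (?f 0)) \<le> tanh (tree_field \<beta> B 0 (Suc t) X)" using B by simp
          finally show ?thesis by simp
        qed
        with pos show "AE X in ?\<mu>. tanh \<beta> / (1 + C) * H t (subtree X 0) \<le> tanh (tree_field \<beta> B 0 (Suc t) X)"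
          by auto
      qed
      finally show ?thesis .
    qed
    have "tanh \<beta> / (1 + C) * y \<le> bethe_magnetization D K \<beta> B"
    proof (rule LIMSEQ_le)
      show "(\<lambda>t. tanh \<beta> / (1 + C) * (\<integral>X. H t X \<partial>offspring_law K K)) \<longlonglongrightarrow> tanh \<beta> / (1 + C) * y"
        by (intro tendsto_mult tendsto_const y)
      show "(\<lambda>t. \<integral>X. tanh (tree_field \<beta> B 0 (Suc t) X) \<partial>?\<mu>) \<longlonglongrightarrow> bethe_magnetization D K \<beta> B"
        by (rule LIMSEQ_Suc[OF magnetization_free_tendsto[OF \<beta> B(1)]])
    qed (use lower in blast)
    moreover have "tanh \<beta> / (1 + C) * \<eta> \<le> tanh \<beta> / (1 + C) * y"
      using y(1) th C by (intro mult_left_mono) auto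
    ultimately show ?thesis by linarith
  qed
  moreover have "0 < tanh \<beta> / (1 + C) * \<eta>" using th C \<eta> by simp
  ultimately show ?thesis by blast
qed

lemma Inf_ereal_ray:
  assumes "{b<..} \<subseteq> S" "S \<subseteq> {b..}" shows "Inf (ereal ` S) = ereal b"
proof (rule antisym)
  show "ereal b \<le> Inf (ereal ` S)" using assms(2) by (intro INF_greatest) auto
  show "Inf (ereal ` S) \<le> ereal b"
  proof (rule dense_ge)
    fix x assume "ereal b < x"
    then show "Inf (ereal ` S) \<le> x"
    proof (cases x)
      case (real y)
      then show ?thesis using \<open>ereal b < x\<close> assms(1) by (intro INF_lower2[of y]) auto
    qed auto
  qed
qed

text \<open>Only field strengths \<open>B > 0\<close> enter the critical temperature, so it is the same for all functions that
agree with the magnetization of the Bethe tree there. Below the threshold the limit \<open>B \<rightarrow> 0\<close> is zero by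
the linear bound; above it the limit exists by monotonicity in \<open>B\<close> and inherits the uniform lower bound.\<close>

lemma critical_temperature_eqI:
  assumes D0: "pmf D 0 = 0" and D: "integrable (measure_pmf D) real"
    and nu: "\<nu> = (\<integral>\<^sup>+k. ennreal (real k) \<partial>measure_pmf K)"
    and M: "\<And>\<beta> B. 0 \<le> \<beta> \<Longrightarrow> 0 < B \<Longrightarrow> M \<beta> B = bethe_magnetization D K \<beta> B"
  shows "critical_temperature M = ext_artanh (1 / \<nu>)"
proof -
  have right: "eventually (\<lambda>B. 0 < B \<and> B \<le> 1) (at_right (0::real))"
    using eventually_at_right_less[of 0] eventually_at_right_real[of 0 1]
    by (auto elim!: eventually_elim2)
  have sub: "\<not> 0 < Lim (at_right 0) (M \<beta>)" if \<beta>: "0 \<le> \<beta>" and *: "ennreal (tanh \<beta>) * \<nu> < 1" for \<beta>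
  proof -
    obtain C where C: "\<And>B. 0 < B \<Longrightarrow> bethe_magnetization D K \<beta> B \<le> C * B"
      using bethe_magnetization_le_linear[OF \<beta> _ D] * nu by auto
    have "(M \<beta> \<longlongrightarrow> 0) (at_right 0)"
    proof (rule tendsto_sandwich[of "\<lambda>_. 0"])
      show "\<forall>\<^sub>F B in at_right 0. 0 \<le> M \<beta> B"
        using right by eventually_elim (simp add: M \<beta> bethe_magnetization_nonneg)
      show "\<forall>\<^sub>F B in at_right 0. M \<beta> B \<le> C * B"
        using right by eventually_elim (simp add: M \<beta> C)
      show "((\<lambda>B. C * B) \<longlongrightarrow> 0) (at_right 0)"
        by (rule tendsto_eq_intros | simp)+
    qed auto
    then have "Lim (at_right 0) (M \<beta>) = 0" by (intro tendsto_Lim) auto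
    then show ?thesis by simp
  qed
  have super: "0 < Lim (at_right 0) (M \<beta>)" if \<beta>: "0 \<le> \<beta>" and *: "1 < ennreal (tanh \<beta>) * \<nu>" for \<beta>
  proof -
    obtain c where c: "0 < c" "\<And>B. 0 < B \<Longrightarrow> B \<le> 1 \<Longrightarrow> c \<le> bethe_magnetization D K \<beta> B"
      using bethe_magnetization_bounded_below[OF D0 \<beta>] * nu by auto
    have "(M \<beta> \<longlongrightarrow> Inf (M \<beta> ` ({0<..} \<inter> UNIV))) (at 0 within ({0<..} \<inter> UNIV))"
      by (rule Lim_right_bound[where K = 0])
         (auto simp: M \<beta> bethe_magnetization_nonneg bethe_magnetization_mono)
    then obtain L where L: "(M \<beta> \<longlongrightarrow> L) (at_right 0)" by auto
    have "c \<le> L"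
    proof (rule tendsto_lowerbound[OF L])
      show "\<forall>\<^sub>F B in at_right 0. c \<le> M \<beta> B" using right by eventually_elim (simp add: M \<beta> c)
    qed simp
    moreover have "Lim (at_right 0) (M \<beta>) = L" using L by (intro tendsto_Lim) auto
    ultimately show ?thesis using c by simp
  qed
  let ?S = "{\<beta>. \<beta> \<ge> 0 \<and> Lim (at_right 0) (\<lambda>B. M \<beta> B) > 0}"
  show ?thesis
  proof (cases "1 / \<nu> < 1")
    case False
    have "\<nu> \<le> 1"
    proof (rule ccontr)
      assume "\<not> \<nu> \<le> 1"
      then have "1 / \<nu> < 1" by (cases \<nu>) (auto simp: divide_ennreal ennreal_less_iff simp flip: ennreal_1)
      with False show False by simp
    qed
    have "ennreal (tanh \<beta>) * \<nu> < 1" if "0 \<le> \<beta>" for \<beta>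
    proof -
      have "ennreal (tanh \<beta>) * \<nu> \<le> ennreal (tanh \<beta>) * 1" by (intro mult_left_mono \<open>\<nu> \<le> 1\<close>) auto
      also have "\<dots> < 1" using that tanh_real_lt_1[of \<beta>] by (simp add: ennreal_less_one_iff)
      finally show ?thesis .
    qed
    then have S: "?S = {}" using sub by blast
    show ?thesis unfolding critical_temperature_def S ext_artanh_def using False by (simp add: top_ereal_def)
  next
    case True
    define r where "r = enn2real (1 / \<nu>)"
    have "1 / \<nu> < top" using True by (rule order.strict_trans) simp
    then have r: "ennreal r = 1 / \<nu>" "0 \<le> r" unfolding r_def by (simp_all only: ennreal_enn2real enn2real_nonneg)
    have r1: "r < 1" using True unfolding r(1)[symmetric] using r(2) by (simp add: ennreal_less_one_iff)
    have tr: "tanh (artanh r) = r" using r r1 by (intro tanh_artanh_real) auto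
    have "0 \<le> tanh (artanh r)" unfolding tr by (rule r(2))
    then have ar0: "0 \<le> artanh r" by simp
    \<comment> \<open>Not an equivalence: for \<open>\<nu> = \<infinity>\<close> and \<open>x = 0\<close> the product is \<open>0\<close> although \<open>r = 0\<close>.\<close>
    have less: "x < r \<Longrightarrow> ennreal x * \<nu> < 1" "r < x \<Longrightarrow> 1 < ennreal x * \<nu>" if x: "0 \<le> x" for x
    proof -
      have "(x < r \<longrightarrow> ennreal x * \<nu> < 1) \<and> (r < x \<longrightarrow> 1 < ennreal x * \<nu>)"
      proof (cases \<nu>)
        case (real v)
        have v: "0 < v"
        proof (rule ccontr)
          assume "\<not> 0 < v"
          then have "\<nu> = 0" using real by (simp add: ennreal_neg)
          then show False using True by simp
        qed
        then have "ennreal r = ennreal (1 / v)"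
          using r(1) real by (simp add: divide_ennreal flip: ennreal_1)
        then have rv: "r = 1 / v" using r(2) v by (simp add: ennreal_inj)
        have "ennreal x * \<nu> = ennreal (x * v)" using real x v by (simp add: ennreal_mult)
        then show ?thesis unfolding rv using x v
          by (auto simp: ennreal_less_iff field_simps simp flip: ennreal_1)
      next
        case top
        then have "r = 0" using r by simp
        then show ?thesis using x top by (auto simp: ennreal_mult_top)
      qed
      then show "x < r \<Longrightarrow> ennreal x * \<nu> < 1" "r < x \<Longrightarrow> 1 < ennreal x * \<nu>" by auto
    qed
    have "Inf (ereal ` ?S) = ereal (artanh r)"
    proof (rule Inf_ereal_ray)
      show "{artanh r<..} \<subseteq> ?S"
      proof
        fix \<beta> assume "\<beta> \<in> {artanh r<..}"
        then have b: "artanh r < \<beta>" by simp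
        then have "r < tanh \<beta>" by (metis tanh_real_less_iff tr)
        moreover have "0 \<le> \<beta>" using b ar0 by linarith
        ultimately show "\<beta> \<in> ?S" using super[of \<beta>] less(2)[of "tanh \<beta>"] by simp
      qed
      show "?S \<subseteq> {artanh r..}"
      proof
        fix \<beta> assume S: "\<beta> \<in> ?S"
        show "\<beta> \<in> {artanh r..}"
        proof (rule ccontr)
          assume "\<beta> \<notin> {artanh r..}"
          then have "tanh \<beta> < r" by (metis atLeast_iff not_le tanh_real_less_iff tr)
          then show False using S sub[of \<beta>] less(1)[of "tanh \<beta>"] by simp
        qed
      qed
    qed
    then show ?thesis using True by (simp add: critical_temperature_def ext_artanh_def r_def)
  qed
qed

section \<open>Isomorphic balls and the local sandwich\<close>

lemma rooted_iso_refl: "rooted_iso G r G r"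
  by (cases G) (auto simp: rooted_iso_def intro!: exI[of _ "\<lambda>x. x"] bij_betw_id[unfolded id_def])

lemma rooted_iso_sym:
  assumes "rooted_iso G r H s" "r \<in> fst G" shows "rooted_iso H s G r"
proof -
  obtain V E V' E' where [simp]: "G = (V, E)" "H = (V', E')" by (cases G, cases H)
  obtain f where f: "bij_betw f V V'" "f r = s" "\<And>u v. u \<in> V \<Longrightarrow> v \<in> V \<Longrightarrow> {u, v} \<in> E \<longleftrightarrow> {f u, f v} \<in> E'"
    using assms(1) by (auto simp: rooted_iso_def)
  let ?g = "inv_into V f"
  have g: "bij_betw ?g V' V" "?g s = r"
    using bij_betw_inv_into[OF f(1)] bij_betw_inv_into_left[OF f(1), of r] f(2) assms(2) by auto
  have "{u, v} \<in> E' \<longleftrightarrow> {?g u, ?g v} \<in> E" if "u \<in> V'" "v \<in> V'" for u v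
    using f(3)[of "?g u" "?g v"] that g(1) bij_betw_inv_into_right[OF f(1)] bij_betwE by fastforce
  with g show ?thesis by (auto simp: rooted_iso_def)
qed

lemma rooted_iso_trans:
  assumes "rooted_iso G r H s" "rooted_iso H s I q" shows "rooted_iso G r I q"
proof -
  obtain V E V' E' V'' E'' where [simp]: "G = (V, E)" "H = (V', E')" "I = (V'', E'')" by (cases G, cases H, cases I)
  obtain f where f: "bij_betw f V V'" "f r = s" "\<And>u v. u \<in> V \<Longrightarrow> v \<in> V \<Longrightarrow> {u, v} \<in> E \<longleftrightarrow> {f u, f v} \<in> E'"
    using assms(1) by (auto simp: rooted_iso_def)
  obtain g where g: "bij_betw g V' V''" "g s = q" "\<And>u v. u \<in> V' \<Longrightarrow> v \<in> V' \<Longrightarrow> {u, v} \<in> E' \<longleftrightarrow> {g u, g v} \<in> E''"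
    using assms(2) by (auto simp: rooted_iso_def)
  have "bij_betw (g \<circ> f) V V''" using f(1) g(1) by (rule bij_betw_trans)
  moreover have "{u, v} \<in> E \<longleftrightarrow> {(g \<circ> f) u, (g \<circ> f) v} \<in> E''" if "u \<in> V" "v \<in> V" for u v
    using that f(1,3) g(3) bij_betwE by fastforce
  ultimately show ?thesis using f(2) g(2) by (auto simp: rooted_iso_def intro!: exI[of _ "g \<circ> f"])
qed

lemma gibbs_mean_relabel:
  assumes f: "bij_betw f V V'" and A: "A \<subseteq> V" and i: "i \<in> V"
    and H: "\<And>\<sigma>. \<sigma> \<in> spin_configs V' (f ` A) \<Longrightarrow> H' \<sigma> = H (restrict (\<sigma> \<circ> f) V)"
  shows "gibbs_mean V' (f ` A) H' (\<lambda>\<sigma>. \<sigma> (f i)) = gibbs_mean V A H (\<lambda>\<sigma>. \<sigma> i)"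
proof -
  let ?g = "inv_into V f"
  have fV: "f v \<in> V'" if "v \<in> V" for v using f that bij_betwE by blast
  have gV: "?g v \<in> V" if "v \<in> V'" for v using f that by (simp add: bij_betw_def inv_into_into)
  have gf: "?g (f v) = v" if "v \<in> V" for v using f that by (simp add: bij_betw_inv_into_left)
  have fg: "f (?g v) = v" if "v \<in> V'" for v using f that by (simp add: bij_betw_inv_into_right)
  have reindex: "(\<Sum>\<sigma>\<in>spin_configs V' (f ` A). F (restrict (\<sigma> \<circ> f) V)) = (\<Sum>\<sigma>\<in>spin_configs V A. F \<sigma>)"
    for F :: "_ \<Rightarrow> real"
  proof (rule sum.reindex_bij_witness[of _ "\<lambda>\<sigma>. restrict (\<sigma> \<circ> ?g) V'" "\<lambda>\<sigma>. restrict (\<sigma> \<circ> f) V"])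
    fix \<sigma> assume \<sigma>: "\<sigma> \<in> spin_configs V' (f ` A)"
    show "restrict (restrict (\<sigma> \<circ> f) V \<circ> ?g) V' = \<sigma>"
      using \<sigma> gV fg by (auto simp: spin_configs_def PiE_iff extensional_def fun_eq_iff)
    show "restrict (\<sigma> \<circ> f) V \<in> spin_configs V A"
      using \<sigma> fV A by (auto simp: spin_configs_def PiE_iff)
  next
    fix \<sigma> assume \<sigma>: "\<sigma> \<in> spin_configs V A"
    show "restrict (restrict (\<sigma> \<circ> ?g) V' \<circ> f) V = \<sigma>"
      using \<sigma> fV gf by (auto simp: spin_configs_def PiE_iff extensional_def fun_eq_iff)
    show "restrict (\<sigma> \<circ> ?g) V' \<in> spin_configs V' (f ` A)"
      using \<sigma> gV fV gf A by (auto simp: spin_configs_def PiE_iff subset_iff)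
  qed simp
  have "(\<Sum>\<sigma>\<in>spin_configs V' (f ` A). \<sigma> (f i) * exp (H' \<sigma>)) = (\<Sum>\<sigma>\<in>spin_configs V A. \<sigma> i * exp (H \<sigma>))"
    by (subst reindex[symmetric]) (use i H in \<open>auto intro!: sum.cong\<close>)
  moreover have "(\<Sum>\<sigma>\<in>spin_configs V' (f ` A). exp (H' \<sigma>)) = (\<Sum>\<sigma>\<in>spin_configs V A. exp (H \<sigma>))"
    by (subst reindex[symmetric]) (use H in \<open>auto intro!: sum.cong\<close>)
  ultimately show ?thesis by (simp add: gibbs_mean_def)
qed

lemma ising_expectation_iso:
  assumes f: "bij_betw f V V'" and E: "E \<in> edge_sets V" "E' \<in> edge_sets V'"
    and edges: "\<And>u v. u \<in> V \<Longrightarrow> v \<in> V \<Longrightarrow> {u, v} \<in> E \<longleftrightarrow> {f u, f v} \<in> E'"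
    and A: "A \<subseteq> V" and i: "i \<in> V"
  shows "ising_expectation \<beta> B (V', E') (f ` A) (\<lambda>\<sigma>. \<sigma> (f i)) = ising_expectation \<beta> B (V, E) A (\<lambda>\<sigma>. \<sigma> i)"
  unfolding ising_expectation_eq_gibbs_mean
proof (rule gibbs_mean_relabel[OF f A i])
  fix \<sigma> :: "'b \<Rightarrow> real"
  have inj: "inj_on f V" and im: "f ` V = V'" using f by (auto simp: bij_betw_def)
  have sub: "e \<subseteq> V" "card e = 2" if "e \<in> E" for e using E(1) that by (auto simp: edge_sets_def)
  have sub': "e \<subseteq> V'" "card e = 2" if "e \<in> E'" for e using E(2) that by (auto simp: edge_sets_def)
  have E': "E' = (\<lambda>e. f ` e) ` E"
  proof (intro set_eqI iffI)
    fix e assume e: "e \<in> E'"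
    obtain x y where xy: "e = {x, y}" using sub'[OF e] by (auto simp: card_2_iff)
    then obtain u v where uv: "u \<in> V" "v \<in> V" "x = f u" "y = f v" using sub'[OF e] im by auto
    then have "{u, v} \<in> E" using edges e xy by auto
    then show "e \<in> (\<lambda>e. f ` e) ` E" using xy uv by (intro image_eqI[of _ _ "{u, v}"]) auto
  next
    fix e assume "e \<in> (\<lambda>e. f ` e) ` E"
    then obtain d where d: "d \<in> E" "e = f ` d" by auto
    obtain u v where uv: "d = {u, v}" using sub[OF d(1)] by (auto simp: card_2_iff)
    then show "e \<in> E'" using edges[of u v] sub[OF d(1)] d by auto
  qed
  have inj2: "inj_on (\<lambda>e. f ` e) E"
    by (rule inj_on_subset[OF inj_on_image_Pow[OF inj]]) (use sub in auto)
  have "(\<Sum>e\<in>E'. \<Prod>v\<in>e. \<sigma> v) = (\<Sum>e\<in>E. \<Prod>v\<in>e. restrict (\<sigma> \<circ> f) V v)"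
    unfolding E' sum.reindex[OF inj2]
  proof (rule sum.cong[OF refl])
    fix e assume e: "e \<in> E"
    have "inj_on f e" using inj sub(1)[OF e] by (rule inj_on_subset)
    then have "(\<Prod>v\<in>f ` e. \<sigma> v) = (\<Prod>v\<in>e. \<sigma> (f v))" by (simp add: prod.reindex)
    also have "\<dots> = (\<Prod>v\<in>e. restrict (\<sigma> \<circ> f) V v)" using sub(1)[OF e] by (intro prod.cong) auto
    finally show "((\<lambda>e. \<Prod>v\<in>e. \<sigma> v) \<circ> (`) f) e = (\<Prod>v\<in>e. restrict (\<sigma> \<circ> f) V v)" by simp
  qed
  moreover have "(\<Sum>v\<in>V'. \<sigma> v) = (\<Sum>v\<in>V. restrict (\<sigma> \<circ> f) V v)"
    unfolding im[symmetric] sum.reindex[OF inj] by simp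
  ultimately show "\<beta> * (\<Sum>e\<in>E'. \<Prod>v\<in>e. \<sigma> v) + B * (\<Sum>v\<in>V'. \<sigma> v) =
      \<beta> * (\<Sum>e\<in>E. \<Prod>v\<in>e. restrict (\<sigma> \<circ> f) V v) + B * (\<Sum>v\<in>V. restrict (\<sigma> \<circ> f) V v)" by simp
qed

lemma abs_ising_magnetization_le:
  assumes "finite V" "i \<in> V" shows "\<bar>ising_expectation \<beta> B (V, E) {} (\<lambda>\<sigma>. \<sigma> i)\<bar> \<le> 1"
proof -
  let ?H = "\<lambda>\<sigma>. \<beta> * (\<Sum>e\<in>E. \<Prod>v\<in>e. \<sigma> v) + B * (\<Sum>v\<in>V. \<sigma> v)"
  have "\<bar>\<Sum>\<sigma>\<in>spin_configs V {}. \<sigma> i * exp (?H \<sigma>)\<bar> \<le> (\<Sum>\<sigma>\<in>spin_configs V {}. \<bar>\<sigma> i * exp (?H \<sigma>)\<bar>)"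
    by (rule sum_abs)
  also have "\<dots> = (\<Sum>\<sigma>\<in>spin_configs V {}. exp (?H \<sigma>))"
    using spin_value[OF _ assms(2)] by (intro sum.cong refl) (force simp: abs_mult)
  finally show ?thesis
    using gibbs_normalizer_pos[OF assms(1) empty_subsetI, of ?H]
    by (simp add: ising_expectation_eq_gibbs_mean gibbs_mean_def)
qed

text \<open>The infimum of a nonempty set of extended naturals is attained.\<close>

lemma graph_dist_le_iff:
  "graph_dist E u v \<le> enat m \<longleftrightarrow> (\<exists>xs. walk E u xs v \<and> length xs - 1 \<le> m)"
proof
  assume *: "graph_dist E u v \<le> enat m"
  have "(\<lambda>xs. enat (length xs - 1)) ` {xs. walk E u xs v} \<noteq> {}"
    using * by (auto simp: graph_dist_def Inf_enat_def split: if_splits)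
  then have "graph_dist E u v \<in> (\<lambda>xs. enat (length xs - 1)) ` {xs. walk E u xs v}"
    unfolding graph_dist_def by (metis (mono_tags, lifting) Inf_enat_def LeastI_ex ex_in_conv)
  then show "\<exists>xs. walk E u xs v \<and> length xs - 1 \<le> m" using * by auto
next
  assume "\<exists>xs. walk E u xs v \<and> length xs - 1 \<le> m"
  then show "graph_dist E u v \<le> enat m"
    unfolding graph_dist_def by (auto intro!: INF_lower2)
qed

lemma graph_dist_self: "graph_dist E u u \<le> enat m"
  unfolding graph_dist_le_iff by (intro exI[of _ "[u]"]) (auto simp: walk_def)

lemma walk_snoc:
  assumes "walk E u xs v" "{v, w} \<in> E" shows "walk E u (xs @ [w]) w"
  using assms by (auto simp: walk_def successively_append_iff)

lemma walk_length_pos: "walk E u xs v \<Longrightarrow> 0 < length xs" by (auto simp: walk_def)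

lemma graph_dist_step:
  assumes "graph_dist E u v \<le> enat m" "{v, w} \<in> E" shows "graph_dist E u w \<le> enat (Suc m)"
proof -
  obtain xs where "walk E u xs v" "length xs - 1 \<le> m" using assms(1) by (auto simp: graph_dist_le_iff)
  then show ?thesis unfolding graph_dist_le_iff using walk_snoc[OF _ assms(2)] walk_length_pos
    by (intro exI[of _ "xs @ [w]"]) fastforce
qed

lemma walk_rev:
  assumes "walk E u xs v" shows "walk E v (rev xs) u"
  using assms by (auto simp: walk_def hd_rev last_rev insert_commute)

lemma walk_append:
  assumes "walk E u xs v" "walk E v ys w" shows "walk E u (xs @ tl ys) w"
  using assms by (cases ys) (auto simp: walk_def successively_append_iff successively_Cons)

lemma successively_edge_nth:
  assumes "successively P xs" "Suc i < length xs" shows "P (xs ! i) (xs ! Suc i)"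
  using assms by (simp add: successively_conv_nth)

text \<open>A parent function that lowers a level by one describes a tree. In a cycle, a vertex of maximal level
would have its parent as both neighbours, which are distinct because the cycle has at least three
vertices.\<close>

lemma parent_structure_rooted_tree:
  assumes r: "r \<in> V" and E: "E = (\<lambda>v. {par v, v}) ` (V - {r})"
    and par: "\<And>v. v \<in> V \<Longrightarrow> v \<noteq> r \<Longrightarrow> par v \<in> V" "\<And>v. v \<in> V \<Longrightarrow> v \<noteq> r \<Longrightarrow> lev v = Suc (lev (par v))"
    and lev: "\<And>v. v \<in> V \<Longrightarrow> lev v \<le> t"
  shows "rooted_tree_gen t (V, E) r"
proof -
  have edge: "(x = par y \<and> lev y = Suc (lev x)) \<or> (y = par x \<and> lev x = Suc (lev y))" if "{x, y} \<in> E" for x y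
    using that par(2) unfolding E by (auto simp: doubleton_eq_iff)
  have "E \<in> edge_sets V"
  proof -
    have "par v \<noteq> v" if "v \<in> V" "v \<noteq> r" for v using par(2)[OF that] by auto
    then show ?thesis using par(1) unfolding E edge_sets_def by auto
  qed
  have dist: "graph_dist E r v \<le> enat (lev v)" if "v \<in> V" for v
    using that
  proof (induction "lev v" arbitrary: v)
    case 0
    then have "v = r" using par(2)[of v] by auto
    then show ?case by (simp add: graph_dist_self)
  next
    case (Suc n)
    show ?case
    proof (cases "v = r")
      case True
      then show ?thesis by (simp add: graph_dist_self)
    next
      case False
      then have "graph_dist E r (par v) \<le> enat (lev (par v))" using Suc par by auto
      moreover have "{par v, v} \<in> E" using False Suc.prems unfolding E by auto
      ultimately show ?thesis using par(2)[OF Suc.prems False] graph_dist_step by fastforce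
    qed
  qed
  have "graph_dist E u v < \<infinity>" if uv: "u \<in> V" "v \<in> V" for u v
  proof -
    obtain xs ys where "walk E r xs u" "walk E r ys v"
      using dist[OF uv(1)] dist[OF uv(2)] by (auto simp: graph_dist_le_iff)
    then have "walk E u (rev xs @ tl ys) v" using walk_rev walk_append by fast
    then have "graph_dist E u v \<le> enat (length (rev xs @ tl ys) - 1)" unfolding graph_dist_le_iff by blast
    then show ?thesis using order.strict_trans1 by fastforce
  qed
  moreover have "acyclic_graph E"
    unfolding acyclic_graph_def
  proof
    assume "\<exists>xs. 3 \<le> length xs \<and> distinct xs \<and> successively (\<lambda>x y. {x, y} \<in> E) xs \<and> {last xs, hd xs} \<in> E"
    then obtain xs where xs: "3 \<le> length xs" "distinct xs" "successively (\<lambda>x y. {x, y} \<in> E) xs" "{last xs, hd xs} \<in> E"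
      by blast
    let ?n = "length xs"
    have ne: "xs \<noteq> []" using xs(1) by auto
    obtain k where k: "k < ?n" "\<And>j. j < ?n \<Longrightarrow> lev (xs ! j) \<le> lev (xs ! k)"
    proof -
      have "Max ((\<lambda>j. lev (xs ! j)) ` {..<?n}) \<in> (\<lambda>j. lev (xs ! j)) ` {..<?n}"
        using ne by (intro Max_in) auto
      then obtain k where k: "k < ?n" "Max ((\<lambda>j. lev (xs ! j)) ` {..<?n}) = lev (xs ! k)" by auto
      have "lev (xs ! j) \<le> lev (xs ! k)" if "j < ?n" for j
        unfolding k(2)[symmetric] using that by (intro Max_ge) auto
      with k(1) show thesis by (rule that)
    qed
    have cyc: "{xs ! j, xs ! (if Suc j < ?n then Suc j else 0)} \<in> E" if "j < ?n" for j
    proof (cases "Suc j < ?n")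
      case True
      then show ?thesis using successively_edge_nth[OF xs(3)] by simp
    next
      case False
      then have "j = ?n - 1" using that by simp
      then show ?thesis using xs(4) ne False by (simp add: last_conv_nth hd_conv_nth)
    qed
    \<comment> \<open>Successor and predecessor of the position \<open>k\<close> along the cycle.\<close>
    define s where "s = (if Suc k < ?n then Suc k else 0)"
    define p where "p = (if k = 0 then ?n - 1 else k - 1)"
    have sp: "s < ?n" "p < ?n" "s \<noteq> p" using k(1) xs(1) by (auto simp: s_def p_def)
    have "{xs ! k, xs ! s} \<in> E" using cyc[OF k(1)] by (simp add: s_def)
    then have "xs ! s = par (xs ! k)" using edge[of "xs ! k" "xs ! s"] k(2)[OF sp(1)] by auto
    moreover have "{xs ! p, xs ! k} \<in> E" using cyc[OF sp(2)] k(1) by (auto simp: p_def split: if_splits)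
    then have "xs ! p = par (xs ! k)" using edge[of "xs ! p" "xs ! k"] k(2)[OF sp(2)] by auto
    ultimately show False using nth_eq_iff_index_eq[OF xs(2) sp(1,2)] sp(3) by simp
  qed
  moreover have "graph_dist E r v \<le> enat t" if "v \<in> V" for v
    using dist[OF that] lev[OF that] order.trans enat_ord_simps(1) by metis
  ultimately show ?thesis
    using r \<open>E \<in> edge_sets V\<close> by (auto simp: rooted_tree_gen_def tree_graph_def)
qed

lemma butlast_in_gw_verts: "v \<in> gw_verts X t \<Longrightarrow> butlast v \<in> gw_verts X t"
  unfolding gw_verts_def gw_vertices_def by (auto simp: nth_butlast butlast_conv_take min_def)

text \<open>Local convergence is stated for trees with natural numbers as vertices; the encoding of lists as naturals
moves the Ulam--Harris trees there.\<close>

lemma gw_tree_relabel: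
  "\<exists>(T :: nat graph) r. rooted_tree_gen t T r \<and> rooted_iso (tree_on (gw_verts X t)) [] T r \<and>
      rooted_iso T r (tree_on (gw_verts X t)) []"
proof -
  let ?F = "gw_verts X t" and ?c = "to_nat :: nat list \<Rightarrow> nat"
  let ?d = "from_nat :: nat \<Rightarrow> nat list"
  let ?T = "(?c ` ?F, (\<lambda>v. {?c (butlast (?d v)), v}) ` (?c ` ?F - {?c []}))"
  have "rooted_tree_gen t ?T (?c [])"
  proof (rule parent_structure_rooted_tree[where lev = "\<lambda>v. length (?d v)" and par = "\<lambda>v. ?c (butlast (?d v))"])
    fix v assume "v \<in> ?c ` ?F" "v \<noteq> ?c []"
    then obtain w where w: "v = ?c w" "w \<in> ?F" "w \<noteq> []" by auto
    then show "?c (butlast (?d v)) \<in> ?c ` ?F" by (simp add: butlast_in_gw_verts)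
    show "length (?d v) = Suc (length (?d (?c (butlast (?d v)))))" using w by simp
  qed (auto simp: Nil_in_gw_verts, simp add: gw_verts_def)
  moreover have iso: "rooted_iso (tree_on ?F) [] ?T (?c [])"
    unfolding rooted_iso_def tree_on_def
  proof (simp, intro exI[of _ ?c] conjI ballI)
    show "bij_betw ?c ?F (?c ` ?F)" by (simp add: bij_betw_def inj_on_def)
    fix u v assume uv: "u \<in> ?F" "v \<in> ?F"
    have "?c ` ?F - {?c []} = ?c ` (?F - {[]})" by auto
    then have "(\<lambda>v. {?c (butlast (?d v)), v}) ` (?c ` ?F - {?c []}) = (\<lambda>w. {?c (butlast w), ?c w}) ` (?F - {[]})"
      by (simp add: image_image)
    then show "({u, v} \<in> (\<lambda>v. {butlast v, v}) ` (?F - {[]})) =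
       ({?c u, ?c v} \<in> (\<lambda>v. {?c (butlast (?d v)), v}) ` (?c ` ?F - {?c []}))"
      by (auto simp: image_iff doubleton_eq_iff)
  qed simp
  moreover have "rooted_iso ?T (?c []) (tree_on ?F) []"
    by (rule rooted_iso_sym[OF iso]) (simp add: tree_on_def Nil_in_gw_verts)
  ultimately show ?thesis by blast
qed

lemma tree_on_edge_sets:
  "snd (tree_on (gw_verts X t)) \<in> edge_sets (gw_verts X t)"
proof -
  have "butlast v \<noteq> v" if "v \<noteq> []" for v :: "nat list"
    using that by (metis append_butlast_last_id append_self_conv not_Cons_self2)
  then show ?thesis using butlast_in_gw_verts by (auto simp: tree_on_def edge_sets_def)
qed

text \<open>The path from a tree vertex to the root, followed through prefixes, pulls back along the isomorphism.\<close>

lemma graph_dist_le_tree_length: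
  assumes f: "bij_betw f W (gw_verts X t)" "f i = []" "i \<in> W"
    and edges: "\<And>u v. u \<in> W \<Longrightarrow> v \<in> W \<Longrightarrow> {u, v} \<in> EW \<longleftrightarrow> {f u, f v} \<in> snd (tree_on (gw_verts X t))"
    and u: "u \<in> W"
  shows "graph_dist EW i u \<le> enat (length (f u))"
  using u
proof (induction "length (f u)" arbitrary: u)
  case 0
  then have "u = i" using f by (auto simp: bij_betw_def inj_on_def)
  then show ?case by (simp add: graph_dist_self)
next
  case (Suc n)
  have fu: "f u \<in> gw_verts X t" "f u \<noteq> []" using Suc bij_betwE[OF f(1)] by auto
  then obtain w where w: "w \<in> W" "f w = butlast (f u)"
    using butlast_in_gw_verts f(1) by (metis bij_betw_imp_surj_on image_iff)
  have n: "n = length (f w)" using Suc.hyps(2) w by simp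
  have "graph_dist EW i w \<le> enat (length (f w))" by (rule Suc.hyps(1)[OF n w(1)])
  moreover have "{w, u} \<in> EW" using edges[OF w(1) Suc.prems] w(2) fu by (auto simp: tree_on_def)
  ultimately show ?case using graph_dist_step n Suc.hyps(2) by metis
qed

lemma tree_length_le_walk:
  assumes "walk (snd (tree_on V)) u xs v" shows "length v \<le> length u + (length xs - 1)"
  using assms
proof (induction xs arbitrary: u)
  case Nil
  then show ?case by (simp add: walk_def)
next
  case (Cons x xs)
  show ?case
  proof (cases xs)
    case Nil
    then show ?thesis using Cons.prems by (auto simp: walk_def)
  next
    case (Cons y ys)
    then have "walk (snd (tree_on V)) y xs v" "x = u" "{u, y} \<in> snd (tree_on V)"
      using Cons.prems by (auto simp: walk_def)
    moreover have "length y \<le> Suc (length u)"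
      using \<open>{u, y} \<in> snd (tree_on V)\<close> by (auto simp: tree_on_def doubleton_eq_iff)
    ultimately show ?thesis using Cons.IH[of y] Cons by simp
  qed
qed

lemma tree_iso_length_le:
  assumes f: "bij_betw f (gw_verts Y t) (gw_verts X t)" "f [] = []"
    and edges: "\<And>u v. u \<in> gw_verts Y t \<Longrightarrow> v \<in> gw_verts Y t \<Longrightarrow>
      {u, v} \<in> snd (tree_on (gw_verts Y t)) \<longleftrightarrow> {f u, f v} \<in> snd (tree_on (gw_verts X t))"
    and u: "u \<in> gw_verts Y t"
  shows "length u \<le> length (f u)"
proof -
  have "graph_dist (snd (tree_on (gw_verts Y t))) [] u \<le> enat (length (f u))"
    by (rule graph_dist_le_tree_length[OF f Nil_in_gw_verts edges u])
  then obtain xs where "walk (snd (tree_on (gw_verts Y t))) [] xs u" "length xs - 1 \<le> length (f u)"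
    by (auto simp: graph_dist_le_iff)
  then show ?thesis using tree_length_le_walk by fastforce
qed

text \<open>Lengths of vertices are distances from the root, which both an isomorphism and its inverse preserve.
Consequently isomorphisms respect plus boundary conditions.\<close>

lemma tree_iso_length:
  assumes f: "bij_betw f (gw_verts Y t) (gw_verts X t)" "f [] = []"
    and edges: "\<And>u v. u \<in> gw_verts Y t \<Longrightarrow> v \<in> gw_verts Y t \<Longrightarrow>
      {u, v} \<in> snd (tree_on (gw_verts Y t)) \<longleftrightarrow> {f u, f v} \<in> snd (tree_on (gw_verts X t))"
    and u: "u \<in> gw_verts Y t"
  shows "length (f u) = length u"
proof (rule antisym)
  show "length u \<le> length (f u)" by (rule tree_iso_length_le[OF f edges u])
  let ?g = "inv_into (gw_verts Y t) f"
  have gf: "?g (f v) = v" if "v \<in> gw_verts Y t" for v using f that by (simp add: bij_betw_inv_into_left)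
  have fg: "f (?g v) = v" if "v \<in> gw_verts X t" for v using f that by (simp add: bij_betw_inv_into_right)
  have g: "bij_betw ?g (gw_verts X t) (gw_verts Y t)" by (rule bij_betw_inv_into[OF f(1)])
  have gin: "?g v \<in> gw_verts Y t" if "v \<in> gw_verts X t" for v using g that bij_betwE by blast
  have fu: "f u \<in> gw_verts X t" using f(1) u bij_betwE by blast
  have "length (f u) \<le> length (?g (f u))"
  proof (rule tree_iso_length_le[OF g])
    show "?g [] = []" using gf[OF Nil_in_gw_verts] f(2) by simp
    show "{v, w} \<in> snd (tree_on (gw_verts X t)) \<longleftrightarrow> {?g v, ?g w} \<in> snd (tree_on (gw_verts Y t))"
      if "v \<in> gw_verts X t" "w \<in> gw_verts X t" for v w
      using edges[OF gin[OF that(1)] gin[OF that(2)]] fg that by simp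
  qed (rule fu)
  then show "length (f u) \<le> length u" using gf[OF u] by simp
qed

lemma rooted_iso_tree_on:
  assumes "rooted_iso (W, EW) i (tree_on (gw_verts X t)) []"
  obtains f where "bij_betw f W (gw_verts X t)" "f i = []"
    "\<And>u v. u \<in> W \<Longrightarrow> v \<in> W \<Longrightarrow> {u, v} \<in> EW \<longleftrightarrow> {f u, f v} \<in> snd (tree_on (gw_verts X t))"
  using assms by (auto simp: rooted_iso_def tree_on_def)

lemma root_magnetization_free:
  "ising_expectation \<beta> B (tree_on (gw_verts X t)) {} (\<lambda>\<sigma>. \<sigma> []) = tanh (tree_field \<beta> B 0 t X)"
  using tree_expectation_free_eq[of \<beta> B X t] by (simp add: tree_expectation_free_def gw_tree_eq)

lemma root_magnetization_plus:
  "ising_expectation \<beta> B (tree_on (gw_verts X (Suc t))) (tree_boundary True X (Suc t)) (\<lambda>\<sigma>. \<sigma> []) = tanh (tree_field \<beta> B \<beta> t X)"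
  using root_magnetization_eq_tanh[OF rooted_partition_plus, of \<beta> B X t] .

lemma ising_expectation_tree_iso:
  assumes f: "bij_betw f W (gw_verts X t)" "f i = []" "i \<in> W" and EW: "EW \<in> edge_sets W"
    and edges: "\<And>u v. u \<in> W \<Longrightarrow> v \<in> W \<Longrightarrow> {u, v} \<in> EW \<longleftrightarrow> {f u, f v} \<in> snd (tree_on (gw_verts X t))"
    and A: "A \<subseteq> W"
  shows "ising_expectation \<beta> B (W, EW) A (\<lambda>\<sigma>. \<sigma> i) = ising_expectation \<beta> B (tree_on (gw_verts X t)) (f ` A) (\<lambda>\<sigma>. \<sigma> [])"
  using ising_expectation_iso[OF f(1) EW tree_on_edge_sets edges A f(3), of \<beta> B] f(2)
  by (simp add: tree_on_def)

lemma tree_field_iso_invariant: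
  assumes "rooted_iso (tree_on (gw_verts Y t)) [] (tree_on (gw_verts X t)) []"
  shows "tree_field \<beta> B 0 t Y = tree_field \<beta> B 0 t X"
    and "t = Suc u \<Longrightarrow> tree_field \<beta> B \<beta> u Y = tree_field \<beta> B \<beta> u X"
proof -
  obtain f where f: "bij_betw f (gw_verts Y t) (gw_verts X t)" "f [] = []"
    "\<And>u v. u \<in> gw_verts Y t \<Longrightarrow> v \<in> gw_verts Y t \<Longrightarrow>
       {u, v} \<in> snd (tree_on (gw_verts Y t)) \<longleftrightarrow> {f u, f v} \<in> snd (tree_on (gw_verts X t))"
    using rooted_iso_tree_on[of "gw_verts Y t" "snd (tree_on (gw_verts Y t))" "[]" X t] assms
    by (auto simp: tree_on_def)
  have iso: "ising_expectation \<beta> B (tree_on (gw_verts Y t)) A (\<lambda>\<sigma>. \<sigma> [])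
      = ising_expectation \<beta> B (tree_on (gw_verts X t)) (f ` A) (\<lambda>\<sigma>. \<sigma> [])" if "A \<subseteq> gw_verts Y t" for A
  proof -
    have "ising_expectation \<beta> B (gw_verts Y t, snd (tree_on (gw_verts Y t))) A (\<lambda>\<sigma>. \<sigma> [])
      = ising_expectation \<beta> B (tree_on (gw_verts X t)) (f ` A) (\<lambda>\<sigma>. \<sigma> [])"
      by (rule ising_expectation_tree_iso[OF f(1,2) Nil_in_gw_verts tree_on_edge_sets _ that]) (rule f(3))
    then show ?thesis by (simp add: tree_on_def)
  qed
  have "tanh (tree_field \<beta> B 0 t Y) = tanh (tree_field \<beta> B 0 t X)"
    using iso[of "{}"] by (simp only: root_magnetization_free image_empty empty_subsetI)
  then show "tree_field \<beta> B 0 t Y = tree_field \<beta> B 0 t X" by simp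
  assume t: "t = Suc u"
  have im: "f ` tree_boundary True Y t = tree_boundary True X t"
  proof -
    have "f ` {v \<in> gw_verts Y t. length (f v) = t} = {v \<in> gw_verts X t. length v = t}"
      using f(1) by (auto simp: bij_betw_def)
    moreover have "{v \<in> gw_verts Y t. length (f v) = t} = {v \<in> gw_verts Y t. length v = t}"
    proof (rule Collect_cong)
      fix v
      have "v \<in> gw_verts Y t \<Longrightarrow> length (f v) = length v" by (rule tree_iso_length[OF f])
      then show "v \<in> gw_verts Y t \<and> length (f v) = t \<longleftrightarrow> v \<in> gw_verts Y t \<and> length v = t" by auto
    qed
    ultimately show ?thesis by (simp add: tree_boundary_def)
  qed
  have "tree_boundary True Y t \<subseteq> gw_verts Y t" by (auto simp: tree_boundary_def)
  from iso[OF this] have "tanh (tree_field \<beta> B \<beta> u Y) = tanh (tree_field \<beta> B \<beta> u X)"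
    unfolding im unfolding t by (simp only: root_magnetization_plus)
  then show "tree_field \<beta> B \<beta> u Y = tree_field \<beta> B \<beta> u X" by simp
qed

text \<open>The ball with free boundary is a subgraph. For the upper bound, fix to \<open>+1\<close> the spins in the set \<open>S\<close> of ball vertices that
correspond to generation \<open>t\<close>. An edge can leave the ball only at \<open>S\<close>, since a neighbour of a
vertex at distance below \<open>t\<close> is still in the ball.\<close>

lemma
  assumes V: "finite V" "E \<in> edge_sets V" and i: "i \<in> V" and pos: "0 \<le> \<beta>" "0 \<le> B"
    and iso: "rooted_iso (ball_graph (V, E) i t) i (tree_on (gw_verts X t)) []"
  shows magnetization_ge_free_ball: "tanh (tree_field \<beta> B 0 t X) \<le> ising_expectation \<beta> B (V, E) {} (\<lambda>\<sigma>. \<sigma> i)"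
    and magnetization_le_plus_ball: "t = Suc u \<Longrightarrow> ising_expectation \<beta> B (V, E) {} (\<lambda>\<sigma>. \<sigma> i) \<le> tanh (tree_field \<beta> B \<beta> u X)"
proof -
  define W where "W = {v \<in> V. graph_dist E i v \<le> enat t}"
  let ?EW = "{e \<in> E. e \<subseteq> W}"
  have ball: "ball_graph (V, E) i t = (W, ?EW)" by (simp add: ball_graph_def W_def Let_def)
  have W: "W \<subseteq> V" "i \<in> W" using i by (auto simp: W_def graph_dist_self)
  have EW: "?EW \<in> edge_sets W" using V(2) by (auto simp: edge_sets_def)
  obtain f where f: "bij_betw f W (gw_verts X t)" "f i = []"
    "\<And>u v. u \<in> W \<Longrightarrow> v \<in> W \<Longrightarrow> {u, v} \<in> ?EW \<longleftrightarrow> {f u, f v} \<in> snd (tree_on (gw_verts X t))"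
    using rooted_iso_tree_on[OF iso[unfolded ball]] by blast
  have tree: "ising_expectation \<beta> B (W, ?EW) A (\<lambda>\<sigma>. \<sigma> i)
      = ising_expectation \<beta> B (tree_on (gw_verts X t)) (f ` A) (\<lambda>\<sigma>. \<sigma> [])" if "A \<subseteq> W" for A
    by (rule ising_expectation_tree_iso[OF f(1,2) W(2) EW _ that]) (rule f(3))
  have "tanh (tree_field \<beta> B 0 t X) = ising_expectation \<beta> B (W, ?EW) {} (\<lambda>\<sigma>. \<sigma> i)"
    using tree[of "{}"] by (simp only: root_magnetization_free image_empty empty_subsetI)
  also have "\<dots> \<le> ising_expectation \<beta> B (V, E) {} (\<lambda>\<sigma>. \<sigma> i)"
    by (rule ising_free_subgraph_le[OF V W pos])
  finally show "tanh (tree_field \<beta> B 0 t X) \<le> ising_expectation \<beta> B (V, E) {} (\<lambda>\<sigma>. \<sigma> i)" .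
  assume t: "t = Suc u"
  define S where "S = {w \<in> W. length (f w) = t}"
  have SW: "S \<subseteq> W" by (auto simp: S_def)
  have im: "f ` S = tree_boundary True X t"
    unfolding S_def tree_boundary_def using f(1) by (auto simp: bij_betw_def)
  have out: "w \<in> S" if w: "w \<in> W" and e: "{w, v} \<in> E" and v: "v \<in> V" "v \<notin> W" for w v
  proof (rule ccontr)
    assume "w \<notin> S"
    have "f w \<in> gw_verts X t" using f(1) w bij_betwE by blast
    then have "length (f w) \<le> t" by (simp add: gw_verts_def)
    with \<open>w \<notin> S\<close> w have len: "Suc (length (f w)) \<le> t" by (auto simp: S_def)
    have "graph_dist ?EW i w \<le> enat (length (f w))"
      by (rule graph_dist_le_tree_length[OF f(1,2) W(2) f(3) w])
    then obtain xs where xs: "walk ?EW i xs w" "length xs - 1 \<le> length (f w)" by (auto simp: graph_dist_le_iff)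
    then have "walk E i xs w" by (auto simp: walk_def elim!: successively_mono)
    then have "graph_dist E i w \<le> enat (length (f w))" using xs(2) by (auto simp: graph_dist_le_iff)
    then have "graph_dist E i v \<le> enat (Suc (length (f w)))" by (rule graph_dist_step[OF _ e])
    also have "\<dots> \<le> enat t" using len by simp
    finally show False using v by (simp add: W_def)
  qed
  have "ising_expectation \<beta> B (V, E) {} (\<lambda>\<sigma>. \<sigma> i) \<le> ising_expectation \<beta> B (W, ?EW) S (\<lambda>\<sigma>. \<sigma> i)"
  proof (rule ising_plus_subgraph_ge[OF V W pos SW])
    fix e assume e: "e \<in> E" "\<not> e \<subseteq> W"
    have eV: "e \<subseteq> V" "card e = 2" using V(2) e by (auto simp: edge_sets_def)
    show "e \<subseteq> S \<union> (V - W)"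
    proof
      fix w assume w: "w \<in> e"
      obtain v where v: "v \<in> e" "v \<notin> W" using e(2) by auto
      show "w \<in> S \<union> (V - W)"
      proof (cases "w \<in> W")
        case True
        then have "w \<noteq> v" using v by auto
        then have "e = {w, v}" using eV(2) w v by (auto simp: card_2_iff)
        then show ?thesis using out[OF True] e(1) v eV by auto
      qed (use w eV in auto)
    qed
  qed
  also have "\<dots> = tanh (tree_field \<beta> B \<beta> u X)"
    unfolding tree[OF SW] im unfolding t by (rule root_magnetization_plus)
  finally show "ising_expectation \<beta> B (V, E) {} (\<lambda>\<sigma>. \<sigma> i) \<le> tanh (tree_field \<beta> B \<beta> u X)" .
qed

section \<open>Local convergence of the magnetization\<close>

text \<open>A numbering of the isomorphism classes of finite trees: the least code of a list of vertices that spans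
an isomorphic tree. It makes the class of a random tree a discrete random variable.\<close>

definition tree_code :: "nat list set \<Rightarrow> nat" where
  "tree_code F = (LEAST k. rooted_iso (tree_on F) [] (tree_on (set (from_nat k :: nat list list))) [])"

definition tree_class :: "nat \<Rightarrow> (nat list \<Rightarrow> nat) \<Rightarrow> nat" where
  "tree_class t X = tree_code (gw_verts X t)"

lemma root_in_tree_on: "[] \<in> fst (tree_on (gw_verts X t))"
  by (simp add: tree_on_def Nil_in_gw_verts)

lemma tree_class_eq_iff:
  "tree_class t X = tree_class t Y \<longleftrightarrow> rooted_iso (tree_on (gw_verts X t)) [] (tree_on (gw_verts Y t)) []"
proof -
  let ?P = "\<lambda>X k. rooted_iso (tree_on (gw_verts X t)) [] (tree_on (set (from_nat k :: nat list list))) []"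
  have ex: "?P X (tree_class t X)" for X
  proof -
    obtain xs where "set xs = gw_verts X t" using finite_list[OF finite_gw_verts] by blast
    then have "?P X (to_nat xs)" by (simp add: rooted_iso_refl)
    then show ?thesis unfolding tree_class_def tree_code_def by (rule LeastI)
  qed
  show ?thesis
  proof
    assume eq: "tree_class t X = tree_class t Y"
    show "rooted_iso (tree_on (gw_verts X t)) [] (tree_on (gw_verts Y t)) []"
      by (rule rooted_iso_trans[OF ex[of X]], unfold eq, rule rooted_iso_sym[OF ex root_in_tree_on])
  next
    assume iso: "rooted_iso (tree_on (gw_verts X t)) [] (tree_on (gw_verts Y t)) []"
    have "?P X k \<longleftrightarrow> ?P Y k" for k
      by (rule iffI) (erule rooted_iso_trans[OF rooted_iso_sym[OF iso root_in_tree_on]], erule rooted_iso_trans[OF iso])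
    then show "tree_class t X = tree_class t Y" by (simp add: tree_class_def tree_code_def)
  qed
qed

text \<open>The vertex set of a truncated tree takes countably many values, each determined by countably many
conditions on finitely many offspring numbers.\<close>

lemma measurable_tree_class [measurable]: "tree_class t \<in> measurable offspring_space (count_space UNIV)"
proof -
  have vert: "{X. v \<in> gw_verts X t} \<in> sets offspring_space" for v
  proof -
    have "{X \<in> space offspring_space. length v \<le> t \<and> (\<forall>k<length v. v ! k < X (take k v))} \<in> sets offspring_space"
      by measurable
    then show ?thesis by (simp add: gw_verts_def gw_vertices_def space_PiM conj_commute)
  qed
  have "(\<lambda>X. gw_verts X t) \<in> measurable offspring_space (count_space (Collect finite))"
    unfolding measurable_count_space_eq_countable[OF countable_Collect_finite]
  proof (intro conjI ballI)
    fix F :: "nat list set"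
    have "(\<lambda>X. gw_verts X t) -` {F} \<inter> space offspring_space
        = (\<Inter>v. if v \<in> F then {X. v \<in> gw_verts X t} else - {X. v \<in> gw_verts X t})"
      by (auto simp: space_PiM split: if_splits)
    also have "\<dots> \<in> sets offspring_space"
    proof (rule sets.countable_INT')
      show "range (\<lambda>v. if v \<in> F then {X. v \<in> gw_verts X t} else - {X. v \<in> gw_verts X t}) \<subseteq> sets offspring_space"
        using vert sets.Diff[OF sets.top vert] by (auto simp: space_PiM Compl_eq_Diff_UNIV)
    qed auto
    finally show "(\<lambda>X. gw_verts X t) -` {F} \<inter> space offspring_space \<in> sets offspring_space" .
  qed (simp add: finite_gw_verts)
  then have "(\<lambda>X. tree_code (gw_verts X t)) \<in> measurable offspring_space (count_space UNIV)"
    by (rule measurable_compose) simp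
  then show ?thesis unfolding tree_class_def[abs_def] .
qed

lemma ball_class_frequency_tendsto:
  assumes "locally_tree_like D K E"
  shows "(\<lambda>n. measure_pmf.prob (pmf_of_set {1..n})
            {i. rooted_iso (ball_graph ({1..n}, E n) i t) i (tree_on (gw_verts Y t)) []})
      \<longlonglongrightarrow> measure (offspring_law D K) {X. tree_class t X = tree_class t Y}"
proof -
  obtain T :: "nat graph" and r where T: "rooted_tree_gen t T r"
    "rooted_iso (tree_on (gw_verts Y t)) [] T r" "rooted_iso T r (tree_on (gw_verts Y t)) []"
    using gw_tree_relabel[of t Y] by (elim exE conjE)
  have ball: "rooted_iso H s T r \<longleftrightarrow> rooted_iso H s (tree_on (gw_verts Y t)) []" for H :: "nat graph" and s
    using rooted_iso_trans[OF _ T(2), of H s] rooted_iso_trans[OF _ T(3), of H s] by (rule iffI[rotated])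
  have tree: "rooted_iso (gw_tree X t) [] T r \<longleftrightarrow> tree_class t X = tree_class t Y" for X
    unfolding tree_class_eq_iff gw_tree_eq
    using rooted_iso_trans[OF _ T(2)] rooted_iso_trans[OF _ T(3)] by (rule iffI[rotated])
  show ?thesis
    using assms[unfolded locally_tree_like_def, rule_format, OF T(1)] by (simp only: ball tree)
qed

text \<open>A Fatou lemma for local convergence. Up to a small error the expectation of \<open>\<phi>\<close> is carried by finitely
many isomorphism classes, and for these the frequencies of balls converge; as \<open>a \<ge> 0\<close>, the remaining
vertices can be ignored in a lower bound.\<close>

lemma local_average_lower_bound:
  fixes \<phi> :: "(nat list \<Rightarrow> nat) \<Rightarrow> real" and a :: "nat \<Rightarrow> nat \<Rightarrow> real"
  assumes ltl: "locally_tree_like D K E"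
    and \<phi>: "\<phi> \<in> borel_measurable offspring_space" "\<And>X. 0 \<le> \<phi> X" "\<And>X. \<phi> X \<le> 1"
    and inv: "\<And>X Y. tree_class t X = tree_class t Y \<Longrightarrow> \<phi> X = \<phi> Y"
    and a: "\<And>n i. n \<ge> 1 \<Longrightarrow> i \<in> {1..n} \<Longrightarrow> 0 \<le> a n i"
    and le: "\<And>n i X. n \<ge> 1 \<Longrightarrow> i \<in> {1..n} \<Longrightarrow>
       rooted_iso (ball_graph ({1..n}, E n) i t) i (tree_on (gw_verts X t)) [] \<Longrightarrow> \<phi> X \<le> a n i"
    and c: "c < (\<integral>X. \<phi> X \<partial>offspring_law D K)"
  shows "\<forall>\<^sub>F n in sequentially. c < 1 / real n * (\<Sum>i\<in>{1..n}. a n i)"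
proof -
  let ?\<mu> = "offspring_law D K"
  interpret prob_space ?\<mu> by (rule prob_space_offspring_law)
  let ?C = "tree_class t"
  have \<phi>m [measurable]: "\<phi> \<in> borel_measurable ?\<mu>"
    unfolding measurable_cong_sets[OF sets_offspring_law refl] by (rule \<phi>(1))
  have Cm [measurable]: "?C \<in> measurable ?\<mu> (count_space UNIV)"
    unfolding measurable_cong_sets[OF sets_offspring_law refl] by (rule measurable_tree_class)
  have "(\<lambda>m. \<integral>X. \<phi> X * of_bool (?C X < m) \<partial>?\<mu>) \<longlonglongrightarrow> (\<integral>X. \<phi> X \<partial>?\<mu>)"
  proof (rule integral_dominated_convergence[where w = "\<lambda>_. 1"])
    show "AE X in ?\<mu>. (\<lambda>m. \<phi> X * of_bool (?C X < m)) \<longlonglongrightarrow> \<phi> X"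
    proof (intro always_eventually allI)
      fix X
      have "\<forall>\<^sub>F m in sequentially. \<phi> X * of_bool (?C X < m) = \<phi> X"
        using eventually_gt_at_top[of "?C X"] by eventually_elim simp
      then show "(\<lambda>m. \<phi> X * of_bool (?C X < m)) \<longlonglongrightarrow> \<phi> X" by (rule tendsto_eventually)
    qed
    show "AE X in ?\<mu>. norm (\<phi> X * of_bool (?C X < m)) \<le> 1" for m
      using \<phi>(2,3) by (intro always_eventually allI) (auto simp: of_bool_def)
    have "(\<lambda>X. of_bool (?C X < m) :: real) \<in> borel_measurable ?\<mu>" for m
      by (rule measurable_compose[OF Cm]) simp
    then show "(\<lambda>X. \<phi> X * of_bool (?C X < m)) \<in> borel_measurable ?\<mu>" for m
      by (intro borel_measurable_times \<phi>m)
    show "integrable ?\<mu> (\<lambda>_. 1 :: real)" by simp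
  qed (rule \<phi>m)
  then have "\<forall>\<^sub>F m in sequentially. c < (\<integral>X. \<phi> X * of_bool (?C X < m) \<partial>?\<mu>)"
    using c by (rule order_tendstoD)
  then obtain m where m: "c < (\<integral>X. \<phi> X * of_bool (?C X < m) \<partial>?\<mu>)"
    by (auto simp: eventually_sequentially)
  \<comment> \<open>The finitely many classes that are kept, each with a representative tree.\<close>
  define J where "J = range ?C \<inter> {..<m}"
  have J: "finite J" by (simp add: J_def)
  define Y where "Y = (\<lambda>k. SOME X. ?C X = k)"
  have Y: "?C (Y k) = k" if "k \<in> J" for k
  proof -
    have "\<exists>X. ?C X = k" using that by (auto simp: J_def)
    then show ?thesis unfolding Y_def by (rule someI_ex)
  qed
  have meas: "{X. ?C X = k} \<in> sets ?\<mu>" for k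
    using measurable_sets[OF Cm, of "{k}"] by (simp add: vimage_def)
  have "\<phi> X * of_bool (?C X < m) = (\<Sum>k\<in>J. \<phi> (Y k) * indicator {X. ?C X = k} X)" for X
  proof (cases "?C X < m")
    case True
    then have XJ: "?C X \<in> J" by (simp add: J_def)
    have "(\<Sum>k\<in>J. \<phi> (Y k) * indicator {X. ?C X = k} X) = (\<Sum>k\<in>{?C X}. \<phi> (Y k) * indicator {X. ?C X = k} X)"
      using XJ J by (intro sum.mono_neutral_right) (auto simp: indicator_def)
    also have "\<dots> = \<phi> X" using inv[OF Y[OF XJ]] by simp
    finally show ?thesis using True by simp
  next
    case False
    then have "(\<Sum>k\<in>J. \<phi> (Y k) * indicator {X. ?C X = k} X) = 0"
      by (intro sum.neutral) (auto simp: J_def indicator_def)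
    then show ?thesis using False by simp
  qed
  then have "(\<integral>X. \<phi> X * of_bool (?C X < m) \<partial>?\<mu>) = (\<integral>X. (\<Sum>k\<in>J. \<phi> (Y k) * indicator {X. ?C X = k} X) \<partial>?\<mu>)"
    by simp
  also have "\<dots> = (\<Sum>k\<in>J. \<integral>X. \<phi> (Y k) * indicator {X. ?C X = k} X \<partial>?\<mu>)"
    using meas by (intro Bochner_Integration.integral_sum) (auto simp: emeasure_eq_measure)
  also have "\<dots> = (\<Sum>k\<in>J. \<phi> (Y k) * measure ?\<mu> {X. ?C X = k})" by simp
  finally have sum: "c < (\<Sum>k\<in>J. \<phi> (Y k) * measure ?\<mu> {X. ?C X = k})" using m by simp
  let ?I = "\<lambda>n k. {i. rooted_iso (ball_graph ({1..n}, E n) i t) i (tree_on (gw_verts (Y k) t)) []}"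
  have "(\<lambda>n. \<Sum>k\<in>J. \<phi> (Y k) * measure_pmf.prob (pmf_of_set {1..n}) (?I n k))
      \<longlonglongrightarrow> (\<Sum>k\<in>J. \<phi> (Y k) * measure ?\<mu> {X. ?C X = k})"
  proof (intro tendsto_sum tendsto_mult tendsto_const)
    fix k assume "k \<in> J"
    then show "(\<lambda>n. measure_pmf.prob (pmf_of_set {1..n}) (?I n k)) \<longlonglongrightarrow> measure ?\<mu> {X. ?C X = k}"
      using ball_class_frequency_tendsto[OF ltl, of t "Y k"] Y by simp
  qed
  then have "\<forall>\<^sub>F n in sequentially. c < (\<Sum>k\<in>J. \<phi> (Y k) * measure_pmf.prob (pmf_of_set {1..n}) (?I n k))"
    using sum by (rule order_tendstoD)
  then show ?thesis
    using eventually_ge_at_top[of "1::nat"]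
  proof eventually_elim
    case (elim n)
    have ball_root: "i \<in> fst (ball_graph ({1..n}, E n) i t)" if "i \<in> {1..n}" for i
      using that by (simp add: ball_graph_def Let_def graph_dist_self)
    have point: "(\<Sum>k\<in>J. \<phi> (Y k) * indicator (?I n k) i) \<le> a n i" if i: "i \<in> {1..n}" for i
    proof (cases "\<exists>k\<in>J. i \<in> ?I n k")
      case True
      then obtain k where k: "k \<in> J" "i \<in> ?I n k" by blast
      have uniq: "k' = k" if k': "k' \<in> J" "i \<in> ?I n k'" for k'
      proof -
        have iso: "rooted_iso (ball_graph ({1..n}, E n) i t) i (tree_on (gw_verts (Y k) t)) []"
          "rooted_iso (ball_graph ({1..n}, E n) i t) i (tree_on (gw_verts (Y k') t)) []"
          using k(2) k'(2) by simp_all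
        have "rooted_iso (tree_on (gw_verts (Y k') t)) [] (tree_on (gw_verts (Y k) t)) []"
          by (rule rooted_iso_trans[OF rooted_iso_sym[OF iso(2) ball_root[OF i]] iso(1)])
        then have "?C (Y k') = ?C (Y k)" by (simp add: tree_class_eq_iff)
        then show ?thesis using Y k k' by simp
      qed
      have "(\<Sum>k\<in>J. \<phi> (Y k) * indicator (?I n k) i) = (\<Sum>k\<in>{k}. \<phi> (Y k) * indicator (?I n k) i)"
        using k(1) J uniq by (intro sum.mono_neutral_right) (auto simp: indicator_def)
      also have "\<dots> = \<phi> (Y k)" using k(2) by simp
      also have "\<dots> \<le> a n i" using le[OF elim(2) i] k(2) by simp
      finally show ?thesis .
    next
      case False
      then have "(\<Sum>k\<in>J. \<phi> (Y k) * indicator (?I n k) i) = 0" by (intro sum.neutral) auto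
      then show ?thesis using a[OF elim(2) i] by simp
    qed
    have freq: "measure_pmf.prob (pmf_of_set {1..n}) (?I n k) = 1 / real n * (\<Sum>i\<in>{1..n}. indicator (?I n k) i)" for k
    proof -
      have "(\<Sum>i\<in>{1..n}. indicator (?I n k) i :: real) = real (card ({1..n} \<inter> ?I n k))"
        unfolding indicator_def by (subst sum_of_bool_eq) simp_all
      then show ?thesis using elim(2) by (subst measure_pmf_of_set) auto
    qed
    have "(\<Sum>k\<in>J. \<phi> (Y k) * measure_pmf.prob (pmf_of_set {1..n}) (?I n k))
        = 1 / real n * (\<Sum>k\<in>J. \<Sum>i\<in>{1..n}. \<phi> (Y k) * indicator (?I n k) i)"
      unfolding freq sum_distrib_left by (intro sum.cong refl) (simp only: mult_ac)
    also have "\<dots> = 1 / real n * (\<Sum>i\<in>{1..n}. \<Sum>k\<in>J. \<phi> (Y k) * indicator (?I n k) i)"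
      by (subst sum.swap) simp
    also have "\<dots> \<le> 1 / real n * (\<Sum>i\<in>{1..n}. a n i)"
      by (intro mult_left_mono sum_mono point) auto
    finally show ?case using elim(1) by simp
  qed
qed

text \<open>The lower bound on averages is applied to \<open>(1 + \<langle>\<sigma> i\<rangle>) / 2\<close> with free balls and to
\<open>(1 - \<langle>\<sigma> i\<rangle>) / 2\<close> with plus balls; both lie in \<open>[0, 1]\<close>, and the second one gives the upper bound.\<close>

lemma magnetization_eq_bethe:
  assumes ltl: "locally_tree_like D K E" and E: "\<And>n. n \<ge> 1 \<Longrightarrow> E n \<in> edge_sets {1..n}"
    and \<beta>: "0 \<le> \<beta>" and B: "0 < B"
  shows "magnetization E \<beta> B = bethe_magnetization D K \<beta> B"
proof -
  let ?m = "bethe_magnetization D K \<beta> B" and ?\<mu> = "offspring_law D K"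
  interpret prob_space ?\<mu> by (rule prob_space_offspring_law)
  let ?s = "\<lambda>n i. ising_expectation \<beta> B ({1..n}, E n) {} (\<lambda>\<sigma>. \<sigma> i)"
  have abs: "\<bar>?s n i\<bar> \<le> 1" if "i \<in> {1..n}" for n i
    using that by (intro abs_ising_magnetization_le) auto
  have average: "1 / real n * (\<Sum>i\<in>{1..n}. 1 + e * ?s n i) = 1 + e * finite_magnetization E n \<beta> B"
    if "1 \<le> n" for n and e :: real
    using that by (simp add: finite_magnetization_def sum.distrib field_simps sum_distrib_left)
  have affine: "(\<integral>X. 1 + e * tanh (f X) \<partial>?\<mu>) = 1 + e * (\<integral>X. tanh (f X) \<partial>?\<mu>)"
    if "f \<in> borel_measurable offspring_space" for f and e :: real
    using integrable_tanh[OF that, of D K] by (simp add: prob_space[simplified])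
  have half: "(\<integral>X. (1 + e * tanh (f X)) / 2 \<partial>?\<mu>) = (1 + e * (\<integral>X. tanh (f X) \<partial>?\<mu>)) / 2"
    if "f \<in> borel_measurable offspring_space" for f and e :: real
    using affine[OF that, of e] by simp
  have tb: "- 1 \<le> tanh x" "tanh x \<le> 1" for x :: real using abs_tanh_lt_1[of x] by auto
  have free_inv: "tree_field \<beta> B 0 t X = tree_field \<beta> B 0 t Y" if "tree_class t X = tree_class t Y" for t X Y
    using that tree_field_iso_invariant(1) unfolding tree_class_eq_iff by blast
  have plus_inv: "tree_field \<beta> B \<beta> u X = tree_field \<beta> B \<beta> u Y" if "tree_class (Suc u) X = tree_class (Suc u) Y" for u X Y
    using that tree_field_iso_invariant(2)[OF _ refl] unfolding tree_class_eq_iff by blast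
  have lower: "\<forall>\<^sub>F n in sequentially. c < finite_magnetization E n \<beta> B" if "c < ?m" for c
  proof -
    have "\<forall>\<^sub>F t in sequentially. c < (\<integral>X. tanh (tree_field \<beta> B 0 t X) \<partial>?\<mu>)"
      using magnetization_free_tendsto[OF \<beta> B] that by (rule order_tendstoD)
    then obtain t where t: "c < (\<integral>X. tanh (tree_field \<beta> B 0 t X) \<partial>?\<mu>)" by (auto simp: eventually_sequentially)
    have "\<forall>\<^sub>F n in sequentially. (1 + 1 * c) / 2 < 1 / real n * (\<Sum>i\<in>{1..n}. (1 + 1 * ?s n i) / 2)"
    proof (rule local_average_lower_bound[OF ltl, where t = t and \<phi> = "\<lambda>X. (1 + 1 * tanh (tree_field \<beta> B 0 t X)) / 2"])
      show "(1 + 1 * c) / 2 < (\<integral>X. (1 + 1 * tanh (tree_field \<beta> B 0 t X)) / 2 \<partial>?\<mu>)"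
        unfolding half[OF measurable_tree_field] using t by simp
      show "(1 + 1 * tanh (tree_field \<beta> B 0 t X)) / 2 \<le> (1 + 1 * ?s n i) / 2"
        if "n \<ge> 1" "i \<in> {1..n}" "rooted_iso (ball_graph ({1..n}, E n) i t) i (tree_on (gw_verts X t)) []" for n i X
        using magnetization_ge_free_ball[OF _ E[OF that(1)] that(2) \<beta> _ that(3)] B by simp
      show "0 \<le> (1 + 1 * ?s n i) / 2" if "i \<in> {1..n}" for n i using abs[OF that] by simp
      show "(1 + 1 * tanh (tree_field \<beta> B 0 t X)) / 2 = (1 + 1 * tanh (tree_field \<beta> B 0 t Y)) / 2"
        if "tree_class t X = tree_class t Y" for X Y using free_inv[OF that] by simp
      show "0 \<le> (1 + 1 * tanh (tree_field \<beta> B 0 t X)) / 2" "(1 + 1 * tanh (tree_field \<beta> B 0 t X)) / 2 \<le> 1" for X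
        using tb[of "tree_field \<beta> B 0 t X"] by simp_all
      show "(\<lambda>X. (1 + 1 * tanh (tree_field \<beta> B 0 t X)) / 2) \<in> borel_measurable offspring_space" by measurable
    qed
    then show ?thesis using eventually_ge_at_top[of "1::nat"]
    proof eventually_elim
      case (elim n)
      then show ?case using average[OF elim(2), of 1] by (simp add: sum_divide_distrib[symmetric])
    qed
  qed
  have upper: "\<forall>\<^sub>F n in sequentially. finite_magnetization E n \<beta> B < c" if "?m < c" for c
  proof -
    have "\<forall>\<^sub>F t in sequentially. (\<integral>X. tanh (tree_field \<beta> B \<beta> t X) \<partial>?\<mu>) < c"
      using magnetization_plus_tendsto[OF \<beta> B] that by (rule order_tendstoD)
    then obtain u where u: "(\<integral>X. tanh (tree_field \<beta> B \<beta> u X) \<partial>?\<mu>) < c" by (auto simp: eventually_sequentially)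
    have "\<forall>\<^sub>F n in sequentially. (1 + (-1) * c) / 2 < 1 / real n * (\<Sum>i\<in>{1..n}. (1 + (-1) * ?s n i) / 2)"
    proof (rule local_average_lower_bound[OF ltl, where t = "Suc u" and \<phi> = "\<lambda>X. (1 + (-1) * tanh (tree_field \<beta> B \<beta> u X)) / 2"])
      show "(1 + (-1) * c) / 2 < (\<integral>X. (1 + (-1) * tanh (tree_field \<beta> B \<beta> u X)) / 2 \<partial>?\<mu>)"
        unfolding half[OF measurable_tree_field] using u by simp
      show "(1 + (-1) * tanh (tree_field \<beta> B \<beta> u X)) / 2 \<le> (1 + (-1) * ?s n i) / 2"
        if "n \<ge> 1" "i \<in> {1..n}" "rooted_iso (ball_graph ({1..n}, E n) i (Suc u)) i (tree_on (gw_verts X (Suc u))) []" for n i X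
        using magnetization_le_plus_ball[OF _ E[OF that(1)] that(2) \<beta> _ that(3) refl] B by simp
      show "0 \<le> (1 + (-1) * ?s n i) / 2" if "i \<in> {1..n}" for n i using abs[OF that] by simp
      show "(1 + (-1) * tanh (tree_field \<beta> B \<beta> u X)) / 2 = (1 + (-1) * tanh (tree_field \<beta> B \<beta> u Y)) / 2"
        if "tree_class (Suc u) X = tree_class (Suc u) Y" for X Y using plus_inv[OF that] by simp
      show "0 \<le> (1 + (-1) * tanh (tree_field \<beta> B \<beta> u X)) / 2" "(1 + (-1) * tanh (tree_field \<beta> B \<beta> u X)) / 2 \<le> 1" for X
        using tb[of "tree_field \<beta> B \<beta> u X"] by simp_all
      show "(\<lambda>X. (1 + (-1) * tanh (tree_field \<beta> B \<beta> u X)) / 2) \<in> borel_measurable offspring_space" by measurable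
    qed
    then show ?thesis using eventually_ge_at_top[of "1::nat"]
    proof eventually_elim
      case (elim n)
      then show ?case using average[OF elim(2), of "-1"] by (simp add: sum_divide_distrib[symmetric])
    qed
  qed
  have "(\<lambda>n. finite_magnetization E n \<beta> B) \<longlonglongrightarrow> ?m"
    by (rule order_tendstoI[OF lower upper])
  then show ?thesis unfolding magnetization_def by (rule limI)
qed

theorem theorem2p7:
  fixes \<Omega> :: "'w measure"
    and G :: "nat \<Rightarrow> 'w \<Rightarrow> nat set set"
    and P K :: "nat pmf"
    and \<nu> :: ennreal
  assumes P_pos: "pmf P 0 = 0"
    and mean_finite: "integrable (measure_pmf P) real"
    and forward: "\<And>k. pmf K k = (real k + 1) * pmf P (k + 1) / measure_pmf.expectation P real"
    and nu: "\<nu> = (\<integral>\<^sup>+k. ennreal (real k) \<partial>measure_pmf K)"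
    and prob: "prob_space \<Omega>"
    and random_graph: "\<And>n. n \<ge> 1 \<Longrightarrow> G n \<in> measurable \<Omega> (count_space (edge_sets {1..n}))"
    and tree_like: "AE \<omega> in \<Omega>. locally_tree_like P K (\<lambda>n. G n \<omega>)"
    and sparse: "AE \<omega> in \<Omega>. uniformly_sparse (\<lambda>n. G n \<omega>)"
  shows "(AE \<omega> in \<Omega>. critical_temperature (magnetization (\<lambda>n. G n \<omega>)) = ext_artanh (1 / \<nu>)) \<and>
         critical_temperature (bethe_magnetization P K) = ext_artanh (1 / \<nu>)"
proof
  show "critical_temperature (bethe_magnetization P K) = ext_artanh (1 / \<nu>)"
    by (rule critical_temperature_eqI[OF P_pos mean_finite nu refl])
  show "AE \<omega> in \<Omega>. critical_temperature (magnetization (\<lambda>n. G n \<omega>)) = ext_artanh (1 / \<nu>)"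
    using tree_like AE_space
  proof eventually_elim
    case (elim \<omega>)
    have edges: "G n \<omega> \<in> edge_sets {1..n}" if "n \<ge> 1" for n
      using measurable_space[OF random_graph[OF that] elim(2)] by simp
    show ?case
      by (rule critical_temperature_eqI[OF P_pos mean_finite nu magnetization_eq_bethe[OF elim(1) edges]])
  qed
qed

end
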